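(* Let $\mu\subseteq\lambda$ be partitions and $r\ge0$. Then \[ P_{\lambda/\mu}\, s_r=\sum_{\lambda^+,\mu^-}(-1)^{|\mu/\mu^-|}\,\mathrm{sk}_{\lambda^+/\lambda}(t)\,\mathrm{vs}_{\mu/\mu^-}(t)\,P_{\lambda^+/\mu^-}, \] where the sum is over all partitions $\lambda^+\supseteq\lambda$ and $\mu^-\subseteq\mu$ with $|\lambda^+/\lambda|+|\mu/\mu^-|=r$.
   Context: $\Lambda[t]$ is the ring of symmetric functions over $\mathbb{Q}(t)$; $s_r$ is the Schur function of the one-row shape $(r)$, $P_\lambda=P_\lambda(t)$ are Hall--Littlewood functions. Let $Q_\lambda=b_\lambda(t)P_\lambda$ with $b_\lambda(t)=\prod_{i\ge1}(1-t)(1-t^2)\cdots(1-t^{m_i(\lambda)})$, and let $\langle\cdot,\cdot\rangle$ be the scalar product on $\Lambda[t]$ with $\langle P_\lambda,Q_\mu\rangle=\delta_{\lambda\mu}$. For $\mu\subseteq\lambda$, $P_{\lambda/\mu}$ is the unique element with $\langle P_{\lambda/\mu},Q_\nu\rangle=\langle P_\lambda,Q_\nu Q_\mu\rangle$ for all $\nu$. Notation: $\lambda^c$ is the conjugate partition, $m_j(\lambda)$ the number of parts equal to $j$, $|\lambda/\mu|=|\lambda|-|\mu|$, $\begin{bmatrix} a\\ b\end{bmatrix}_t=\frac{(1-t^a)\cdots(1-t^{a-b+1})}{(1-t^b)\cdots(1-t)}$. $\lambda/\mu$ is a vertical strip if $\lambda_i\le\mu_i+1$ for all $i$; $\mathrm{vs}_{\lambda/\mu}(t)=\prod_{j\ge1}\begin{bmatrix}\lambda^c_j-\lambda^c_{j+1}\\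 \lambda^c_j-\mu^c_j\end{bmatrix}_t$ if $\lambda/\mu$ is a vertical strip and $0$ otherwise. For $\mu\subseteq\lambda$, $\mathrm{sk}_{\lambda/\mu}(t)=t^{\sum_j\binom{\lambda^c_j-\mu^c_j}{2}}\prod_{j\ge1}\begin{bmatrix}\lambda^c_j-\mu^c_{j+1}\\ m_j(\mu)\end{bmatrix}_t$. *)

theory Defs
  imports "HOL-Library.Poly_Mapping" "HOL-Library.Multiset"
          "HOL-Computational_Algebra.Polynomial" "HOL-Computational_Algebra.Fraction_Field"
          "HOL-Combinatorics.Permutations"
begin

type_synonym Qt = "rat poly fract"

definition tt :: Qt where "tt = Fract [:0, 1:] 1"

definition is_partition :: "nat list \<Rightarrow> bool" where
  "is_partition la \<longleftrightarrow> sorted_wrt (\<ge>) la \<and> 0 \<notin> set la"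

definition part :: "nat list \<Rightarrow> nat \<Rightarrow> nat" where
  "part la i = (if i < length la then la ! i else 0)"

definition psize :: "nat list \<Rightarrow> nat" where
  "psize la = sum_list la"

text \<open>conjugate partition: conj la j = lambda^c_j (j >= 1)\<close>
definition conj :: "nat list \<Rightarrow> nat \<Rightarrow> nat" where
  "conj la j = length (filter (\<lambda>x. j \<le> x) la)"

definition mult :: "nat list \<Rightarrow> nat \<Rightarrow> nat" where
  "mult la j = length (filter (\<lambda>x. x = j) la)"

definition contained :: "nat list \<Rightarrow> nat list \<Rightarrow> bool" where
  "contained mu la \<longleftrightarrow> (\<forall>i. part mu i \<le> part la i)"

definition vertical_strip :: "nat list \<Rightarrow> nat list \<Rightarrow> bool" where
  "vertical_strip la mu \<longleftrightarrow> contained mu la \<and> (\<forall>i. part la i \<le> part mu i + 1)"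

definition dominated_strict :: "nat list \<Rightarrow> nat list \<Rightarrow> bool" where
  "dominated_strict mu la \<longleftrightarrow> mu \<noteq> la \<and> psize mu = psize la \<and>
     (\<forall>k. (\<Sum>i<k. part mu i) \<le> (\<Sum>i<k. part la i))"

definition qbinom :: "nat \<Rightarrow> nat \<Rightarrow> Qt" where
  "qbinom a b = (\<Prod>i<b. 1 - tt ^ (a - i)) / (\<Prod>i<b. 1 - tt ^ (i + 1))"

definition vs :: "nat list \<Rightarrow> nat list \<Rightarrow> Qt" where
  "vs la mu = (if vertical_strip la mu then
      (\<Prod>j\<in>{1..psize la}. qbinom (conj la j - conj la (j+1)) (conj la j - conj mu j))
    else 0)"

definition sk :: "nat list \<Rightarrow> nat list \<Rightarrow> Qt" where
  "sk la mu = tt ^ (\<Sum>j\<in>{1..psize la}. (conj la j - conj mu j) choose 2) *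
      (\<Prod>j\<in>{1..psize la}. qbinom (conj la j - conj mu (j+1)) (mult mu j))"

text \<open>Lambda[t] = Q(t)[p_1, p_2, ...] is modelled as the monoid algebra of finite
 multisets of natural numbers; the multiset element k stands for the power sum
 p_(k+1). So the basis element indexed by a multiset K is the power-sum p_rho.\<close>

type_synonym Lam = "(nat multiset) \<Rightarrow>\<^sub>0 Qt"

definition pkey :: "nat list \<Rightarrow> nat multiset" where
  "pkey rho = mset (map (\<lambda>k. k - 1) rho)"

definition powsum :: "nat list \<Rightarrow> Lam" where
  "powsum rho = Poly_Mapping.single (pkey rho) 1"

definition cst :: "Qt \<Rightarrow> Lam" where
  "cst c = Poly_Mapping.single {#} c"

definition zrho :: "nat multiset \<Rightarrow> Qt" where
  "zrho K = (\<Prod>k\<in>set_mset K. of_nat ((k + 1) ^ count K k * fact (count K k)))"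

definition zt :: "nat multiset \<Rightarrow> Qt" where
  "zt K = zrho K * (\<Prod>k\<in>set_mset K. 1 / (1 - tt ^ (k + 1)) ^ count K k)"

definition hl_inner :: "Lam \<Rightarrow> Lam \<Rightarrow> Qt" where
  "hl_inner f g = (\<Sum>K\<in>Poly_Mapping.keys f. Poly_Mapping.lookup f K * Poly_Mapping.lookup g K * zt K)"

definition hcomp :: "nat \<Rightarrow> Lam" where
  "hcomp r = (\<Sum>rho\<in>{rho. is_partition rho \<and> psize rho = r}.
                cst (1 / zrho (pkey rho)) * powsum rho)"

definition hcomp_int :: "int \<Rightarrow> Lam" where
  "hcomp_int k = (if k < 0 then 0 else hcomp (nat k))"

text \<open>Schur functions via Jacobi-Trudi: s_la = det(h_(la_i - i + j))\<close>
definition schur :: "nat list \<Rightarrow> Lam" where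
  "schur la = (let n = length la in
     (\<Sum>\<sigma>\<in>{\<sigma>. \<sigma> permutes {..<n}}. of_int (sign \<sigma>) *
        (\<Prod>i<n. hcomp_int (int (part la i) - int i + int (\<sigma> i)))))"

text \<open>Hall-Littlewood P_la: the unique element with P_la = s_la + sum_(mu < la) w s_mu
 (dominance) and <P_la, P_mu> = 0 for la /= mu (Macdonald III).\<close>
definition HL_P :: "nat list \<Rightarrow> Lam" where
  "HL_P = (THE P. (\<forall>la. \<not> is_partition la \<longrightarrow> P la = 0) \<and> (\<forall>la. is_partition la \<longrightarrow>
      (\<exists>c. P la = schur la + (\<Sum>mu\<in>{mu. is_partition mu \<and> dominated_strict mu la}.
                                   cst (c mu) * schur mu))
      \<and> (\<forall>mu. is_partition mu \<and> mu \<noteq> la \<longrightarrow> hl_inner (P la) (P mu) = 0)))"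

definition bfac :: "nat list \<Rightarrow> Qt" where
  "bfac la = (\<Prod>i\<in>set la. \<Prod>k\<in>{1..mult la i}. 1 - tt ^ k)"

definition HL_Q :: "nat list \<Rightarrow> Lam" where
  "HL_Q la = cst (bfac la) * HL_P la"

definition HL_P_skew :: "nat list \<Rightarrow> nat list \<Rightarrow> Lam" where
  "HL_P_skew la mu = (THE f. \<forall>nu. is_partition nu \<longrightarrow>
      hl_inner f (HL_Q nu) = hl_inner (HL_P la) (HL_Q nu * HL_Q mu))"

end

theory Submission
  imports
    "Jordan_Normal_Form.Determinant"
    "HOL-Computational_Algebra.Formal_Power_Series"
    "HOL-Library.Multiset_Order"
    Defs
begin

text \<open>
  Adjoints with respect to the Hall--Littlewood scalar product satisfy
  \<open>(g\<^sup>\<bottom> f) h\<^sub>r = \<Sum>\<^sub>j (-1)\<^sup>j (e\<^sub>j\<^sup>\<bottom> g)\<^sup>\<bottom> (h\<^bsub>r-j\<^esub> f)\<close>. Taking \<open>g = Q\<^sub>\<mu>\<close> and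
  \<open>f = P\<^sub>\<lambda>\<close>, so that \<open>g\<^sup>\<bottom> f = P\<^bsub>\<lambda>/\<mu>\<^esub>\<close>, reduces the theorem to the two expansions
  \<open>e\<^sub>j\<^sup>\<bottom> Q\<^sub>\<mu> = \<Sum> vs\<^bsub>\<mu>/\<nu>\<^esub> Q\<^sub>\<nu>\<close> and \<open>h\<^sub>r P\<^sub>\<lambda> = \<Sum> sk\<^bsub>\<rho>/\<lambda>\<^esub> P\<^sub>\<rho>\<close>.

  Both come from Jing's vertex operators \<open>B\<^sub>n\<close>. Set \<open>Q\<^sub>\<lambda> = B\<^bsub>\<lambda>\<^sub>1\<^esub> B\<^bsub>\<lambda>\<^sub>2\<^esub> \<dots> 1\<close>. The operators obey
  \<open>B\<^sub>m B\<^bsub>m+1\<^esub> = t B\<^bsub>m+1\<^esub> B\<^sub>m\<close>, \<open>e\<^sub>r B\<^sub>n = B\<^sub>n e\<^sub>r + B\<^bsub>n+1\<^esub> e\<^bsub>r-1\<^esub>\<close> and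
  \<open>e\<^sub>r\<^sup>\<bottom> B\<^sub>n = B\<^sub>n e\<^sub>r\<^sup>\<bottom> + B\<^bsub>n-1\<^esub> e\<^bsub>r-1\<^esub>\<^sup>\<bottom>\<close>, so the noncommutative \<open>t\<close>-binomial theorem, applied
  to each block of equal parts, yields the expansions of \<open>e\<^sub>r Q\<^sub>\<lambda>\<close> and \<open>e\<^sub>r\<^sup>\<bottom> Q\<^sub>\<lambda>\<close>. Comparing
  the two shows that \<open>Q\<close> and \<open>P = Q / b\<close> are dual. The rule for \<open>h\<^sub>r\<close> follows from the one for
  \<open>e\<^sub>r\<close> and \<open>\<Sum>\<^sub>i (-1)\<^sup>i e\<^sub>i h\<^bsub>r-i\<^esub> = 0\<close>, because the alternating sum of \<open>sk \<cdot> vs\<close> factors over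
  columns.

  To see that these \<open>P\<close> are the functions characterized by triangularity, the same construction
  is run with \<open>t\<close> replaced by \<open>0\<close>, where it produces the Jacobi--Trudi determinants: in both cases the
  \<open>e\<close>-Pieri rule gives unitriangularity with respect to products of elementary functions.
\<close>

text \<open>The definitions give P only implicitly and describe the ring by power sums, so no Pieri
  coefficient can be read off from them; explicit operators make them computable. In power-sum
  coordinates p_k^perp is k/(1-t^k) times d/dp_k. Hence H(z) is an eigenvector of p_k^perp with
  eigenvalue z^k/(1-t^k), while E^perp(-z) is the substitution p_k -> p_k - z^k/(1-t^k). Moving
  g^perp past multiplication by H(z) therefore replaces g by E^perp(-z) g, and this is the adjoint
  formula. The operator relations have the same origin: S and E^perp are substitutions that multiply
  Q(z) and E(z) by simple rational factors. Column lengths, not rows, are the working coordinates: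
  vertical strips become independent intervals, one per column, so that sums over strips are sums
  over product sets.\<close>

text \<open>Characteristic 0 is needed to cancel \<open>of_nat n\<close> in
  \<open>newton_unique\<close> and to have \<open>zrho\<close> nonzero.\<close>

instance fract :: ("{idom, ring_char_0}") ring_char_0
proof
  show "inj (of_nat :: nat \<Rightarrow> 'a fract)"
    by (rule injI) (simp add: of_nat_fract eq_fract)
qed

text \<open>The one place where \<open>tt\<close> is unfolded: all later arguments use only that t
  is not a root of unity.\<close>

lemma tt_power_neq_1: "n > 0 \<Longrightarrow> tt ^ n \<noteq> 1"
proof
  assume n: "n > 0" and eq: "tt ^ n = 1"
  have "tt ^ k = Fract (monom 1 k) 1" for k
    by (induction k) (simp_all add: tt_def One_fract_def monom_0 monom_Suc pCons_one)
  with eq have "monom (1::rat) n = 1" by (simp add: One_fract_def eq_fract)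
  then have "degree (monom (1::rat) n) = 0" by simp
  with n show False by (simp add: degree_monom_eq)
qed

section \<open>The power-sum algebra: coefficients, induction, linear extension\<close>

text \<open>The power sum p_(k+1). This shift is the source of every \<open>Suc k\<close> in degrees
  and exponents below.\<close>

definition pk :: "nat \<Rightarrow> Lam" where "pk k = Poly_Mapping.single {#k#} 1"

lemma lookup_single_mult:
  "Poly_Mapping.lookup (Poly_Mapping.single A a * f) K =
     (if A \<subseteq># K then a * Poly_Mapping.lookup f (K - A) else (0::Qt))"
proof -
  have "Sum_any (\<lambda>q. Poly_Mapping.lookup f q when K = A + q) =
    Sum_any (\<lambda>q. (if A \<subseteq># K then Poly_Mapping.lookup f (K - A) else 0) when q = K - A)"
    by (rule Sum_any.cong) (auto simp: when_def)
  then have *: "Sum_any (\<lambda>q. Poly_Mapping.lookup f q when K = A + q) =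
    (if A \<subseteq># K then Poly_Mapping.lookup f (K - A) else 0)" by simp
  show ?thesis
    by (simp add: lookup_mult lookup_single when_mult * cong: when_cong)
qed

lemma lookup_cst_mult [simp]: "Poly_Mapping.lookup (cst c * f) K = c * Poly_Mapping.lookup f K"
  by (simp add: cst_def lookup_single_mult)

lemma lookup_pk_mult: "Poly_Mapping.lookup (pk k * f) K =
    (if k \<in># K then Poly_Mapping.lookup f (K - {#k#}) else 0)"
  by (simp add: pk_def lookup_single_mult)

lemma cst_0 [simp]: "cst 0 = 0" and cst_1 [simp]: "cst 1 = 1"
  and cst_add: "cst (a + b) = cst a + cst b"
  and cst_diff: "cst (a - b) = cst a - cst b"
  and cst_minus: "cst (- a) = - cst a"
  and cst_mult: "cst (a * b) = cst a * cst b"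
  by (simp_all add: cst_def single_add single_diff single_uminus mult_single flip: single_one)

lemma cst_power: "cst (a ^ n) = cst a ^ n"
  by (induction n) (simp_all add: cst_mult)

lemma cst_sum: "cst (sum f A) = (\<Sum>x\<in>A. cst (f x))"
  by (induction A rule: infinite_finite_induct) (simp_all add: cst_add)

lemma cst_of_nat: "cst (of_nat n) = of_nat n"
  by (induction n) (simp_all add: cst_add)

lemma single_add_mset: "Poly_Mapping.single (add_mset k K) (1::Qt) = pk k * Poly_Mapping.single K 1"
  by (simp add: pk_def mult_single)

lemma Lam_expand: "f = (\<Sum>K\<in>Poly_Mapping.keys f. cst (Poly_Mapping.lookup f K) * Poly_Mapping.single K 1)"
proof (rule poly_mapping_eqI)
  fix L
  have "Poly_Mapping.lookup (\<Sum>K\<in>Poly_Mapping.keys f. cst (Poly_Mapping.lookup f K) * Poly_Mapping.single K 1) L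
      = (\<Sum>K\<in>Poly_Mapping.keys f. if K = L then Poly_Mapping.lookup f K else 0)"
    by (simp add: lookup_sum lookup_single when_def if_distrib cong: if_cong)
  also have "\<dots> = Poly_Mapping.lookup f L"
    by (simp add: sum.delta in_keys_iff)
  finally show "Poly_Mapping.lookup f L = Poly_Mapping.lookup (\<Sum>K\<in>Poly_Mapping.keys f. cst (Poly_Mapping.lookup f K) * Poly_Mapping.single K 1) L"
    by simp
qed

lemma Lam_induct_single [case_names single add scale]:
  assumes single: "\<And>K. P (Poly_Mapping.single K 1)"
    and add: "\<And>f g. P f \<Longrightarrow> P g \<Longrightarrow> P (f + g)"
    and scale: "\<And>c f. P f \<Longrightarrow> P (cst c * f)"
  shows "P f"
proof -
  have zero: "P 0" using scale[OF single, of 0] by simp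
  have "P (\<Sum>K\<in>A. cst (Poly_Mapping.lookup f K) * Poly_Mapping.single K 1)" if "finite A" for A
    using that by (induction A rule: finite_induct) (auto intro: zero add scale single)
  from this[of "Poly_Mapping.keys f"] show ?thesis
    using Lam_expand[of f] by simp
qed

text \<open>The power sums generate the algebra, so properties compatible with a product rule can be
  built up one generator at a time.\<close>

lemma Lam_induct [case_names one add scale mult]:
  assumes one: "P 1"
    and add: "\<And>f g. P f \<Longrightarrow> P g \<Longrightarrow> P (f + g)"
    and scale: "\<And>c f. P f \<Longrightarrow> P (cst c * f)"
    and mult: "\<And>k f. P f \<Longrightarrow> P (pk k * f)"
  shows "P f"
proof (rule Lam_induct_single)
  show "P (Poly_Mapping.single K 1)" for K
    by (induction K) (use one mult in \<open>simp_all add: single_add_mset\<close>)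
qed (fact add scale)+

text \<open>Extension from power-sum products. The coefficient map \<open>c\<close> is a parameter
  because the targets differ: scalars for the scalar product, polynomials over \<open>Lam\<close>
  for translations.\<close>

definition lext :: "(Qt \<Rightarrow> 'r::comm_ring_1) \<Rightarrow> (nat multiset \<Rightarrow> 'r) \<Rightarrow> Lam \<Rightarrow> 'r" where
  "lext c \<phi> f = (\<Sum>K\<in>Poly_Mapping.keys f. c (Poly_Mapping.lookup f K) * \<phi> K)"

locale scalar_hom =
  fixes c :: "Qt \<Rightarrow> 'r::comm_ring_1"
  assumes hom_add: "c (a + b) = c a + c b" and hom_mult: "c (a * b) = c a * c b"
    and hom_1: "c 1 = 1"
begin

lemma hom_0: "c 0 = 0"
  using hom_add[of 0 0] by simp

lemma lext_superset:
  assumes "finite A" "Poly_Mapping.keys f \<subseteq> A"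
  shows "lext c \<phi> f = (\<Sum>K\<in>A. c (Poly_Mapping.lookup f K) * \<phi> K)"
  unfolding lext_def
  by (rule sum.mono_neutral_left) (use assms in \<open>auto simp: in_keys_iff hom_0\<close>)

lemma lext_add: "lext c \<phi> (f + g) = lext c \<phi> f + lext c \<phi> g"
proof -
  let ?A = "Poly_Mapping.keys f \<union> Poly_Mapping.keys g"
  have "finite ?A" "Poly_Mapping.keys (f + g) \<subseteq> ?A" by (simp_all add: keys_add)
  then show ?thesis
    by (simp add: lext_superset[of ?A] lookup_add hom_add distrib_right sum.distrib)
qed

lemma lext_scale: "lext c \<phi> (cst a * f) = c a * lext c \<phi> f"
proof -
  have "Poly_Mapping.keys (cst a * f) \<subseteq> Poly_Mapping.keys f" by (auto simp: in_keys_iff)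
  then show ?thesis
    by (simp add: lext_superset[of "Poly_Mapping.keys f"] hom_mult mult.assoc sum_distrib_left)
qed

lemma lext_single: "lext c \<phi> (Poly_Mapping.single K 1) = \<phi> K"
  by (simp add: lext_def hom_1)

lemma lext_1: "lext c \<phi> 1 = \<phi> {#}"
  using lext_single[of \<phi> "{#}"] by simp

end

subsection \<open>Exponential series\<close>

text \<open>\<open>newton P f\<close> says \<open>f = exp (\<integral> P / X)\<close>; identities between generating functions are reduced to
  identities between the logarithmic derivatives \<open>P\<close>, which are linear in the power sums.\<close>

definition newton :: "'r::comm_ring_1 fps \<Rightarrow> 'r fps \<Rightarrow> bool" where
  "newton P f \<longleftrightarrow> fps_nth f 0 = 1 \<and> fps_X * fps_deriv f = P * f"

lemma newton_mult: "newton P f \<Longrightarrow> newton R g \<Longrightarrow> newton (P + R) (f * g)"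
proof -
  assume *: "newton P f" "newton R g"
  have "fps_X * fps_deriv (f * g) = (fps_X * fps_deriv f) * g + f * (fps_X * fps_deriv g)"
    by (simp add: algebra_simps)
  also have "\<dots> = (P + R) * (f * g)"
    using * by (simp add: newton_def algebra_simps)
  finally show ?thesis using * by (simp add: newton_def)
qed

lemma newton_iff: "newton P f \<longleftrightarrow>
    fps_nth f 0 = 1 \<and> (\<forall>n. of_nat n * fps_nth f n = (\<Sum>i\<le>n. fps_nth P i * fps_nth f (n - i)))"
proof -
  have "fps_nth (fps_X * fps_deriv f) n = of_nat n * fps_nth f n" for n
    by (cases n) simp_all
  then show ?thesis
    by (simp add: newton_def fps_eq_iff fps_mult_nth atMost_atLeast0)
qed

lemma newton_unique:
  fixes f g :: "'r::{idom, ring_char_0} fps"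
  assumes "newton P f" "newton P g"
  shows "f = g"
proof -
  \<comment> \<open>The constant terms force this, so the recursion for coefficient n involves only
    earlier coefficients.\<close>
  have P0: "fps_nth P 0 = 0"
    using assms(1) by (auto simp: newton_iff dest: spec[of _ 0])
  have "fps_nth f n = fps_nth g n" for n
  proof (induction n rule: less_induct)
    case (less n)
    show ?case
    proof (cases "n = 0")
      case True with assms show ?thesis by (simp add: newton_def)
    next
      case False
      have "of_nat n * fps_nth f n = (\<Sum>i\<le>n. fps_nth P i * fps_nth f (n - i))"
        using assms by (simp add: newton_iff)
      also have "\<dots> = (\<Sum>i\<le>n. fps_nth P i * fps_nth g (n - i))"
        by (rule sum.cong) (use P0 less False in \<open>auto\<close>, metis diff_less gr0I less mult_zero_left P0)
      also have "\<dots> = of_nat n * fps_nth g n"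
        using assms by (simp add: newton_iff)
      finally show ?thesis using False by simp
    qed
  qed
  then show ?thesis by (simp add: fps_eq_iff)
qed

lemma newton_one_minus:
  fixes y :: "'r::comm_ring_1"
  shows "newton (Abs_fps (\<lambda>n. if n = 0 then 0 else - (y ^ n))) (1 - fps_const y * fps_X)"
proof -
  have "fps_nth (Abs_fps (\<lambda>n. if n = 0 then 0 else - (y ^ n)) * (1 - fps_const y * fps_X)) n
     = fps_nth (fps_X * fps_deriv (1 - fps_const y * fps_X)) n" for n
    by (cases n; cases "n - 1") (auto simp: algebra_simps simp flip: fps_const_mult)
  then show ?thesis by (simp add: newton_def fps_eq_iff)
qed

subsection \<open>The series \<open>exp (\<Sum>n. a\<^sub>n p\<^sub>n z\<^sup>n / n)\<close>\<close>

definition wt :: "nat multiset \<Rightarrow> nat" where "wt K = (\<Sum>k\<in>#K. Suc k)"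

lemma wt_empty [simp]: "wt {#} = 0" and wt_add [simp]: "wt (add_mset k K) = Suc k + wt K"
  by (simp_all add: wt_def)

lemma wt_eq_sum: "wt K = (\<Sum>k\<in>set_mset K. count K k * Suc k)"
proof -
  have "wt K = (\<Sum>k\<in>A. count K k * Suc k)" if "finite A" "set_mset K \<subseteq> A" for A
    using that(2)
  proof (induction K)
    case (add k K)
    have "(\<Sum>j\<in>A. count (add_mset k K) j * Suc j)
        = (\<Sum>j\<in>A. count K j * Suc j + (if j = k then Suc k else 0))"
      by (rule sum.cong) auto
    also have "\<dots> = wt (add_mset k K)"
      using add that(1) by (simp add: sum.distrib)
    finally show ?case by simp
  qed simp
  from this[of "set_mset K"] show ?thesis by simp
qed

lemma wt_eq_0_iff: "wt K = 0 \<longleftrightarrow> K = {#}"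
  by (cases K) auto

lemma finite_wt: "finite {K. wt K = r}"
proof (induction r rule: less_induct)
  case (less r)
  have "{K. wt K = r} \<subseteq> insert {#} (\<Union>k<r. add_mset k ` {K. wt K = r - Suc k})"
  proof
    fix K assume "K \<in> {K. wt K = r}"
    then show "K \<in> insert {#} (\<Union>k<r. add_mset k ` {K. wt K = r - Suc k})"
      by (cases K) (auto intro!: bexI imageI)
  qed
  moreover have "finite (insert {#} (\<Union>k<r. add_mset k ` {K. wt K = r - Suc k}))"
    using less by auto
  ultimately show ?case by (rule finite_subset)
qed

definition aprod :: "(nat \<Rightarrow> Qt) \<Rightarrow> nat multiset \<Rightarrow> Qt" where
  "aprod a K = (\<Prod>k\<in>#K. a k)"

lemma zrho_superset:
  assumes "finite A" "set_mset K \<subseteq> A"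
  shows "zrho K = (\<Prod>k\<in>A. of_nat ((k + 1) ^ count K k * fact (count K k)))"
  unfolding zrho_def
  by (rule prod.mono_neutral_left) (use assms in \<open>auto simp: not_in_iff\<close>)

lemma zrho_add_mset: "zrho (add_mset k K) = of_nat (Suc k) * of_nat (Suc (count K k)) * zrho K"
proof -
  let ?A = "insert k (set_mset K)" and ?z = "\<lambda>c j. of_nat ((j + 1) ^ c j * fact (c j)) :: Qt"
  have "zrho (add_mset k K) = ?z (count (add_mset k K)) k * (\<Prod>j\<in>?A - {k}. ?z (count (add_mset k K)) j)"
    by (subst zrho_superset[of ?A]) (auto simp only: prod.remove[of ?A k] finite_insert finite_set_mset insertI1 set_mset_add_mset_insert)
  also have "(\<Prod>j\<in>?A - {k}. ?z (count (add_mset k K)) j) = (\<Prod>j\<in>?A - {k}. ?z (count K) j)"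
    by (rule prod.cong) auto
  also have "?z (count (add_mset k K)) k * \<dots>
      = of_nat (Suc k) * of_nat (Suc (count K k)) * (?z (count K) k * (\<Prod>j\<in>?A - {k}. ?z (count K) j))"
    by (simp add: algebra_simps)
  also have "?z (count K) k * (\<Prod>j\<in>?A - {k}. ?z (count K) j) = zrho K"
    by (subst zrho_superset[of ?A K]) (auto simp only: prod.remove[of ?A k] finite_insert finite_set_mset insertI1)
  finally show ?thesis .
qed

lemma zrho_nonzero [simp]: "zrho K \<noteq> 0"
  by (induction K) (simp_all add: zrho_add_mset zrho_def del: of_nat_Suc)

text \<open>The choices 1, (-1)^k and 1 - q^(k+1) for \<open>a k\<close> give h_r, e_r and the
  one-row function q_r.\<close>

definition G :: "(nat \<Rightarrow> Qt) \<Rightarrow> nat \<Rightarrow> Lam" where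
  "G a r = (\<Sum>K\<in>{K. wt K = r}. Poly_Mapping.single K (aprod a K / zrho K))"

lemma lookup_G: "Poly_Mapping.lookup (G a r) K = (if wt K = r then aprod a K / zrho K else 0)"
  by (simp add: G_def lookup_sum lookup_single when_def finite_wt sum.delta')

lemma G_0 [simp]: "G a 0 = 1"
  by (rule poly_mapping_eqI) (auto simp: lookup_G wt_eq_0_iff lookup_one when_def aprod_def zrho_def)

text \<open>Newton's identity, read off coefficientwise: splitting off a part k+1 multiplies 1/z by
  (k+1) times its multiplicity, and these factors add up to the weight r.\<close>

lemma G_newton_sum: "of_nat r * G a r = (\<Sum>k<r. cst (a k) * (pk k * G a (r - Suc k)))"
proof (rule poly_mapping_eqI)
  fix K
  have "Poly_Mapping.lookup (\<Sum>k<r. cst (a k) * (pk k * G a (r - Suc k))) K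
     = (\<Sum>k<r. if k \<in># K \<and> wt K = r then of_nat (count K k * Suc k) * (aprod a K / zrho K) else 0)"
    unfolding lookup_sum
  proof (rule sum.cong)
    fix k assume k: "k \<in> {..<r}"
    show "Poly_Mapping.lookup (cst (a k) * (pk k * G a (r - Suc k))) K =
      (if k \<in># K \<and> wt K = r then of_nat (count K k * Suc k) * (aprod a K / zrho K) else 0)"
    proof (cases "k \<in># K")
      case True
      then obtain L where L: "K = add_mset k L" by (metis insert_DiffM)
      show ?thesis using k
        by (auto simp: L lookup_pk_mult lookup_G zrho_add_mset aprod_def divide_simps
            simp del: of_nat_Suc mult_Suc mult_Suc_right)
    next
      case False then show ?thesis by (simp add: lookup_pk_mult)
    qed
  qed simp
  also have "\<dots> = (if wt K = r then of_nat r * (aprod a K / zrho K) else 0)"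
  proof (cases "wt K = r")
    case True
    have sub: "set_mset K \<subseteq> {..<r}"
    proof
      fix k assume "k \<in># K"
      then obtain L where L: "K = add_mset k L" by (metis insert_DiffM)
      then show "k \<in> {..<r}" using True by simp
    qed
    have "(\<Sum>k<r. if k \<in># K then of_nat (count K k * Suc k) * (aprod a K / zrho K) else 0)
        = (\<Sum>k\<in>set_mset K. of_nat (count K k * Suc k) * (aprod a K / zrho K))"
      by (rule sum.mono_neutral_cong_right) (use sub in auto)
    also have "\<dots> = of_nat (wt K) * (aprod a K / zrho K)"
      by (simp only: wt_eq_sum of_nat_sum sum_distrib_right)
    finally show ?thesis using True by simp
  qed simp
  finally show "Poly_Mapping.lookup (of_nat r * G a r) K =
      Poly_Mapping.lookup (\<Sum>k<r. cst (a k) * (pk k * G a (r - Suc k))) K"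
    by (simp add: lookup_G flip: cst_of_nat)
qed

definition psum :: "(nat \<Rightarrow> Qt) \<Rightarrow> Lam fps" where
  "psum a = Abs_fps (\<lambda>n. if n = 0 then 0 else cst (a (n - 1)) * pk (n - 1))"

lemma newton_G: "newton (psum a) (Abs_fps (G a))"
proof -
  have "(\<Sum>i\<le>n. fps_nth (psum a) i * G a (n - i)) = of_nat n * G a n" for n
  proof (cases n)
    case (Suc m)
    show ?thesis unfolding G_newton_sum Suc
      by (subst sum.atMost_Suc_shift) (simp add: psum_def lessThan_Suc_atMost mult.assoc)
  qed (simp add: psum_def)
  then show ?thesis by (simp add: newton_iff)
qed

lemma newton_map:
  assumes "newton P f" "F 1 = 1" "\<And>x y. F (x + y) = F x + F y" "\<And>x y. F (x * y) = F x * F y"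
  shows "newton (Abs_fps (\<lambda>n. F (fps_nth P n))) (Abs_fps (\<lambda>n. F (fps_nth f n)))"
proof -
  have F0: "F 0 = 0" using assms(3)[of 0 0] by simp
  have Fsum: "F (\<Sum>i\<le>n. g i) = (\<Sum>i\<le>n. F (g i))" for g and n :: nat
    by (induction n) (simp_all add: assms)
  have Fof: "F (of_nat n) = of_nat n" for n
    by (induction n) (simp_all add: assms F0)
  show ?thesis
    unfolding newton_iff
  proof (intro conjI allI)
    show "fps_nth (Abs_fps (\<lambda>n. F (fps_nth f n))) 0 = 1"
      using assms by (simp add: newton_iff)
    fix n
    have "F (of_nat n * fps_nth f n) = F (\<Sum>i\<le>n. fps_nth P i * fps_nth f (n - i))"
      using assms(1) by (simp add: newton_iff)
    then show "of_nat n * fps_nth (Abs_fps (\<lambda>n. F (fps_nth f n))) n =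
      (\<Sum>i\<le>n. fps_nth (Abs_fps (\<lambda>n. F (fps_nth P n))) i * fps_nth (Abs_fps (\<lambda>n. F (fps_nth f n))) (n - i))"
      by (simp add: assms Fsum Fof)
  qed
qed

text \<open>This is the substitution X -> y X.\<close>

lemma newton_scale:
  assumes "newton P f"
  shows "newton (Abs_fps (\<lambda>n. y ^ n * fps_nth P n)) (Abs_fps (\<lambda>n. y ^ n * fps_nth f n))"
  unfolding newton_iff
proof (intro conjI allI)
  show "fps_nth (Abs_fps (\<lambda>n. y ^ n * fps_nth f n)) 0 = 1"
    using assms by (simp add: newton_iff)
  fix n
  have "of_nat n * (y ^ n * fps_nth f n) = y ^ n * (\<Sum>i\<le>n. fps_nth P i * fps_nth f (n - i))"
    using assms by (simp add: newton_iff mult.left_commute[of "of_nat n"])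
  also have "\<dots> = (\<Sum>i\<le>n. y ^ i * fps_nth P i * (y ^ (n - i) * fps_nth f (n - i)))"
    unfolding sum_distrib_left
  proof (rule sum.cong)
    fix i assume "i \<in> {..n}"
    then have "y ^ n = y ^ i * y ^ (n - i)" by (simp flip: power_add)
    then show "y ^ n * (fps_nth P i * fps_nth f (n - i)) =
         y ^ i * fps_nth P i * (y ^ (n - i) * fps_nth f (n - i))"
      by (simp add: algebra_simps)
  qed simp
  finally show "of_nat n * fps_nth (Abs_fps (\<lambda>n. y ^ n * fps_nth f n)) n =
      (\<Sum>i\<le>n. fps_nth (Abs_fps (\<lambda>n. y ^ n * fps_nth P n)) i *
        fps_nth (Abs_fps (\<lambda>n. y ^ n * fps_nth f n)) (n - i))"
    by simp
qed

subsection \<open>Translations \<open>p\<^sub>k \<mapsto> p\<^sub>k + \<alpha>\<^sub>k w\<^sup>k\<close>\<close>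

interpretation cst: scalar_hom cst
  by unfold_locales (simp_all add: cst_add cst_mult)

interpretation pcst: scalar_hom "\<lambda>x. [:cst x:]"
  by unfold_locales (simp_all add: cst_add cst_mult)

interpretation idhom: scalar_hom "\<lambda>x. x"
  by unfold_locales simp_all

definition tau :: "(nat \<Rightarrow> Qt) \<Rightarrow> Lam \<Rightarrow> Lam poly" where
  "tau \<alpha> = lext (\<lambda>x. [:cst x:]) (\<lambda>K. \<Prod>k\<in>#K. [:pk k:] + monom (cst (\<alpha> k)) (Suc k))"

lemma tau_add: "tau \<alpha> (f + g) = tau \<alpha> f + tau \<alpha> g"
  and tau_scale: "tau \<alpha> (cst c * f) = [:cst c:] * tau \<alpha> f"
  and tau_1 [simp]: "tau \<alpha> 1 = 1"
  by (simp_all add: tau_def pcst.lext_add pcst.lext_scale pcst.lext_1)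

lemma tau_cst [simp]: "tau \<alpha> (cst c) = [:cst c:]"
  using tau_scale[of \<alpha> c 1] by simp

lemma tau_zero [simp]: "tau \<alpha> 0 = 0"
  using tau_cst[of \<alpha> 0] by simp

lemma tau_pk_mult: "tau \<alpha> (pk k * f) = ([:pk k:] + monom (cst (\<alpha> k)) (Suc k)) * tau \<alpha> f"
proof (induction f rule: Lam_induct_single)
  case (single K)
  show ?case
    unfolding tau_def by (simp only: single_add_mset[symmetric] pcst.lext_single) simp
next
  case (add f g) then show ?case by (simp only: distrib_left tau_add)
next
  case (scale c f)
  then show ?case by (simp only: mult.left_commute[of "pk k" "cst c"] tau_scale mult.left_commute)
qed

lemma tau_pk: "tau \<alpha> (pk k) = [:pk k:] + monom (cst (\<alpha> k)) (Suc k)"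
  using tau_pk_mult[of \<alpha> k 1] by simp

lemma tau_mult: "tau \<alpha> (f * g) = tau \<alpha> f * tau \<alpha> g"
proof (induction f rule: Lam_induct)
  case (mult k f) then show ?case by (simp only: mult.assoc tau_pk_mult)
next
  case (scale c f) then show ?case by (simp only: mult.assoc tau_scale)
qed (simp_all only: mult_1 tau_1 distrib_right tau_add)

lemma newton_tau: "newton (Abs_fps (\<lambda>n. tau \<alpha> (fps_nth (psum a) n))) (Abs_fps (\<lambda>n. tau \<alpha> (G a n)))"
  using newton_map[OF newton_G[of a], of "tau \<alpha>"] by (simp add: tau_add tau_mult)

definition tauc :: "(nat \<Rightarrow> Qt) \<Rightarrow> nat \<Rightarrow> Lam \<Rightarrow> Lam" where
  "tauc \<alpha> i f = coeff (tau \<alpha> f) i"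

lemma tauc_add: "tauc \<alpha> i (f + g) = tauc \<alpha> i f + tauc \<alpha> i g"
  and tauc_scale: "tauc \<alpha> i (cst c * f) = cst c * tauc \<alpha> i f"
  and tauc_1: "tauc \<alpha> i 1 = (if i = 0 then 1 else 0)"
  by (simp_all add: tauc_def tau_add tau_scale coeff_1)

lemma tauc_0 [simp]: "tauc \<alpha> i 0 = 0"
  using tauc_scale[of \<alpha> i 0 0] by simp

lemma tauc_sum: "tauc \<alpha> i (sum f A) = (\<Sum>x\<in>A. tauc \<alpha> i (f x))"
  by (induction A rule: infinite_finite_induct) (simp_all add: tauc_add)

lemma tauc_pk_mult: "tauc \<alpha> i (pk k * f) = pk k * tauc \<alpha> i f +
    (if Suc k \<le> i then cst (\<alpha> k) * tauc \<alpha> (i - Suc k) f else 0)"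
  by (simp add: tauc_def tau_pk_mult distrib_right coeff_monom_mult)

text \<open>Two shifts of the same variables by independent amounts commute.\<close>

lemma tauc_commute: "tauc \<alpha> i (tauc \<beta> j f) = tauc \<beta> j (tauc \<alpha> i f)"
proof (induction f arbitrary: i j rule: Lam_induct)
  case (mult k f)
  then show ?case by (auto simp: tauc_pk_mult tauc_add tauc_scale add_ac diff_right_commute)
qed (auto simp: tauc_1 tauc_add tauc_scale)

section \<open>Partitions as exponents of power-sum products\<close>

lemma partition_eq_if_mset_eq:
  assumes "is_partition la" "is_partition mu" "mset la = mset mu"
  shows "la = mu"
proof -
  have "sorted (rev la)" "sorted (rev mu)"
    using assms by (simp_all add: is_partition_def sorted_wrt_rev)
  moreover have "mset (rev la) = mset (rev mu)" using assms by simp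
  ultimately have "rev la = rev mu"
    by (metis properties_for_sort)
  then show ?thesis by simp
qed

text \<open>Transfers sums over partitions to the multisets that index \<open>G\<close>, and
  finiteness back to partitions. Positivity of the parts lets \<open>Suc\<close> undo the truncated
  subtraction in \<open>pkey\<close>.\<close>

lemma pkey_bij: "bij_betw pkey {rho. is_partition rho \<and> psize rho = r} {K. wt K = r}"
proof -
  have Suc_pkey: "image_mset Suc (pkey rho) = mset rho" if "is_partition rho" for rho
  proof -
    have "map (Suc \<circ> (\<lambda>k. k - 1)) rho = map id rho"
      using that by (intro map_cong) (auto simp: is_partition_def intro!: Suc_pred gr0I)
    then show ?thesis by (simp add: pkey_def flip: mset_map)
  qed
  have wt: "wt (pkey rho) = psize rho" if "is_partition rho" for rho
    using arg_cong[OF Suc_pkey[OF that], of sum_mset]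
    by (simp add: wt_def psize_def sum_mset_sum_list)
  show ?thesis
  proof (rule bij_betwI')
    fix x y assume "x \<in> {rho. is_partition rho \<and> psize rho = r}" "y \<in> {rho. is_partition rho \<and> psize rho = r}"
    then show "(pkey x = pkey y) = (x = y)"
      using partition_eq_if_mset_eq[of x y] Suc_pkey[of x] Suc_pkey[of y] by (metis mem_Collect_eq)
  next
    fix x assume "x \<in> {rho. is_partition rho \<and> psize rho = r}"
    then show "pkey x \<in> {K. wt K = r}" using wt by simp
  next
    fix K assume K: "K \<in> {K. wt K = r}"
    let ?x = "rev (sorted_list_of_multiset (image_mset Suc K))"
    have "mset ?x = image_mset Suc K" by simp
    moreover have p: "is_partition ?x"
      by (auto simp: is_partition_def sorted_wrt_rev)
    moreover have key: "pkey ?x = K"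
      by (simp add: pkey_def multiset.map_comp comp_def)
    ultimately show "\<exists>x\<in>{rho. is_partition rho \<and> psize rho = r}. K = pkey x"
      using K wt[OF p] by (intro bexI[of _ ?x]) simp_all
  qed
qed

abbreviation hh :: "nat \<Rightarrow> Lam" where "hh \<equiv> G (\<lambda>_. 1)"
abbreviation ee :: "nat \<Rightarrow> Lam" where "ee \<equiv> G (\<lambda>k. (-1) ^ k)"

lemma hcomp_eq: "hcomp r = hh r"
proof -
  have "hcomp r = (\<Sum>rho\<in>{rho. is_partition rho \<and> psize rho = r}. Poly_Mapping.single (pkey rho) (1 / zrho (pkey rho)))"
    by (simp add: hcomp_def powsum_def cst_def mult_single)
  also have "\<dots> = (\<Sum>K\<in>{K. wt K = r}. Poly_Mapping.single K (1 / zrho K))"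
    by (rule sum.reindex_bij_betw[OF pkey_bij])
  finally show ?thesis by (simp add: G_def aprod_def)
qed

lemma finite_partitions: "finite {la. is_partition la \<and> psize la = n}"
  using bij_betw_finite[OF pkey_bij[of n]] finite_wt[of n] by simp

text \<open>This is E(-X) H(X) = 1: the two logarithmic derivatives cancel.\<close>

lemma ee_hh_sum: "(\<Sum>i\<le>r. (-1) ^ i * ee i * hh (r - i)) = (if r = 0 then 1 else 0)"
proof -
  have "newton (Abs_fps (\<lambda>n. (- 1) ^ n * fps_nth (psum (\<lambda>k. (-1) ^ k)) n) + psum (\<lambda>_. 1))
     (Abs_fps (\<lambda>n. (- 1) ^ n * fps_nth (Abs_fps ee) n) * Abs_fps hh)"
    by (intro newton_mult newton_scale newton_G)
  moreover have "Abs_fps (\<lambda>n. (- 1) ^ n * fps_nth (psum (\<lambda>k. (-1) ^ k)) n) + psum (\<lambda>_. 1) = 0"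
  proof (rule fps_ext)
    fix n show "fps_nth (Abs_fps (\<lambda>n. (- 1) ^ n * fps_nth (psum (\<lambda>k. (-1) ^ k)) n) + psum (\<lambda>_. 1)) n = fps_nth 0 n"
      by (cases n) (simp_all add: psum_def cst_power cst_minus mult.assoc[symmetric] flip: power_mult_distrib)
  qed
  moreover have "newton 0 (1 :: Lam fps)" by (simp add: newton_def)
  ultimately have "Abs_fps (\<lambda>n. (- 1) ^ n * fps_nth (Abs_fps ee) n) * Abs_fps hh = 1"
    by (auto intro: newton_unique)
  then have "fps_nth (Abs_fps (\<lambda>n. (- 1) ^ n * fps_nth (Abs_fps ee) n) * Abs_fps hh) r = fps_nth 1 r"
    by simp
  then show ?thesis by (simp add: fps_mult_nth atMost_atLeast0)
qed

subsection \<open>The scalar product and adjoint operators\<close>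

lemma tt_power_Suc_neq_1 [simp]: "tt ^ Suc k \<noteq> 1" "1 \<noteq> tt ^ Suc k"
  using tt_power_neq_1[of "Suc k"] by (metis zero_less_Suc)+

lemma zt_superset:
  assumes "finite A" "set_mset K \<subseteq> A"
  shows "zt K = zrho K * (\<Prod>k\<in>A. 1 / (1 - tt ^ (k + 1)) ^ count K k)"
proof -
  have "(\<Prod>k\<in>set_mset K. 1 / (1 - tt ^ (k + 1)) ^ count K k) = (\<Prod>k\<in>A. 1 / (1 - tt ^ (k + 1)) ^ count K k)"
    by (rule prod.mono_neutral_left) (use assms in \<open>auto simp: not_in_iff\<close>)
  then show ?thesis by (simp add: zt_def)
qed

lemma zt_add_mset: "zt (add_mset k K) =
    of_nat (Suc k) * of_nat (Suc (count K k)) / (1 - tt ^ Suc k) * zt K"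
proof -
  let ?A = "insert k (set_mset K)" and ?z = "\<lambda>c j. 1 / (1 - tt ^ (j + 1)) ^ c j"
  have "(\<Prod>j\<in>?A. ?z (count (add_mset k K)) j) = ?z (count (add_mset k K)) k * (\<Prod>j\<in>?A - {k}. ?z (count (add_mset k K)) j)"
    by (rule prod.remove) auto
  also have "(\<Prod>j\<in>?A - {k}. ?z (count (add_mset k K)) j) = (\<Prod>j\<in>?A - {k}. ?z (count K) j)"
    by (rule prod.cong) auto
  also have "?z (count (add_mset k K)) k * \<dots>
      = 1 / (1 - tt ^ Suc k) * (?z (count K) k * (\<Prod>j\<in>?A - {k}. ?z (count K) j))"
    by (simp add: field_simps)
  also have "?z (count K) k * (\<Prod>j\<in>?A - {k}. ?z (count K) j) = (\<Prod>j\<in>?A. ?z (count K) j)"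
    by (rule prod.remove[symmetric]) auto
  finally show ?thesis
    by (simp add: zt_superset[of ?A] subset_insertI zrho_add_mset mult_ac del: of_nat_Suc power_Suc)
qed

lemma zt_nonzero [simp]: "zt K \<noteq> 0"
  by (induction K) (simp_all add: zt_add_mset zt_def zrho_def del: of_nat_Suc power_Suc)

lemma hl_inner_lext: "hl_inner f g = lext (\<lambda>x. x) (\<lambda>K. Poly_Mapping.lookup g K * zt K) f"
  by (simp add: hl_inner_def lext_def mult.assoc)

lemma hl_inner_commute: "hl_inner f g = hl_inner g f"
proof -
  let ?A = "Poly_Mapping.keys f \<union> Poly_Mapping.keys g"
  show ?thesis unfolding hl_inner_lext
    by (simp add: idhom.lext_superset[of ?A] mult_ac)
qed

lemma hl_inner_add_left: "hl_inner (f + g) x = hl_inner f x + hl_inner g x"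
  and hl_inner_scale_left: "hl_inner (cst c * f) x = c * hl_inner f x"
  by (simp_all add: hl_inner_lext idhom.lext_add idhom.lext_scale)

lemma hl_inner_add_right: "hl_inner x (f + g) = hl_inner x f + hl_inner x g"
  and hl_inner_scale_right: "hl_inner x (cst c * f) = c * hl_inner x f"
  by (simp_all only: hl_inner_commute[of x] hl_inner_add_left hl_inner_scale_left)

lemma hl_inner_0_left [simp]: "hl_inner 0 x = 0"
  by (simp add: hl_inner_def)

lemma hl_inner_0_right [simp]: "hl_inner x 0 = 0"
  by (simp add: hl_inner_commute[of x])

lemma hl_inner_minus_left: "hl_inner (- f) x = - hl_inner f x"
  using hl_inner_scale_left[of "-1" f x] by (simp add: cst_minus)

lemma hl_inner_diff_left: "hl_inner (f - g) x = hl_inner f x - hl_inner g x"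
  using hl_inner_add_left[of f "- g" x] by (simp add: hl_inner_minus_left)

lemma hl_inner_sum_left: "hl_inner (sum f A) x = (\<Sum>a\<in>A. hl_inner (f a) x)"
  by (induction A rule: infinite_finite_induct) (simp_all add: hl_inner_add_left)

lemma hl_inner_sum_right: "hl_inner x (sum f A) = (\<Sum>a\<in>A. hl_inner x (f a))"
  by (simp only: hl_inner_commute[of x] hl_inner_sum_left)

lemma hl_inner_single_left: "hl_inner (Poly_Mapping.single K 1) f = Poly_Mapping.lookup f K * zt K"
  by (simp add: hl_inner_lext idhom.lext_single)

lemma hl_inner_single: "hl_inner f (Poly_Mapping.single K 1) = Poly_Mapping.lookup f K * zt K"
  by (subst hl_inner_commute) (rule hl_inner_single_left)

text \<open>The power-sum products are orthogonal with nonzero norms \<open>zt\<close>.\<close>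

lemma hl_inner_eqI: "(\<And>x. hl_inner f x = hl_inner g x) \<Longrightarrow> f = g"
  using hl_inner_single[of f] hl_inner_single[of g] by (intro poly_mapping_eqI) (metis mult_cancel_right zt_nonzero)

lemma finite_submultisets: "finite {L :: nat multiset. L \<subseteq># K}"
proof (rule finite_subset)
  have "wt L \<le> wt K" if "L \<subseteq># K" for L
    using that by (auto simp: wt_def subset_mset.le_iff_add)
  then show "{L. L \<subseteq># K} \<subseteq> (\<Union>r\<le>wt K. {L. wt L = r})" by auto
  show "finite (\<Union>r\<le>wt K. {L. wt L = r})" by (simp add: finite_wt)
qed

text \<open>Only submultisets of keys of \<open>f\<close> can contribute, which keeps the support finite.\<close>

definition perp :: "Lam \<Rightarrow> Lam \<Rightarrow> Lam" where
  "perp g f = (\<Sum>L\<in>(\<Union>K\<in>Poly_Mapping.keys f. {L. L \<subseteq># K}).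
      cst (hl_inner f (Poly_Mapping.single L 1 * g) / zt L) * Poly_Mapping.single L 1)"

lemma hl_inner_perp: "hl_inner (perp g f) x = hl_inner f (x * g)"
proof (induction x rule: Lam_induct_single)
  case (single M)
  let ?A = "\<Union>K\<in>Poly_Mapping.keys f. {L. L \<subseteq># K}"
  have fin: "finite ?A" by (simp add: finite_submultisets)
  have "Poly_Mapping.lookup (perp g f) M * zt M =
      (\<Sum>L\<in>?A. if L = M then hl_inner f (Poly_Mapping.single L 1 * g) else 0)"
    unfolding perp_def lookup_sum sum_distrib_right
    by (rule sum.cong) (auto simp: lookup_single when_def)
  also have "\<dots> = (if M \<in> ?A then hl_inner f (Poly_Mapping.single M 1 * g) else 0)"
    using fin by simp
  also have "\<dots> = hl_inner f (Poly_Mapping.single M 1 * g)"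
  proof (cases "M \<in> ?A")
    \<comment> \<open>A multiple of the monomial of \<open>M\<close> is supported on multisets
      containing \<open>M\<close>, and no key of \<open>f\<close> does.\<close>
    case False
    then have "hl_inner f (Poly_Mapping.single M 1 * g) = 0"
      unfolding hl_inner_def by (intro sum.neutral) (auto simp: lookup_single_mult)
    then show ?thesis by simp
  qed simp
  finally show ?case by (simp add: hl_inner_single)
qed (simp_all add: hl_inner_add_right distrib_right hl_inner_scale_right mult.assoc)

lemma perp_eqI: "(\<And>x. hl_inner h x = hl_inner f (x * g)) \<Longrightarrow> perp g f = h"
  by (rule hl_inner_eqI) (simp add: hl_inner_perp)

lemma perp_add_left: "perp (g + g') f = perp g f + perp g' f"
  by (rule perp_eqI) (simp add: hl_inner_perp hl_inner_add_left hl_inner_add_right distrib_left)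

lemma perp_scale_left: "perp (cst c * g) f = cst c * perp g f"
  by (rule perp_eqI) (simp add: hl_inner_perp hl_inner_scale_left hl_inner_scale_right mult.left_commute[of _ "cst c"])

lemma perp_add_right: "perp g (f + f') = perp g f + perp g f'"
  by (rule perp_eqI) (simp add: hl_inner_perp hl_inner_add_left)

lemma perp_scale_right: "perp g (cst c * f) = cst c * perp g f"
  by (rule perp_eqI) (simp add: hl_inner_perp hl_inner_scale_left)

lemma perp_1 [simp]: "perp 1 f = f"
  by (rule perp_eqI) simp

lemma perp_mult: "perp (g * g') f = perp g (perp g' f)"
  by (rule perp_eqI) (simp add: hl_inner_perp mult_ac)

lemma perp_0_left [simp]: "perp 0 f = 0"
  by (rule perp_eqI) simp

lemma perp_0_right [simp]: "perp g 0 = 0"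
  by (rule perp_eqI) simp

lemma perp_sum_right: "perp g (sum f A) = (\<Sum>a\<in>A. perp g (f a))"
  by (induction A rule: infinite_finite_induct) (simp_all add: perp_add_right)

lemma perp_sum_left: "perp (sum g A) f = (\<Sum>a\<in>A. perp (g a) f)"
  by (induction A rule: infinite_finite_induct) (simp_all add: perp_add_left)

text \<open>The adjoint of p_n is n/(1-t^n) times d/dp_n, here with n = k+1; the factor is the
  quotient of two norms \<open>zt\<close>. The Leibniz rule \<open>perp_pk_mult\<close> is a
  consequence.\<close>

lemma perp_pk_single:
  "perp (pk k) (Poly_Mapping.single K 1) =
    cst (of_nat (count K k) * of_nat (Suc k) / (1 - tt ^ Suc k)) * Poly_Mapping.single (K - {#k#}) 1"
proof (rule perp_eqI)
  fix x
  show "hl_inner (cst (of_nat (count K k) * of_nat (Suc k) / (1 - tt ^ Suc k)) * Poly_Mapping.single (K - {#k#}) 1) x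
      = hl_inner (Poly_Mapping.single K 1) (x * pk k)"
  proof (cases "k \<in># K")
    case True
    then obtain L where "K = add_mset k L" by (metis insert_DiffM)
    then show ?thesis
      by (simp add: hl_inner_single_left hl_inner_scale_left zt_add_mset mult.commute[of x] lookup_pk_mult
          divide_simps del: of_nat_Suc power_Suc)
  next
    case False
    then show ?thesis
      by (simp add: hl_inner_single_left mult.commute[of x] lookup_pk_mult not_in_iff[THEN iffD1])
  qed
qed

lemma perp_pk_pk_mult: "perp (pk k) (pk j * f) =
    (if j = k then cst (of_nat (Suc k) / (1 - tt ^ Suc k)) * f else 0) + pk j * perp (pk k) f"
proof (induction f rule: Lam_induct_single)
  case (single K)
  let ?c = "of_nat (Suc k) / (1 - tt ^ Suc k)"
  have "pk j * perp (pk k) (Poly_Mapping.single K 1)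
     = cst (of_nat (count K k) * ?c) * Poly_Mapping.single (add_mset j K - {#k#}) 1"
  proof (cases "count K k = 0")
    case True then show ?thesis by (simp add: perp_pk_single)
  next
    case False
    then have "add_mset j (K - {#k#}) = add_mset j K - {#k#}"
      by (auto simp: multiset_eq_iff)
    then have "pk j * Poly_Mapping.single (K - {#k#}) 1 = Poly_Mapping.single (add_mset j K - {#k#}) 1"
      by (metis single_add_mset)
    then show ?thesis
      by (simp only: perp_pk_single mult.left_commute[of "pk j"] times_divide_eq_right)
  qed
  moreover have "perp (pk k) (Poly_Mapping.single (add_mset j K) 1) =
      cst ((if j = k then ?c else 0) + of_nat (count K k) * ?c) * Poly_Mapping.single (add_mset j K - {#k#}) 1"
  proof -
    have "of_nat (count (add_mset j K) k) * x / y = (if j = k then x / y else 0) + of_nat (count K k) * (x / y)"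
      for x y :: Qt by (auto simp: distrib_right add_divide_distrib)
    then show ?thesis by (simp only: perp_pk_single)
  qed
  ultimately show ?case
    by (auto simp: single_add_mset[symmetric] cst_add distrib_right simp del: power_Suc of_nat_Suc)
next
  case (add f g)
  then show ?case by (simp add: perp_add_right distrib_left)
next
  case (scale c f)
  then show ?case by (simp add: perp_scale_right mult.left_commute[of "pk j" "cst c"] distrib_left mult.left_commute)
qed

lemma perp_pk_1 [simp]: "perp (pk k) 1 = 0"
  using perp_pk_single[of k "{#}"] by simp

lemma perp_pk_mult: "perp (pk k) (f * g) = perp (pk k) f * g + f * perp (pk k) g"
proof (induction f rule: Lam_induct)
  case (mult j f)
  then show ?case by (simp add: mult.assoc perp_pk_pk_mult distrib_left distrib_right add.assoc)
next
  case (scale c f)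
  then show ?case by (simp add: mult.assoc perp_scale_right distrib_left)
qed (simp_all add: perp_add_right distrib_right)

text \<open>The derivative of an exponential in p_(k+1) is a multiple of that exponential.\<close>

lemma perp_pk_G: "perp (pk k) (G a r) = (if Suc k \<le> r then cst (a k / (1 - tt ^ Suc k)) * G a (r - Suc k) else 0)"
proof (rule hl_inner_eqI)
  fix x show "hl_inner (perp (pk k) (G a r)) x =
    hl_inner (if Suc k \<le> r then cst (a k / (1 - tt ^ Suc k)) * G a (r - Suc k) else 0) x"
  proof (induction x rule: Lam_induct_single)
    case (single L)
    then show ?case unfolding hl_inner_perp
      by (auto simp: mult.commute[of _ "pk k"] single_add_mset[symmetric] hl_inner_single lookup_G
          zrho_add_mset zt_add_mset aprod_def divide_simps simp del: of_nat_Suc power_Suc)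
  qed (simp_all add: hl_inner_add_right hl_inner_scale_right)
qed

lemma lookup_mult_G_empty:
  "Poly_Mapping.lookup (x * G a j) {#} = (if j = 0 then Poly_Mapping.lookup x {#} else 0)"
proof (cases j)
  case (Suc n)
  have "Poly_Mapping.lookup (x * G a j) {#} = 0"
    by (induction x rule: Lam_induct)
      (simp_all add: Suc lookup_G lookup_add distrib_right mult.assoc lookup_pk_mult)
  with Suc show ?thesis by simp
qed simp

text \<open>By \<open>perp_pk_G\<close> the series E(w) is an eigenvector of the derivation
  p_n^perp, so taking adjoints, E^perp(w) p_n = (p_n + eigenvalue) E^perp(w). Thus E^perp(w) is a
  translation.\<close>

lemma perp_ee: "perp (ee j) f = tauc (\<lambda>k. (-1) ^ k / (1 - tt ^ Suc k)) j f"
proof (induction f arbitrary: j rule: Lam_induct)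
  case one
  show ?case
    using hl_inner_single_left[of "{#}"] lookup_mult_G_empty[of _ _ j]
    by (intro perp_eqI) (auto simp: tauc_1)
next
  case (mult k f)
  show ?case
  proof (rule perp_eqI)
    fix x
    have "hl_inner (pk k * f) (x * ee j) = hl_inner f (perp (pk k) (x * ee j))"
      by (metis hl_inner_commute hl_inner_perp mult.commute)
    also have "\<dots> = hl_inner f (perp (pk k) x * ee j) +
        (if Suc k \<le> j then (-1) ^ k / (1 - tt ^ Suc k) * hl_inner f (x * ee (j - Suc k)) else 0)"
      by (simp add: perp_pk_mult perp_pk_G hl_inner_add_right mult.left_commute[of x] hl_inner_scale_right
          del: power_Suc)
    also have "hl_inner f (perp (pk k) x * ee j) = hl_inner (pk k * perp (ee j) f) x"
      by (metis hl_inner_perp hl_inner_commute mult.commute)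
    finally show "hl_inner (tauc (\<lambda>k. (-1) ^ k / (1 - tt ^ Suc k)) j (pk k * f)) x = hl_inner (pk k * f) (x * ee j)"
      by (simp add: tauc_pk_mult hl_inner_add_left hl_inner_scale_left mult.IH[symmetric] hl_inner_perp del: power_Suc)
  qed
qed (simp_all add: perp_add_right perp_scale_right tauc_add tauc_scale)

lemma sum_shift_guard:
  fixes F :: "nat \<Rightarrow> 'a::comm_monoid_add"
  assumes "m > 0"
  shows "(\<Sum>j\<le>r. if m \<le> j then F j else 0) = (\<Sum>j\<le>r. if m \<le> r - j then F (j + m) else 0)"
proof -
  have "(\<Sum>j\<le>r. if m \<le> j then F j else 0) = (\<Sum>j\<in>{j\<in>{..r}. m \<le> j}. F j)"
    by (rule sum.inter_filter[symmetric]) simp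
  also have "\<dots> = (\<Sum>j\<in>{j\<in>{..r}. m \<le> r - j}. F (j + m))"
    by (rule sum.reindex_bij_witness[of _ "\<lambda>j. j + m" "\<lambda>j. j - m"]) (use assms in auto)
  also have "\<dots> = (\<Sum>j\<le>r. if m \<le> r - j then F (j + m) else 0)"
    by (rule sum.inter_filter) simp
  finally show ?thesis .
qed

text \<open>Induction over the generators of g. For a factor p_n, the derivative of h_(r-j) and the
  translation part of e_j^perp each produce an extra term; these cancel in the alternating sum. The
  element f varies because p_n^perp is passed on to it.\<close>

lemma perp_mult_hh:
  "perp g f * hh r = (\<Sum>j\<le>r. (-1) ^ j * perp (perp (ee j) g) (hh (r - j) * f))"
proof (induction g arbitrary: f r rule: Lam_induct)
  case one
  have "(\<Sum>j\<le>r. (-1) ^ j * perp (perp (ee j) 1) (hh (r - j) * f)) =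
    (\<Sum>j\<le>r. if j = 0 then hh r * f else 0)"
    by (rule sum.cong) (auto simp: perp_ee tauc_1)
  then show ?case by (simp add: mult.commute)
next
  case (add g g')
  then show ?case by (simp add: perp_add_left perp_add_right distrib_right distrib_left sum.distrib)
next
  case (scale c g)
  then show ?case
    by (simp add: perp_scale_left perp_scale_right mult.assoc mult.left_commute[of _ "cst c"] sum_distrib_left)
next
  case (mult k g)
  define A where "A j n = perp (perp (ee j) g) (hh n * f)" for j n
  let ?c = "cst (1 / (1 - tt ^ Suc k))"
  have "perp (perp (ee j) (pk k * g)) (hh (r - j) * f) =
       perp (perp (ee j) g) (hh (r - j) * perp (pk k) f)
      + (if Suc k \<le> r - j then ?c * A j (r - j - Suc k) else 0)
      + (if Suc k \<le> j then (-1) ^ k * ?c * A (j - Suc k) (r - j) else 0)" for j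
  proof -
    have "perp (ee j) (pk k * g) = pk k * perp (ee j) g +
       (if Suc k \<le> j then (-1) ^ k * ?c * perp (ee (j - Suc k)) g else 0)"
      using cst_mult[of "(-1) ^ k" "1 / (1 - tt ^ Suc k)"]
      by (auto simp: perp_ee tauc_pk_mult cst_power cst_minus simp del: power_Suc)
    moreover have "perp ((-1) ^ k * ?c * x) y = (-1) ^ k * ?c * perp x y" for x y
      using perp_scale_left[of "(-1) ^ k * (1 / (1 - tt ^ Suc k))" x y]
      by (simp only: cst_mult cst_power cst_minus cst_1)
    ultimately show ?thesis
      by (auto simp: perp_add_left perp_mult A_def mult.commute[of "pk k"] perp_pk_mult perp_pk_G perp_add_right perp_scale_right
          mult.assoc simp del: power_Suc)
  qed
  then have "(\<Sum>j\<le>r. (-1) ^ j * perp (perp (ee j) (pk k * g)) (hh (r - j) * f)) =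
      (\<Sum>j\<le>r. (-1) ^ j * perp (perp (ee j) g) (hh (r - j) * perp (pk k) f))
    + ((\<Sum>j\<le>r. (-1) ^ j * (if Suc k \<le> r - j then ?c * A j (r - j - Suc k) else 0))
    + (\<Sum>j\<le>r. (-1) ^ j * (if Suc k \<le> j then (-1) ^ k * ?c * A (j - Suc k) (r - j) else 0)))"
    by (simp add: distrib_left sum.distrib)
  \<comment> \<open>Replacing j by j + k + 1 brings the sign (-1)^(k+1), which with the (-1)^k of
    the translation leaves exactly the negative of the other extra sum.\<close>
  also have "(\<Sum>j\<le>r. (-1) ^ j * (if Suc k \<le> j then (-1) ^ k * ?c * A (j - Suc k) (r - j) else 0))
     = (\<Sum>j\<le>r. - ((-1) ^ j * (if Suc k \<le> r - j then ?c * A j (r - j - Suc k) else 0)))"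
  proof -
    have *: "(-1::Lam) ^ Suc (i + k) * ((-1) ^ k * x) = - ((-1) ^ i * x)" for i x
      by (simp add: power_add mult_ac)
    have "(\<Sum>j\<le>r. (-1) ^ j * (if Suc k \<le> j then (-1) ^ k * ?c * A (j - Suc k) (r - j) else 0))
       = (\<Sum>j\<le>r. if Suc k \<le> j then (-1) ^ j * ((-1) ^ k * ?c * A (j - Suc k) (r - j)) else 0)"
      by (rule sum.cong) auto
    also have "\<dots> = (\<Sum>j\<le>r. if Suc k \<le> r - j then
        (-1) ^ (j + Suc k) * ((-1) ^ k * ?c * A (j + Suc k - Suc k) (r - (j + Suc k))) else 0)"
      by (rule sum_shift_guard[where F = "\<lambda>j. (-1) ^ j * ((-1) ^ k * ?c * A (j - Suc k) (r - j))"]) simp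
    also have "\<dots> = (\<Sum>j\<le>r. - ((-1) ^ j * (if Suc k \<le> r - j then ?c * A j (r - j - Suc k) else 0)))"
      by (rule sum.cong) (auto simp: mult.assoc * simp del: power_Suc)
    finally show ?thesis .
  qed
  finally show ?case
    by (simp add: perp_mult mult.commute[of "pk k"] mult.IH sum_negf)
qed

subsection \<open>Vertex operators\<close>

text \<open>The value \<open>q = t\<close> gives the Hall--Littlewood functions and \<open>q = 0\<close> the Schur functions.\<close>

locale hl_param =
  fixes q :: Qt
  assumes q_power: "n > 0 \<Longrightarrow> q ^ n \<noteq> 1"
begin

text \<open>\<open>qa\<close> gives Q(z) = H(z)/H(qz). \<open>ta\<close> gives the translation that
  is E^perp(w) for the scalar product with parameter q; \<open>Tc_eq_perp\<close> identifies it at q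
  = t.\<close>

definition qa :: "nat \<Rightarrow> Qt" where "qa k = 1 - q ^ Suc k"
definition ta :: "nat \<Rightarrow> Qt" where "ta k = (-1) ^ k / (1 - q ^ Suc k)"

abbreviation qs :: "nat \<Rightarrow> Lam" where "qs \<equiv> G qa"
abbreviation tauS :: "Lam \<Rightarrow> Lam poly" where "tauS \<equiv> tau (\<lambda>_. -1)"
abbreviation Sc :: "nat \<Rightarrow> Lam \<Rightarrow> Lam" where "Sc \<equiv> tauc (\<lambda>_. -1)"
abbreviation tauT :: "Lam \<Rightarrow> Lam poly" where "tauT \<equiv> tau ta"
abbreviation Tc :: "nat \<Rightarrow> Lam \<Rightarrow> Lam" where "Tc \<equiv> tauc ta"

lemma q_power_Suc [simp]: "q ^ Suc k \<noteq> 1" "1 - q ^ Suc k \<noteq> 0"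
  using q_power[of "Suc k"] by (metis zero_less_Suc, metis eq_iff_diff_eq_0 zero_less_Suc)

lemma newton_const_poly: "newton (Abs_fps (\<lambda>n. [:fps_nth (psum a) n:])) (Abs_fps (\<lambda>n. [:G a n:]))"
  using newton_map[OF newton_G[of a], of "\<lambda>x. [:x:]"] by simp

lemma fps_nth_mult_one_minus:
  "fps_nth (f * (1 - fps_const y * fps_X)) (Suc n) = fps_nth f (Suc n) - y * fps_nth f n"
  for y :: "'r::comm_ring_1"
proof -
  have "f * (1 - fps_const y * fps_X) = f - fps_const y * (fps_X * f)"
    by (simp add: algebra_simps)
  then show ?thesis by simp
qed

text \<open>S Q(z) = Q(z) (1 - wz)/(1 - qwz), with the denominator cleared and coefficients of
  z^(r+1) compared.\<close>

lemma tauS_qs_rec: "tauS (qs (Suc r)) - monom (cst q) 1 * tauS (qs r) = [:qs (Suc r):] - monom 1 1 * [:qs r:]"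
proof -
  let ?P = "Abs_fps (\<lambda>n. tauS (fps_nth (psum qa) n))"
    and ?R = "Abs_fps (\<lambda>n. [:fps_nth (psum qa) n:])"
    and ?O = "\<lambda>y::Lam poly. Abs_fps (\<lambda>n. if n = 0 then 0 else - (y ^ n))"
  have "newton (?P + ?O (monom (cst q) 1)) (Abs_fps (\<lambda>n. tauS (qs n)) * (1 - fps_const (monom (cst q) 1) * fps_X))"
    by (intro newton_mult newton_tau newton_one_minus)
  moreover have "newton (?R + ?O (monom 1 1)) (Abs_fps (\<lambda>n. [:qs n:]) * (1 - fps_const (monom 1 1) * fps_X))"
    by (intro newton_mult newton_const_poly newton_one_minus)
  moreover have "?P + ?O (monom (cst q) 1) = ?R + ?O (monom 1 1)"
  proof (rule fps_ext)
    fix n show "fps_nth (?P + ?O (monom (cst q) 1)) n = fps_nth (?R + ?O (monom 1 1)) n"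
    proof (cases n)
      case (Suc k)
      have "cst (qa k) * cst (-1) = cst q ^ Suc k - 1"
        by (simp add: qa_def cst_diff cst_power cst_minus del: power_Suc)
      then have "tauS (cst (qa k) * pk k) = [:cst (qa k) * pk k:] + monom (cst q ^ Suc k - 1) (Suc k)"
        by (simp add: tau_mult tau_pk distrib_left smult_monom del: power_Suc)
      also have "monom (cst q ^ Suc k - 1) (Suc k) = monom (cst q ^ Suc k) (Suc k) - monom 1 (Suc k)"
        by (simp add: diff_monom)
      finally have "tauS (cst (qa k) * pk k) = [:cst (qa k) * pk k:] - monom 1 (Suc k) + monom (cst q ^ Suc k) (Suc k)"
        by simp
      then show ?thesis by (simp add: Suc psum_def monom_power del: power_Suc)
    qed (simp add: psum_def)
  qed
  ultimately have "Abs_fps (\<lambda>n. tauS (qs n)) * (1 - fps_const (monom (cst q) 1) * fps_X)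
      = Abs_fps (\<lambda>n. [:qs n:]) * (1 - fps_const (monom 1 1) * fps_X)"
    by (auto intro: newton_unique)
  from arg_cong[OF this, of "\<lambda>f. fps_nth f (Suc r)"] show ?thesis
    by (simp only: fps_nth_mult_one_minus fps_nth_Abs_fps)
qed

text \<open>T Q(z) = (1 + wz) Q(z): the factors 1 - q^n of \<open>qa\<close> and \<open>ta\<close>
  cancel.\<close>

lemma tauT_qs_rec: "tauT (qs (Suc r)) = [:qs (Suc r):] + monom 1 1 * [:qs r:]"
proof -
  let ?P = "Abs_fps (\<lambda>n. tauT (fps_nth (psum qa) n))"
    and ?R = "Abs_fps (\<lambda>n. [:fps_nth (psum qa) n:])"
    and ?O = "\<lambda>y::Lam poly. Abs_fps (\<lambda>n. if n = 0 then 0 else - (y ^ n))"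
  have "newton (?R + ?O (- monom 1 1)) (Abs_fps (\<lambda>n. [:qs n:]) * (1 - fps_const (- monom 1 1) * fps_X))"
    by (intro newton_mult newton_const_poly newton_one_minus)
  moreover have "?P = ?R + ?O (- monom 1 1)"
  proof (rule fps_ext)
    fix n show "fps_nth ?P n = fps_nth (?R + ?O (- monom 1 1)) n"
    proof (cases n)
      case (Suc k)
      have "cst (qa k) * cst (ta k) = (-1) ^ k"
        by (simp add: qa_def ta_def cst_power cst_minus del: power_Suc flip: cst_mult)
      then have "tauT (cst (qa k) * pk k) = [:cst (qa k) * pk k:] + monom ((-1) ^ k) (Suc k)"
        by (simp add: tau_mult tau_pk distrib_left smult_monom del: power_Suc)
      moreover have "(- monom 1 1 :: Lam poly) ^ Suc k = - monom ((-1) ^ k) (Suc k)"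
        by (simp add: minus_monom monom_power del: power_Suc) (simp add: minus_monom)
      ultimately show ?thesis by (simp add: Suc psum_def del: power_Suc)
    qed (simp add: psum_def)
  qed
  moreover have "newton ?P (Abs_fps (\<lambda>n. tauT (qs n)))" by (rule newton_tau)
  ultimately have "Abs_fps (\<lambda>n. tauT (qs n)) = Abs_fps (\<lambda>n. [:qs n:]) * (1 - fps_const (- monom 1 1) * fps_X)"
    by (auto intro: newton_unique)
  from arg_cong[OF this, of "\<lambda>f. fps_nth f (Suc r)"] show ?thesis
    by (simp only: fps_nth_mult_one_minus fps_nth_Abs_fps) simp
qed

text \<open>S E(z) = E(z)/(1 + wz), with the denominator cleared.\<close>

lemma tauS_ee_rec: "tauS (ee (Suc r)) + monom 1 1 * tauS (ee r) = [:ee (Suc r):]"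
proof -
  let ?P = "Abs_fps (\<lambda>n. tauS (fps_nth (psum (\<lambda>k. (-1) ^ k)) n))"
    and ?R = "Abs_fps (\<lambda>n. [:fps_nth (psum (\<lambda>k. (-1) ^ k)) n:])"
    and ?O = "\<lambda>y::Lam poly. Abs_fps (\<lambda>n. if n = 0 then 0 else - (y ^ n))"
  have "newton (?P + ?O (- monom 1 1)) (Abs_fps (\<lambda>n. tauS (ee n)) * (1 - fps_const (- monom 1 1) * fps_X))"
    by (intro newton_mult newton_tau newton_one_minus)
  moreover have "?P + ?O (- monom 1 1) = ?R"
  proof (rule fps_ext)
    fix n show "fps_nth (?P + ?O (- monom 1 1)) n = fps_nth ?R n"
    proof (cases n)
      case (Suc k)
      have "tauS (cst ((-1) ^ k) * pk k) = [:cst ((-1) ^ k) * pk k:] - monom ((-1) ^ k) (Suc k)"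
        by (simp only: tau_mult tau_pk tau_cst distrib_left)
          (simp add: cst_power cst_minus smult_monom minus_monom[symmetric] mult.commute)
      moreover have "(- monom 1 1 :: Lam poly) ^ Suc k = - monom ((-1) ^ k) (Suc k)"
        by (simp add: minus_monom monom_power del: power_Suc) (simp add: minus_monom)
      ultimately show ?thesis by (simp add: Suc psum_def del: power_Suc)
    qed (simp add: psum_def)
  qed
  moreover have "newton ?R (Abs_fps (\<lambda>n. [:ee n:]))" by (rule newton_const_poly)
  ultimately have "Abs_fps (\<lambda>n. [:ee n:]) = Abs_fps (\<lambda>n. tauS (ee n)) * (1 - fps_const (- monom 1 1) * fps_X)"
    by (auto intro: newton_unique)
  from arg_cong[OF this, of "\<lambda>f. fps_nth f (Suc r)"] show ?thesis
    by (simp only: fps_nth_mult_one_minus fps_nth_Abs_fps) simp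
qed

text \<open>Coefficients of Q(-z) E(z) = E(qz).\<close>

lemma qs_ee_sum: "(\<Sum>j\<le>n. (-1) ^ j * qs j * ee (n - j)) = cst (q ^ n) * ee n"
proof -
  let ?P = "Abs_fps (\<lambda>n. (- 1) ^ n * fps_nth (psum qa) n) + psum (\<lambda>k. (-1) ^ k)"
    and ?R = "Abs_fps (\<lambda>n. cst q ^ n * fps_nth (psum (\<lambda>k. (-1) ^ k)) n)"
  have "newton ?P (Abs_fps (\<lambda>n. (- 1) ^ n * fps_nth (Abs_fps qs) n) * Abs_fps ee)"
    by (intro newton_mult newton_scale newton_G)
  moreover have "newton ?R (Abs_fps (\<lambda>n. cst q ^ n * fps_nth (Abs_fps ee) n))"
    by (intro newton_scale newton_G)
  moreover have "?P = ?R"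
  proof (rule fps_ext)
    fix n show "fps_nth ?P n = fps_nth ?R n"
      by (cases n) (simp_all add: psum_def qa_def cst_diff cst_power cst_minus cst_mult algebra_simps)
  qed
  ultimately have "Abs_fps (\<lambda>n. (- 1) ^ n * fps_nth (Abs_fps qs) n) * Abs_fps ee = Abs_fps (\<lambda>n. cst q ^ n * fps_nth (Abs_fps ee) n)"
    by (auto intro: newton_unique)
  from arg_cong[OF this, of "\<lambda>f. fps_nth f n"] show ?thesis
    by (simp add: fps_mult_nth atMost_atLeast0 cst_power)
qed

text \<open>Coefficients of (1 - x)/(1 - qx).\<close>

definition jcoef :: "nat \<Rightarrow> Qt" where
  "jcoef k = (if k = 0 then 1 else q ^ k - q ^ (k - 1))"

lemma tauS_qs: "tauS (qs r) = (\<Sum>k\<le>r. monom (cst (jcoef k) * qs (r - k)) k)"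
proof (induction r)
  case 0 show ?case by (simp add: jcoef_def monom_0 pCons_one)
next
  case (Suc r)
  have "tauS (qs (Suc r)) = [:qs (Suc r):] - monom (qs r) 1 +
      (\<Sum>k\<le>r. monom (cst q * (cst (jcoef k) * qs (r - k))) (Suc k))"
  proof -
    have "monom 1 1 * [:qs r:] = monom (qs r) 1" by (simp add: smult_monom mult.commute[of _ "[:_:]"])
    moreover have "monom (cst q) 1 * tauS (qs r) = (\<Sum>k\<le>r. monom (cst q * (cst (jcoef k) * qs (r - k))) (Suc k))"
      by (simp add: Suc sum_distrib_left mult_monom)
    ultimately show ?thesis using tauS_qs_rec[of r] by (simp add: diff_eq_eq)
  qed
  also have "(\<Sum>k\<le>r. monom (cst q * (cst (jcoef k) * qs (r - k))) (Suc k)) =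
     monom (qs r) 1 + (\<Sum>k\<le>r. monom (cst (jcoef (Suc k)) * qs (r - k)) (Suc k))"
    unfolding atMost_atLeast0 sum.atLeast_Suc_atMost[OF le0]
  proof -
    have "(\<Sum>k=Suc 0..r. monom (cst q * (cst (jcoef k) * qs (r - k))) (Suc k))
      = (\<Sum>k=Suc 0..r. monom (cst (jcoef (Suc k)) * qs (r - k)) (Suc k))"
    proof (rule sum.cong)
      fix k assume "k \<in> {Suc 0..r}"
      then obtain j where "k = Suc j" by (cases k) auto
      then show "monom (cst q * (cst (jcoef k) * qs (r - k))) (Suc k) = monom (cst (jcoef (Suc k)) * qs (r - k)) (Suc k)"
        by (simp add: jcoef_def mult.assoc[symmetric] right_diff_distrib flip: cst_mult)
    qed simp
    moreover have "monom (cst q * qs r) (Suc 0) = monom (qs r) 1 + monom (cst (q - 1) * qs r) (Suc 0)"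
      by (simp add: add_monom cst_diff algebra_simps)
    ultimately show "monom (cst q * (cst (jcoef 0) * qs (r - 0))) (Suc 0) +
        (\<Sum>k=Suc 0..r. monom (cst q * (cst (jcoef k) * qs (r - k))) (Suc k)) =
      monom (qs r) 1 + (monom (cst (jcoef (Suc 0)) * qs (r - 0)) (Suc 0) +
        (\<Sum>k=Suc 0..r. monom (cst (jcoef (Suc k)) * qs (r - k)) (Suc k)))"
      by (simp add: jcoef_def)
  qed
  also have "[:qs (Suc r):] - monom (qs r) 1 + (monom (qs r) 1 + (\<Sum>k\<le>r. monom (cst (jcoef (Suc k)) * qs (r - k)) (Suc k)))
    = (\<Sum>k\<le>Suc r. monom (cst (jcoef k) * qs (Suc r - k)) k)"
    unfolding sum.atMost_Suc_shift by (simp add: jcoef_def monom_0)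
  finally show ?case .
qed

text \<open>\<open>jing n\<close> is the coefficient of \<open>z\<^sup>n\<close> in Jing's vertex operator: with \<open>S\<close> the substitution
  \<open>p\<^sub>k \<mapsto> p\<^sub>k - w\<^sup>k\<close>, it is \<open>\<Sum>\<^sub>i q\<^bsub>n+i\<^esub> [w\<^sup>i] S\<close>.\<close>

definition pair_qs :: "nat \<Rightarrow> Lam poly \<Rightarrow> Lam" where
  "pair_qs n p = (\<Sum>i\<le>degree p. qs (n + i) * coeff p i)"

lemma pair_qs_bound: "degree p \<le> N \<Longrightarrow> pair_qs n p = (\<Sum>i\<le>N. qs (n + i) * coeff p i)"
  unfolding pair_qs_def by (rule sum.mono_neutral_left) (auto simp: coeff_eq_0)

lemma pair_qs_add: "pair_qs n (p + p') = pair_qs n p + pair_qs n p'"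
proof -
  let ?N = "max (degree p) (degree p')"
  have "degree (p + p') \<le> ?N" by (simp add: degree_add_le)
  then show ?thesis by (simp add: pair_qs_bound[of _ ?N] distrib_left sum.distrib)
qed

lemma pair_qs_const_mult: "pair_qs n ([:c:] * p) = c * pair_qs n p"
proof -
  have "degree ([:c:] * p) \<le> degree p" by (simp add: degree_smult_le)
  then show ?thesis by (simp add: pair_qs_bound[of _ "degree p"] sum_distrib_left mult_ac)
qed

lemma pair_qs_monom_mult: "pair_qs n (monom c k * p) = c * pair_qs (n + k) p"
proof -
  have "degree (monom c k * p) \<le> degree p + k"
    using degree_mult_le[of "monom c k" p] degree_monom_le[of c k] by linarith
  then have "pair_qs n (monom c k * p) = (\<Sum>i\<le>degree p + k. if k \<le> i then qs (n + i) * (c * coeff p (i - k)) else 0)"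
    by (subst pair_qs_bound) (auto simp: coeff_monom_mult intro!: sum.cong)
  also have "\<dots> = (\<Sum>i\<in>{i\<in>{..degree p + k}. k \<le> i}. qs (n + i) * (c * coeff p (i - k)))"
    by (rule sum.inter_filter[symmetric]) simp
  also have "\<dots> = (\<Sum>i\<le>degree p. qs (n + k + i) * (c * coeff p i))"
    by (rule sum.reindex_bij_witness[of _ "\<lambda>i. i + k" "\<lambda>i. i - k"]) (auto simp: add_ac)
  finally show ?thesis by (simp add: pair_qs_def sum_distrib_left mult_ac)
qed

lemma pair_qs_0 [simp]: "pair_qs n 0 = 0" by (simp add: pair_qs_def)

lemma pair_qs_sum: "pair_qs n (sum p A) = (\<Sum>x\<in>A. pair_qs n (p x))"
  by (induction A rule: infinite_finite_induct) (simp_all add: pair_qs_add)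

definition jing :: "nat \<Rightarrow> Lam \<Rightarrow> Lam" where "jing n f = pair_qs n (tauS f)"

lemma jing_bound: "degree (tauS f) \<le> N \<Longrightarrow> jing n f = (\<Sum>i\<le>N. qs (n + i) * Sc i f)"
  by (simp add: jing_def pair_qs_bound tauc_def)

lemma jing_add: "jing n (f + g) = jing n f + jing n g"
  and jing_scale: "jing n (cst c * f) = cst c * jing n f"
  by (simp_all only: jing_def tau_add tau_scale pair_qs_add pair_qs_const_mult)

lemma jing_0 [simp]: "jing n 0 = 0"
  using jing_scale[of n 0 0] by simp

lemma jing_sum: "jing n (sum f A) = (\<Sum>x\<in>A. jing n (f x))"
  by (induction A rule: infinite_finite_induct) (simp_all add: jing_add)

lemma jing_one: "jing n 1 = qs n"
  by (simp add: jing_def pair_qs_def)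

lemma jing_0_one [simp]: "jing 0 1 = 1"
  by (simp add: jing_one)

lemma jing_qs_mult: "jing m (qs y * g) = (\<Sum>k\<le>y. cst (jcoef k) * (qs (y - k) * jing (m + k) g))"
  by (simp add: jing_def tau_mult tauS_qs sum_distrib_right pair_qs_sum pair_qs_monom_mult mult.assoc)

text \<open>Both sides are double sums against \<open>S\<^sub>a S\<^sub>b\<close>, which is symmetric in \<open>a\<close> and \<open>b\<close>; the identity holds
  for the symmetrized coefficients, so twice the difference vanishes.\<close>

lemma jing_commute: "jing m (jing (Suc m) f) = cst q * jing (Suc m) (jing m f)"
proof -
  \<comment> \<open>One bound for all degrees that occur, so that both pairings range over 0..N and
    the sums can be exchanged.\<close>
  define N where "N = Max (insert (degree (tauS f)) ((\<lambda>b. degree (tauS (Sc b f))) ` {..degree (tauS f)}))"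
  have N: "degree (tauS f) \<le> N" by (simp add: N_def)
  have N': "degree (tauS (Sc b f)) \<le> N" for b
  proof (cases "b \<le> degree (tauS f)")
    case True then show ?thesis unfolding N_def by (intro Max_ge) auto
  next
    case False then show ?thesis by (simp add: tauc_def coeff_eq_0 tau_zero)
  qed
  \<comment> \<open>The coefficient of z^x u^y in Q(z) Q(u) (1 - u/z)/(1 - q u/z); clearing the
    denominator gives \<open>rec\<close>.\<close>
  define \<Phi> where "\<Phi> x y = (\<Sum>k\<le>y. cst (jcoef k) * (qs (y - k) * qs (x + k)))" for x y
  have BB2: "jing m (jing n f) = (\<Sum>b\<le>N. \<Sum>a\<le>N. \<Phi> (m + a) (n + b) * Sc a (Sc b f))" for m n
  proof -
    have "jing m (jing n f) = (\<Sum>b\<le>N. jing m (qs (n + b) * Sc b f))"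
      by (subst jing_bound[OF N]) (simp add: jing_sum)
    also have "\<dots> = (\<Sum>b\<le>N. \<Sum>k\<le>n+b. \<Sum>a\<le>N. cst (jcoef k) * (qs (n + b - k) * (qs (m + a + k) * Sc a (Sc b f))))"
      unfolding jing_qs_mult by (simp add: jing_bound[OF N'] sum_distrib_left add_ac)
    also have "\<dots> = (\<Sum>b\<le>N. \<Sum>a\<le>N. \<Phi> (m + a) (n + b) * Sc a (Sc b f))"
      unfolding \<Phi>_def sum_distrib_right
      by (rule sum.cong[OF refl], subst sum.swap) (simp add: mult.assoc)
    finally show ?thesis .
  qed
  have rec: "\<Phi> x (Suc y) = qs (Suc y) * qs x - qs (Suc x) * qs y + cst q * \<Phi> (Suc x) y" for x y
  proof -
    have "\<Phi> x (Suc y) = qs (Suc y) * qs x + (\<Sum>k\<le>y. cst (jcoef (Suc k)) * (qs (y - k) * qs (Suc x + k)))"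
      unfolding \<Phi>_def sum.atMost_Suc_shift by (simp add: jcoef_def)
    also have "(\<Sum>k\<le>y. cst (jcoef (Suc k)) * (qs (y - k) * qs (Suc x + k)))
       = (\<Sum>k\<le>y. cst q * (cst (jcoef k) * (qs (y - k) * qs (Suc x + k))) - (if k = 0 then qs (Suc x) * qs y else 0))"
    proof (rule sum.cong)
      fix k assume "k \<in> {..y}"
      show "cst (jcoef (Suc k)) * (qs (y - k) * qs (Suc x + k)) =
         cst q * (cst (jcoef k) * (qs (y - k) * qs (Suc x + k))) - (if k = 0 then qs (Suc x) * qs y else 0)"
        by (cases k) (simp_all add: jcoef_def cst_diff cst_mult cst_power algebra_simps)
    qed simp
    also have "\<dots> = cst q * \<Phi> (Suc x) y - qs (Suc x) * qs y"
      by (simp add: sum_subtractf \<Phi>_def sum_distrib_left)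
    finally show ?thesis by simp
  qed
  \<comment> \<open>The inhomogeneous part of \<open>rec\<close> changes sign when x and y are
    exchanged, so it drops out of the sum.\<close>
  have sym: "\<Phi> x (Suc y) + \<Phi> y (Suc x) = cst q * (\<Phi> (Suc x) y + \<Phi> (Suc y) x)" for x y
    unfolding rec by (simp add: algebra_simps)
  have double: "2 * (\<Sum>b\<le>N. \<Sum>a\<le>N. F a b * Sc a (Sc b f)) = (\<Sum>b\<le>N. \<Sum>a\<le>N. (F a b + F b a) * Sc a (Sc b f))" for F
  proof -
    have "(\<Sum>b\<le>N. \<Sum>a\<le>N. F b a * Sc a (Sc b f)) = (\<Sum>b\<le>N. \<Sum>a\<le>N. F a b * Sc a (Sc b f))"
      by (subst sum.swap) (simp add: tauc_commute)
    then show ?thesis by (simp add: distrib_right sum.distrib)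
  qed
  have "2 * jing m (jing (Suc m) f) = (\<Sum>b\<le>N. \<Sum>a\<le>N. (\<Phi> (m + a) (Suc (m + b)) + \<Phi> (m + b) (Suc (m + a))) * Sc a (Sc b f))"
    unfolding BB2 by (subst double) simp
  also have "\<dots> = cst q * (\<Sum>b\<le>N. \<Sum>a\<le>N. (\<Phi> (Suc (m + a)) (m + b) + \<Phi> (Suc (m + b)) (m + a)) * Sc a (Sc b f))"
    by (simp only: sym sum_distrib_left mult.assoc)
  also have "\<dots> = cst q * (2 * jing (Suc m) (jing m f))"
    unfolding BB2 by (subst double) simp
  finally have "2 * (jing m (jing (Suc m) f) - cst q * jing (Suc m) (jing m f)) = 0"
    by (simp add: algebra_simps)
  then show ?thesis by (simp del: right_diff_distrib)
qed

text \<open>Multiply \<open>tauS_ee_rec\<close> by S f and pair: multiplication by w becomes the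
  index shift from n to n + 1.\<close>

lemma ee_jing: "ee (Suc r) * jing n f = jing n (ee (Suc r) * f) + jing (Suc n) (ee r * f)"
proof -
  have "tauS (ee (Suc r) * f) + monom 1 1 * tauS (ee r * f) = [:ee (Suc r):] * tauS f"
    unfolding tau_mult tauS_ee_rec[symmetric] by (simp only: distrib_right mult.assoc)
  then have "pair_qs n (tauS (ee (Suc r) * f) + monom 1 1 * tauS (ee r * f)) = pair_qs n ([:ee (Suc r):] * tauS f)"
    by simp
  then show ?thesis by (simp only: pair_qs_add pair_qs_monom_mult pair_qs_const_mult jing_def) simp
qed

lemma Tc_0: "Tc 0 f = f"
proof (induction f rule: Lam_induct)
  case (mult k f) then show ?case by (simp add: tauc_pk_mult)
qed (simp_all add: tauc_1 tauc_add tauc_scale)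

lemma Tc_qs_mult: "Tc (Suc r) (qs (Suc n) * f) = qs (Suc n) * Tc (Suc r) f + qs n * Tc r f"
  unfolding tauc_def tau_mult tauT_qs_rec by (simp add: distrib_right coeff_monom_mult mult.assoc del: power_Suc)

text \<open>T commutes with S and multiplies Q(z) by 1 + wz. The index \<open>Suc n\<close> keeps
  the lowered index a natural number.\<close>

lemma Tc_jing: "Tc (Suc r) (jing (Suc n) f) = jing (Suc n) (Tc (Suc r) f) + jing n (Tc r f)"
proof -
  define N where "N = Max {degree (tauS f), degree (tauS (Tc (Suc r) f)), degree (tauS (Tc r f))}"
  have N: "degree (tauS f) \<le> N" "degree (tauS (Tc (Suc r) f)) \<le> N" "degree (tauS (Tc r f)) \<le> N"
    by (simp_all add: N_def)
  show ?thesis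
    unfolding jing_bound[OF N(1)] jing_bound[OF N(2)] jing_bound[OF N(3)]
    by (simp add: tauc_sum Tc_qs_mult sum.distrib tauc_commute[of _ _ "\<lambda>_. -1"] del: power_Suc)
qed

text \<open>S e_k is the sum of (-1)^i e_(k-i) w^i, so the pairing yields \<open>qs_ee_sum\<close>
  without its q_0 term. Iterated from 1 this gives e_k = B_1^k 1 / \<open>qpoch k\<close>, the start
  of the e-rule.\<close>

lemma jing_1_ee: "jing (Suc 0) (ee k) = cst (1 - q ^ Suc k) * ee (Suc k)"
proof -
  have tauS_ee: "tauS (ee r) = (\<Sum>i\<le>r. monom ((-1) ^ i * ee (r - i)) i)" for r
  proof (induction r)
    case (Suc r)
    have "tauS (ee (Suc r)) = [:ee (Suc r):] - monom 1 1 * tauS (ee r)"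
      using tauS_ee_rec[of r] by (simp add: algebra_simps)
    also have "\<dots> = [:ee (Suc r):] + (\<Sum>i\<le>r. monom ((-1) ^ Suc i * ee (r - i)) (Suc i))"
      by (simp add: Suc sum_distrib_left mult_monom sum_negf minus_monom[symmetric])
    also have "\<dots> = (\<Sum>i\<le>Suc r. monom ((-1) ^ i * ee (Suc r - i)) i)"
      unfolding sum.atMost_Suc_shift by (simp add: monom_0)
    finally show ?case .
  qed (simp add: monom_0 pCons_one)
  have "pair_qs (Suc 0) (monom c i) = c * qs (Suc i)" for c i
    using pair_qs_monom_mult[of "Suc 0" c i 1] by (simp add: pair_qs_def)
  then have "jing (Suc 0) (ee k) = (\<Sum>i\<le>k. (-1) ^ i * ee (k - i) * qs (Suc i))"
    by (simp add: jing_def tauS_ee pair_qs_sum)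
  moreover have "ee (Suc k) - (\<Sum>i\<le>k. (-1) ^ i * ee (k - i) * qs (Suc i)) = cst (q ^ Suc k) * ee (Suc k)"
    using qs_ee_sum[of "Suc k"] unfolding sum.atMost_Suc_shift by (simp add: sum_negf mult_ac)
  ultimately show ?thesis by (simp add: cst_diff algebra_simps)
qed

end

subsection \<open>Column lengths of partitions\<close>

lemma conj_Nil [simp]: "Defs.conj [] j = 0"
  and conj_Cons: "Defs.conj (x # xs) j = (if j \<le> x then Suc (Defs.conj xs j) else Defs.conj xs j)"
  by (simp_all add: conj_def)

lemma is_partition_Nil [simp]: "is_partition []"
  and is_partition_Cons: "is_partition (x # xs) \<longleftrightarrow> x > 0 \<and> (\<forall>y\<in>set xs. y \<le> x) \<and> is_partition xs"
  by (auto simp: is_partition_def)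

lemma psize_Nil [simp]: "psize [] = 0" and psize_Cons [simp]: "psize (x # xs) = x + psize xs"
  by (simp_all add: psize_def)

lemma part_Nil [simp]: "part [] i = 0"
  and part_Cons_0 [simp]: "part (x # xs) 0 = x" and part_Cons_Suc [simp]: "part (x # xs) (Suc i) = part xs i"
  by (simp_all add: part_def)

lemma conj_eq_0: "(\<And>x. x \<in> set la \<Longrightarrow> x < j) \<Longrightarrow> Defs.conj la j = 0"
  by (induction la) (simp_all add: conj_Cons not_le)

text \<open>Both sides say that the same cell lies in the diagram; rows are indexed from 0, columns
  from 1.\<close>

lemma less_conj_iff:
  assumes "is_partition la" "j > 0"
  shows "i < Defs.conj la j \<longleftrightarrow> j \<le> part la i"
  using assms(1)
proof (induction la arbitrary: i)
  case (Cons x xs)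
  have "Defs.conj xs j = 0" if "x < j"
    using Cons.prems that by (intro conj_eq_0) (auto simp: is_partition_Cons)
  with Cons show ?case
    by (cases i) (auto simp: conj_Cons is_partition_Cons)
qed (use assms in simp)

lemma conj_Suc_le: "Defs.conj la (Suc j) \<le> Defs.conj la j"
  by (induction la) (auto simp: conj_Cons)

lemma conj_mono: "i \<le> j \<Longrightarrow> Defs.conj la j \<le> Defs.conj la i"
  by (rule lift_Suc_antimono_le[of "Defs.conj la"]) (rule conj_Suc_le)

lemma mult_eq_conj: "Defs.mult la j = Defs.conj la j - Defs.conj la (Suc j)"
proof (induction la)
  case (Cons x xs)
  then show ?case using conj_Suc_le[of xs j] by (auto simp: Defs.mult_def conj_Cons)
qed (simp add: Defs.mult_def)

lemma le_psize: "x \<in> set la \<Longrightarrow> x \<le> psize la"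
  by (simp add: psize_def member_le_sum_list)

lemma conj_beyond: "psize la < j \<Longrightarrow> Defs.conj la j = 0"
  by (rule conj_eq_0) (use le_psize in fastforce)

lemma parts_le_if_conj_0: "Defs.conj la (Suc N) = 0 \<Longrightarrow> x \<in> set la \<Longrightarrow> x \<le> N"
  by (induction la) (auto simp: conj_Cons split: if_splits)

lemma psize_eq_sum_conj:
  "Defs.conj la (Suc N) = 0 \<Longrightarrow> psize la = (\<Sum>j\<in>{1..N}. Defs.conj la j)"
proof (induction la)
  case (Cons x xs)
  then have x: "x \<le> N" and xs: "Defs.conj xs (Suc N) = 0" by (auto simp: conj_Cons split: if_splits)
  have "(\<Sum>j\<in>{1..N}. Defs.conj (x # xs) j) = (\<Sum>j\<in>{1..N}. Defs.conj xs j + (if j \<in> {1..x} then 1 else 0))"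
    by (rule sum.cong) (auto simp: conj_Cons)
  also have "\<dots> = psize xs + (\<Sum>j\<in>{1..N}. if j \<in> {1..x} then 1 else 0)"
    using Cons.IH[OF xs] by (simp add: sum.distrib)
  also have "(\<Sum>j\<in>{1..N}. if j \<in> {1..x} then 1 else (0::nat)) = card ({1..N} \<inter> {1..x})"
    by (subst sum.inter_restrict[symmetric]) auto
  also have "{1..N} \<inter> {1..x} = {1..x}" using x by auto
  finally show ?case by simp
qed simp

lemma partition_eq_if_conj_eq:
  assumes "is_partition la" "is_partition mu" "\<And>j. j > 0 \<Longrightarrow> Defs.conj la j = Defs.conj mu j"
  shows "la = mu"
proof (rule partition_eq_if_mset_eq)
  show "mset la = mset mu"
  proof (rule multiset_eqI)
    fix x
    have c: "count (mset xs) x = Defs.mult xs x" for xs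
      by (simp add: Defs.mult_def count_mset count_list_eq_length_filter) (metis)
    show "count (mset la) x = count (mset mu) x"
    proof (cases "x = 0")
      case True
      have "count (mset la) 0 = count (mset mu) 0"
        using assms(1,2) unfolding is_partition_def by (metis count_eq_zero_iff set_mset_mset)
      then show ?thesis by (simp only: True)
    next
      case False
      then show ?thesis using assms(3)[of x] assms(3)[of "Suc x"] by (simp add: c mult_eq_conj)
    qed
  qed
qed (use assms in auto)

lemma contained_iff_conj:
  assumes "is_partition mu" "is_partition la"
  shows "contained mu la \<longleftrightarrow> (\<forall>j>0. Defs.conj mu j \<le> Defs.conj la j)"
proof
  assume "contained mu la"
  show "\<forall>j>0. Defs.conj mu j \<le> Defs.conj la j"
  proof (intro allI impI)
    fix j :: nat assume j: "j > 0"
    have "i < Defs.conj la j" if "i < Defs.conj mu j" for i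
      using that \<open>contained mu la\<close> assms j by (auto simp: less_conj_iff contained_def intro: order_trans)
    then show "Defs.conj mu j \<le> Defs.conj la j" by (meson less_irrefl not_le)
  qed
next
  assume c: "\<forall>j>0. Defs.conj mu j \<le> Defs.conj la j"
  show "contained mu la"
    unfolding contained_def
  proof
    fix i show "part mu i \<le> part la i"
    proof (cases "part mu i = 0")
      case False
      then have "i < Defs.conj mu (part mu i)" using assms by (simp add: less_conj_iff)
      also have "\<dots> \<le> Defs.conj la (part mu i)" using c False by simp
      finally show ?thesis using assms False by (simp add: less_conj_iff)
    qed simp
  qed
qed

text \<open>For one fixed partition, the columns of the other are thereby confined to separate
  intervals. This is what lets sums over strips become sums over product sets.\<close>

lemma vertical_strip_iff_conj:
  assumes "is_partition mu" "is_partition la"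
  shows "vertical_strip la mu \<longleftrightarrow>
    (\<forall>j>0. Defs.conj mu j \<le> Defs.conj la j \<and> Defs.conj la (Suc j) \<le> Defs.conj mu j)"
proof -
  have "(\<forall>i. part la i \<le> part mu i + 1) \<longleftrightarrow> (\<forall>j>0. Defs.conj la (Suc j) \<le> Defs.conj mu j)"
  proof
    assume p: "\<forall>i. part la i \<le> part mu i + 1"
    show "\<forall>j>0. Defs.conj la (Suc j) \<le> Defs.conj mu j"
    proof (intro allI impI)
      fix j :: nat assume j: "j > 0"
      have "i < Defs.conj mu j" if "i < Defs.conj la (Suc j)" for i
        using that assms j p[rule_format, of i] by (simp add: less_conj_iff)
      then show "Defs.conj la (Suc j) \<le> Defs.conj mu j" by (meson less_irrefl not_le)
    qed
  next
    assume c: "\<forall>j>0. Defs.conj la (Suc j) \<le> Defs.conj mu j"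
    show "\<forall>i. part la i \<le> part mu i + 1"
    proof (rule allI, rule ccontr)
      fix i assume "\<not> part la i \<le> part mu i + 1"
      then have "i < Defs.conj la (Suc (Suc (part mu i)))" using assms by (simp add: less_conj_iff)
      also have "\<dots> \<le> Defs.conj mu (Suc (part mu i))" using c by simp
      finally show False using assms by (simp add: less_conj_iff)
    qed
  qed
  then show ?thesis using contained_iff_conj[OF assms] by (auto simp: vertical_strip_def)
qed

lemma contained_psize: "is_partition mu \<Longrightarrow> is_partition la \<Longrightarrow> contained mu la \<Longrightarrow> psize mu \<le> psize la"
proof -
  assume *: "is_partition mu" "is_partition la" "contained mu la"
  let ?N = "psize mu + psize la"
  have "psize mu = (\<Sum>j\<in>{1..?N}. Defs.conj mu j)" "psize la = (\<Sum>j\<in>{1..?N}. Defs.conj la j)"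
    by (rule psize_eq_sum_conj; simp add: conj_beyond)+
  moreover have "(\<Sum>j\<in>{1..?N}. Defs.conj mu j) \<le> (\<Sum>j\<in>{1..?N}. Defs.conj la j)"
    using * by (intro sum_mono) (auto simp: contained_iff_conj)
  ultimately show ?thesis by simp
qed

lemma contained_refl: "contained la la"
  by (simp add: contained_def)

lemma contained_trans: "contained la mu \<Longrightarrow> contained mu nu \<Longrightarrow> contained la nu"
  by (auto simp: contained_def intro: order_trans)

lemma finite_partitions_le: "finite {la. is_partition la \<and> psize la \<le> n}"
proof (rule finite_subset)
  show "finite (\<Union>k\<le>n. {la. is_partition la \<and> psize la = k})" by (simp add: finite_partitions)
qed auto

text \<open>Column lengths \<open>c 1, \<dots>, c N\<close>, each diminished by \<open>x\<close>.\<close>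

fun of_columns :: "nat \<Rightarrow> (nat \<Rightarrow> nat) \<Rightarrow> nat \<Rightarrow> nat list" where
  "of_columns 0 c x = []"
| "of_columns (Suc N) c x = replicate (c (Suc N) - x) (Suc N) @ of_columns N c (c (Suc N))"

lemma of_columns_set: "y \<in> set (of_columns N c x) \<Longrightarrow> 0 < y \<and> y \<le> N"
  by (induction N arbitrary: x) (auto split: if_splits, force)

lemma sorted_wrt_replicate_refl: "P x x \<Longrightarrow> sorted_wrt P (replicate n x)"
  by (induction n) auto

lemma of_columns_partition: "is_partition (of_columns N c x)"
proof (induction N arbitrary: x)
  case (Suc N)
  then show ?case using of_columns_set[of _ N c]
    by (force simp: is_partition_def sorted_wrt_append intro!: sorted_wrt_replicate_refl)
qed simp

lemma conj_append: "Defs.conj (xs @ ys) j = Defs.conj xs j + Defs.conj ys j"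
  and conj_replicate: "Defs.conj (replicate n y) j = (if j \<le> y then n else 0)"
  by (simp_all add: conj_def)

lemma conj_of_columns:
  assumes "\<And>j. 0 < j \<Longrightarrow> j < N \<Longrightarrow> c (Suc j) \<le> c j" "N > 0 \<Longrightarrow> x \<le> c N" "0 < j" "j \<le> N"
  shows "Defs.conj (of_columns N c x) j = c j - x"
  using assms
proof (induction N arbitrary: x)
  case (Suc N)
  show ?case
  proof (cases "j = Suc N")
    case True
    have "Defs.conj (of_columns N c (c (Suc N))) j = 0"
      by (rule conj_eq_0) (use True of_columns_set in fastforce)
    then show ?thesis using True by (simp add: conj_append conj_replicate)
  next
    case False
    then have j: "j \<le> N" using Suc.prems by simp
    have "Defs.conj (of_columns N c (c (Suc N))) j = c j - c (Suc N)"
      by (rule Suc.IH) (use Suc.prems j in auto)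
    moreover have "c (Suc N) \<le> c j"
      using j Suc.prems(3)
    proof (induction rule: inc_induct)
      case base then show ?case using Suc.prems(1)[of N] by simp
    next
      case (step n) then show ?case using Suc.prems(1)[of n] by simp
    qed
    ultimately show ?thesis using j Suc.prems by (simp add: conj_append conj_replicate)
  qed
qed simp

text \<open>If every value allowed for column j + 1 is at most every value allowed for column j,
  arbitrary choices are weakly decreasing, hence the column lengths of a partition.\<close>

lemma sum_PiE_columns:
  assumes anti: "\<And>j x y. 0 < j \<Longrightarrow> j < N \<Longrightarrow> x \<in> B j \<Longrightarrow> y \<in> B (Suc j) \<Longrightarrow> y \<le> x"
  shows "(\<Sum>d\<in>PiE {1..N} B. F d) =
    (\<Sum>mu\<in>{mu. is_partition mu \<and> (\<forall>j\<in>{1..N}. Defs.conj mu j \<in> B j) \<and> Defs.conj mu (Suc N) = 0}.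
       F (restrict (Defs.conj mu) {1..N}))"
proof (rule sum.reindex_bij_witness[of _ "\<lambda>mu. restrict (Defs.conj mu) {1..N}" "\<lambda>d. of_columns N d 0"])
  fix d assume d: "d \<in> PiE {1..N} B"
  have cj: "Defs.conj (of_columns N d 0) j = d j" if "j \<in> {1..N}" for j
  proof -
    have "Defs.conj (of_columns N d 0) j = d j - 0"
      by (rule conj_of_columns) (use d that anti in \<open>auto simp: PiE_iff\<close>)
    then show ?thesis by simp
  qed
  show eq: "restrict (Defs.conj (of_columns N d 0)) {1..N} = d"
    using d cj by (auto simp: fun_eq_iff restrict_def PiE_iff extensional_def)
  then show "F (restrict (Defs.conj (of_columns N d 0)) {1..N}) = F d" by simp
  have "Defs.conj (of_columns N d 0) (Suc N) = 0"
    by (rule conj_eq_0) (use of_columns_set in fastforce)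
  then show "of_columns N d 0 \<in> {mu. is_partition mu \<and> (\<forall>j\<in>{1..N}. Defs.conj mu j \<in> B j) \<and> Defs.conj mu (Suc N) = 0}"
    using d by (auto simp: of_columns_partition cj[simplified] PiE_iff)
next
  fix mu assume mu: "mu \<in> {mu. is_partition mu \<and> (\<forall>j\<in>{1..N}. Defs.conj mu j \<in> B j) \<and> Defs.conj mu (Suc N) = 0}"
  let ?d = "restrict (Defs.conj mu) {1..N}"
  show "?d \<in> PiE {1..N} B" using mu by auto
  show "of_columns N ?d 0 = mu"
  proof (rule partition_eq_if_conj_eq)
    fix j :: nat assume j: "j > 0"
    show "Defs.conj (of_columns N ?d 0) j = Defs.conj mu j"
    proof (cases "j \<le> N")
      case True
      have "Defs.conj (of_columns N ?d 0) j = ?d j - 0"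
        by (rule conj_of_columns) (use True j conj_Suc_le in auto)
      then show ?thesis using True j by simp
    next
      case False
      have "Defs.conj (of_columns N ?d 0) j = 0"
        by (rule conj_eq_0) (use of_columns_set False in fastforce)
      moreover have "Defs.conj mu j \<le> Defs.conj mu (Suc N)"
        by (rule conj_mono) (use False in simp)
      ultimately show ?thesis using mu by simp
    qed
  qed (use mu of_columns_partition in auto)
qed

subsection \<open>Removing the first column\<close>

definition remove_column :: "nat list \<Rightarrow> nat list" where
  "remove_column la = filter (\<lambda>x. x > 0) (map (\<lambda>x. x - 1) la)"

lemma remove_column_partition: "is_partition la \<Longrightarrow> is_partition (remove_column la)"
  by (induction la) (auto simp: remove_column_def is_partition_Cons)

lemma conj_remove_column: "j > 0 \<Longrightarrow> Defs.conj (remove_column la) j = Defs.conj la (Suc j)"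
  by (induction la) (auto simp: remove_column_def conj_Cons)

lemma conj_1: "is_partition la \<Longrightarrow> Defs.conj la (Suc 0) = length la"
  by (induction la) (auto simp: conj_Cons is_partition_Cons)

lemma psize_remove_column: "is_partition la \<Longrightarrow> psize la = length la + psize (remove_column la)"
  by (induction la) (auto simp: remove_column_def is_partition_Cons)

lemma vertical_strip_remove_column: "is_partition la \<Longrightarrow> vertical_strip la (remove_column la)"
  by (simp add: vertical_strip_iff_conj remove_column_partition conj_remove_column conj_Suc_le)

lemma part_remove_column: "is_partition la \<Longrightarrow> part (remove_column la) i = part la i - 1"
proof -
  assume la: "is_partition la"
  have "j \<le> part (remove_column la) i \<longleftrightarrow> j \<le> part la i - 1" if "j > 0" for j
    using less_conj_iff[OF remove_column_partition[OF la] that, of i] less_conj_iff[OF la, of "Suc j" i] that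
    by (auto simp: conj_remove_column)
  then show ?thesis
    by (metis gr0I le_antisym order_refl zero_le)
qed

lemma part_pos_iff: "is_partition la \<Longrightarrow> part la i > 0 \<longleftrightarrow> i < length la"
  by (auto simp: part_def is_partition_def intro!: gr0I) (metis nth_mem)

lemma part_ext:
  assumes "is_partition la" "is_partition mu" "\<And>i. part la i = part mu i"
  shows "la = mu"
proof (rule partition_eq_if_conj_eq[OF assms(1,2)])
  fix j :: nat assume "j > 0"
  then have "i < Defs.conj la j \<longleftrightarrow> i < Defs.conj mu j" for i
    using assms by (simp add: less_conj_iff)
  then show "Defs.conj la j = Defs.conj mu j" by (metis less_irrefl linorder_neqE_nat)
qed

lemma psize_eq_sum_part: "length la \<le> k \<Longrightarrow> psize la = (\<Sum>i<k. part la i)"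
proof -
  assume "length la \<le> k"
  have "psize la = (\<Sum>i<length la. part la i)"
    by (simp add: psize_def sum_list_sum_nth part_def atLeast0LessThan)
  also have "\<dots> = (\<Sum>i<k. part la i)"
    by (rule sum.mono_neutral_left) (use \<open>length la \<le> k\<close> in \<open>auto simp: part_def\<close>)
  finally show ?thesis .
qed

text \<open>Interlacing bounds the columns of \<open>rho\<close> from the second on by those of
  \<open>la\<close>, and the length bounds the first; equal size then forces equality
  everywhere.\<close>

lemma vertical_strip_eq_if_shorter:
  assumes "is_partition la" "is_partition rho" "vertical_strip rho (remove_column la)"
    "psize rho = psize la" "length rho \<le> length la"
  shows "rho = la"
proof -
  let ?N = "psize la"
  have le: "Defs.conj rho j \<le> Defs.conj la j" if j: "j > 0" for j
  proof (cases "j = 1")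
    case True then show ?thesis using assms by (simp add: conj_1)
  next
    case False
    then obtain i where i: "j = Suc i" "i > 0" using j by (cases j) auto
    have "Defs.conj rho (Suc i) \<le> Defs.conj (remove_column la) i"
      using assms(3) i(2) vertical_strip_iff_conj[OF remove_column_partition[OF assms(1)] assms(2)] by blast
    then show ?thesis using i by (simp add: conj_remove_column)
  qed
  have "(\<Sum>j\<in>{1..?N}. Defs.conj rho j) = (\<Sum>j\<in>{1..?N}. Defs.conj la j)"
    using psize_eq_sum_conj[of rho ?N] psize_eq_sum_conj[of la ?N] assms(4) by (simp add: conj_beyond)
  then have eq: "Defs.conj rho j = Defs.conj la j" if "j \<in> {1..?N}" for j
    using sum_mono_inv[of "Defs.conj rho" "{1..?N}" "Defs.conj la" j] le that by auto
  show ?thesis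
  proof (rule partition_eq_if_conj_eq[OF assms(2,1)])
    fix j :: nat assume "j > 0"
    then show "Defs.conj rho j = Defs.conj la j"
      using eq[of j] assms(4) by (cases "j \<le> ?N") (auto simp: conj_beyond)
  qed
qed

section \<open>Dominance order and vertical strips\<close>

definition dominated :: "nat list \<Rightarrow> nat list \<Rightarrow> bool" where
  "dominated mu la \<longleftrightarrow> psize mu = psize la \<and> (\<forall>k. (\<Sum>i<k. part mu i) \<le> (\<Sum>i<k. part la i))"

lemma dominated_strict_iff: "dominated_strict mu la \<longleftrightarrow> mu \<noteq> la \<and> dominated mu la"
  by (auto simp: dominated_strict_def dominated_def)

lemma dominated_refl: "dominated la la"
  by (simp add: dominated_def)

lemma dominated_trans: "dominated la mu \<Longrightarrow> dominated mu nu \<Longrightarrow> dominated la nu"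
  by (auto simp: dominated_def intro: order_trans)

lemma dominated_antisym:
  assumes "is_partition la" "is_partition mu" "dominated la mu" "dominated mu la"
  shows "la = mu"
proof (rule part_ext[OF assms(1,2)])
  fix i
  have "(\<Sum>i<k. part la i) = (\<Sum>i<k. part mu i)" for k
    using assms by (auto simp: dominated_def intro: antisym)
  from this[of "Suc i"] this[of i] show "part la i = part mu i" by simp
qed

lemma sum_part_remove_column:
  assumes "is_partition la"
  shows "(\<Sum>i<k. part la i) = (\<Sum>i<k. part (remove_column la) i) + min k (length la)"
proof -
  have "(\<Sum>i<k. part la i) = (\<Sum>i<k. part (remove_column la) i + (if i < length la then 1 else 0))"
  proof (rule sum.cong)
    fix i
    show "part la i = part (remove_column la) i + (if i < length la then 1 else 0)"
      using part_pos_iff[OF assms, of i] by (auto simp: part_remove_column[OF assms])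
  qed simp
  also have "(\<Sum>i<k. if i < length la then 1 else (0::nat)) = min k (length la)"
    by (induction k) auto
  ultimately show ?thesis by (simp add: sum.distrib)
qed

text \<open>The first k rows gain at most one cell each, and at most r together because no row loses
  a cell.\<close>

lemma sum_part_vertical_strip:
  assumes "vertical_strip rho nu" "psize rho = psize nu + r"
  shows "(\<Sum>i<k. part rho i) \<le> (\<Sum>i<k. part nu i) + min k r"
proof -
  have le: "part nu i \<le> part rho i" "part rho i \<le> part nu i + 1" for i
    using assms by (auto simp: vertical_strip_def contained_def)
  have "(\<Sum>i<k. part rho i) \<le> (\<Sum>i<k. part nu i + 1)" by (rule sum_mono) (rule le)
  then have "(\<Sum>i<k. part rho i) \<le> (\<Sum>i<k. part nu i) + k" by (simp only: sum.distrib) simp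
  moreover have "(\<Sum>i<k. part rho i) \<le> (\<Sum>i<k. part nu i) + r"
  proof -
    define K where "K = k + length rho + length nu"
    have split: "(\<Sum>i<K. f i) = (\<Sum>i<k. f i) + (\<Sum>i\<in>{k..<K}. f i)" for f :: "nat \<Rightarrow> nat"
      by (metis K_def add.assoc atLeast0LessThan le_add1 sum.atLeastLessThan_concat zero_le)
    have "psize rho = (\<Sum>i<K. part rho i)" "psize nu = (\<Sum>i<K. part nu i)"
      by (auto intro!: psize_eq_sum_part simp: K_def)
    moreover have "(\<Sum>i\<in>{k..<K}. part nu i) \<le> (\<Sum>i\<in>{k..<K}. part rho i)"
      by (rule sum_mono) (rule le)
    ultimately show ?thesis using assms(2) split[of "part rho"] split[of "part nu"] by simp
  qed
  ultimately show ?thesis by simp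
qed

text \<open>The most that the strip can add to k rows, min k l with l the length of
  \<open>la\<close>, is exactly what the removed column contributes to them. Hence multiplication by
  e_l respects dominance.\<close>

lemma dominated_vertical_strip:
  assumes "is_partition la" "dominated nu (remove_column la)" "vertical_strip rho nu"
    "psize rho = psize nu + length la"
  shows "dominated rho la"
  unfolding dominated_def
proof (intro conjI allI)
  show "psize rho = psize la"
    using assms psize_remove_column[OF assms(1)] by (simp add: dominated_def)
  fix k
  have "(\<Sum>i<k. part nu i) \<le> (\<Sum>i<k. part (remove_column la) i)"
    using assms(2) by (simp add: dominated_def)
  then show "(\<Sum>i<k. part rho i) \<le> (\<Sum>i<k. part la i)"
    using sum_part_vertical_strip[OF assms(3,4), of k] sum_part_remove_column[OF assms(1), of k] by linarith
qed

text \<open>The same estimates, applied to \<open>la\<close> itself, give the reverse dominance: the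
  leading term arises only from the leading term.\<close>

lemma dominated_vertical_strip_eq:
  assumes "is_partition la" "is_partition nu" "dominated nu (remove_column la)" "vertical_strip la nu"
    "psize la = psize nu + length la"
  shows "nu = remove_column la"
proof (rule dominated_antisym[OF assms(2) remove_column_partition[OF assms(1)] assms(3)])
  show "dominated (remove_column la) nu"
    unfolding dominated_def
  proof (intro conjI allI)
    show "psize (remove_column la) = psize nu" using assms(3) by (simp add: dominated_def)
    fix k show "(\<Sum>i<k. part (remove_column la) i) \<le> (\<Sum>i<k. part nu i)"
      using sum_part_vertical_strip[OF assms(4,5), of k] sum_part_remove_column[OF assms(1), of k] by linarith
  qed
qed

lemma sum_PiE_insert:
  assumes "x \<notin> A"
  shows "(\<Sum>d\<in>PiE (insert x A) B. F d) = (\<Sum>y\<in>B x. \<Sum>d\<in>PiE A B. F (d(x := y)))"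
proof -
  have "(\<Sum>d\<in>PiE (insert x A) B. F d) = (\<Sum>p\<in>B x \<times> PiE A B. F (case p of (y, d) \<Rightarrow> d(x := y)))"
    unfolding PiE_insert_eq by (subst sum.reindex[OF inj_combinator[OF assms]]) (simp add: comp_def)
  also have "\<dots> = (\<Sum>(y, d)\<in>B x \<times> PiE A B. F (d(x := y)))"
    by (rule sum.cong) auto
  finally show ?thesis by (simp add: sum.cartesian_product)
qed

context hl_param
begin

subsection \<open>Gaussian binomials\<close>

definition qpoch :: "nat \<Rightarrow> Qt" where "qpoch m = (\<Prod>i<m. 1 - q ^ Suc i)"

lemma qpoch_0 [simp]: "qpoch 0 = 1" and qpoch_Suc: "qpoch (Suc m) = qpoch m * (1 - q ^ Suc m)"
  by (simp_all add: qpoch_def)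

lemma qpoch_nonzero [simp]: "qpoch m \<noteq> 0"
  by (simp add: qpoch_def del: power_Suc)

definition gbinom :: "nat \<Rightarrow> nat \<Rightarrow> Qt" where
  "gbinom a b = (if b \<le> a then qpoch a / (qpoch b * qpoch (a - b)) else 0)"

lemma gbinom_0 [simp]: "gbinom a 0 = 1" and gbinom_self [simp]: "gbinom a a = 1" and gbinom_gt: "a < b \<Longrightarrow> gbinom a b = 0"
  by (simp_all add: gbinom_def)

lemma gbinom_symmetric: "b \<le> a \<Longrightarrow> gbinom a (a - b) = gbinom a b"
  by (simp add: gbinom_def mult.commute)

lemma gbinom_pascal: "k \<le> m \<Longrightarrow> gbinom (Suc m) (Suc k) = gbinom m (Suc k) + q ^ (m - k) * gbinom m k"
proof -
  assume "k \<le> m"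
  then obtain d where m: "m = k + d" by (metis le_Suc_ex)
  show ?thesis
  proof (cases d)
    case 0 then show ?thesis by (simp add: m gbinom_gt)
  next
    case (Suc n)
    have "1 - q ^ Suc (k + Suc n) = (1 - q ^ Suc n) + q ^ Suc n * (1 - q ^ Suc k)"
      by (simp add: algebra_simps power_add)
    then have "gbinom (Suc m) (Suc k) = qpoch m * ((1 - q ^ Suc n) + q ^ Suc n * (1 - q ^ Suc k)) / (qpoch (Suc k) * qpoch (Suc n))"
      by (simp add: gbinom_def m Suc qpoch_Suc[of "Suc (k + n)"] del: power_Suc)
    also have "\<dots> = qpoch m * (1 - q ^ Suc n) / (qpoch (Suc k) * qpoch (Suc n)) + q ^ Suc n * (qpoch m * (1 - q ^ Suc k)) / (qpoch (Suc k) * qpoch (Suc n))"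
      by (simp add: distrib_left add_divide_distrib mult_ac del: power_Suc)
    also have "qpoch m * (1 - q ^ Suc n) / (qpoch (Suc k) * qpoch (Suc n)) = gbinom m (Suc k)"
      by (simp add: gbinom_def m Suc qpoch_Suc[of n] del: power_Suc)
    also have "q ^ Suc n * (qpoch m * (1 - q ^ Suc k)) / (qpoch (Suc k) * qpoch (Suc n)) = q ^ (m - k) * gbinom m k"
      by (simp add: gbinom_def m Suc qpoch_Suc[of k] del: power_Suc)
    finally show ?thesis .
  qed
qed

lemma gbinom_pascal': "k \<le> m \<Longrightarrow> gbinom (Suc m) (Suc k) = q ^ Suc k * gbinom m (Suc k) + gbinom m k"
proof -
  assume k: "k \<le> m"
  show ?thesis
  proof (cases "k = m")
    case True then show ?thesis by (simp add: gbinom_gt)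
  next
    case False
    then have k: "Suc k \<le> m" using k by simp
    have "gbinom (Suc m) (Suc k) = gbinom (Suc m) (Suc (m - Suc k))"
      using gbinom_symmetric[of "Suc k" "Suc m"] k by (simp add: Suc_diff_Suc)
    also have "\<dots> = gbinom m (m - k) + q ^ Suc k * gbinom m (m - Suc k)"
      using gbinom_pascal[of "m - Suc k" m] k by (simp add: Suc_diff_Suc)
    also have "\<dots> = gbinom m k + q ^ Suc k * gbinom m (Suc k)"
      using gbinom_symmetric[of k m] gbinom_symmetric[of "Suc k" m] k by simp
    finally show ?thesis by simp
  qed
qed

text \<open>The two forms of Pascal's rule serve the two expansions below: here the new operator
  passes m - k earlier ones, in the primed version k of them.\<close>

lemma gbinom_sum_step:
  fixes X :: "nat \<Rightarrow> Lam"
  shows "(\<Sum>k\<le>m. cst (gbinom m k) * X k) + (\<Sum>k\<le>m. cst (q ^ (m - k) * gbinom m k) * X (Suc k))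
      = (\<Sum>k\<le>Suc m. cst (gbinom (Suc m) k) * X k)"
proof -
  have "(\<Sum>k\<le>Suc m. cst (gbinom (Suc m) k) * X k) = X 0 + (\<Sum>k\<le>m. cst (gbinom (Suc m) (Suc k)) * X (Suc k))"
    unfolding sum.atMost_Suc_shift by simp
  also have "\<dots> = X 0 + (\<Sum>k\<le>m. cst (gbinom m (Suc k)) * X (Suc k)) + (\<Sum>k\<le>m. cst (q ^ (m - k) * gbinom m k) * X (Suc k))"
    by (simp add: gbinom_pascal cst_add distrib_right sum.distrib)
  also have "X 0 + (\<Sum>k\<le>m. cst (gbinom m (Suc k)) * X (Suc k)) = (\<Sum>k\<le>Suc m. cst (gbinom m k) * X k)"
    unfolding sum.atMost_Suc_shift by simp
  finally show ?thesis by (simp add: gbinom_gt)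
qed

lemma gbinom_sum_step':
  fixes X :: "nat \<Rightarrow> Lam"
  shows "(\<Sum>k\<le>m. cst (q ^ k * gbinom m k) * X k) + (\<Sum>k\<le>m. cst (gbinom m k) * X (Suc k))
      = (\<Sum>k\<le>Suc m. cst (gbinom (Suc m) k) * X k)"
proof -
  have "(\<Sum>k\<le>Suc m. cst (gbinom (Suc m) k) * X k) = X 0 + (\<Sum>k\<le>m. cst (gbinom (Suc m) (Suc k)) * X (Suc k))"
    unfolding sum.atMost_Suc_shift by simp
  also have "\<dots> = X 0 + (\<Sum>k\<le>m. cst (q ^ Suc k * gbinom m (Suc k)) * X (Suc k)) + (\<Sum>k\<le>m. cst (gbinom m k) * X (Suc k))"
    by (simp add: gbinom_pascal' cst_add distrib_right sum.distrib del: power_Suc)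
  also have "X 0 + (\<Sum>k\<le>m. cst (q ^ Suc k * gbinom m (Suc k)) * X (Suc k)) = (\<Sum>k\<le>Suc m. cst (q ^ k * gbinom m k) * X k)"
    unfolding sum.atMost_Suc_shift by simp
  finally show ?thesis by (simp add: gbinom_gt)
qed

lemma jing_pow_add: "(jing n ^^ m) (f + g) = (jing n ^^ m) f + (jing n ^^ m) g"
  and jing_pow_scale: "(jing n ^^ m) (cst c * f) = cst c * (jing n ^^ m) f"
  by (induction m) (simp_all add: jing_add jing_scale)

lemma jing_pow_0 [simp]: "(jing n ^^ m) 0 = 0"
  by (induction m) simp_all

lemma jing_pow_sum: "(jing n ^^ m) (sum f A) = (\<Sum>x\<in>A. (jing n ^^ m) (f x))"
  by (induction A rule: infinite_finite_induct) (simp_all add: jing_pow_add)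

lemma jing_jing_Suc_pow: "jing n ((jing (Suc n) ^^ k) f) = cst (q ^ k) * (jing (Suc n) ^^ k) (jing n f)"
  by (induction k) (simp_all add: jing_commute jing_scale cst_mult mult.assoc)

text \<open>Integer indices (with value \<open>0\<close> below \<open>0\<close>) avoid truncated subtraction in the index.\<close>

definition Tc_int :: "int \<Rightarrow> Lam \<Rightarrow> Lam" where "Tc_int r f = (if r < 0 then 0 else Tc (nat r) f)"
definition ee_int :: "int \<Rightarrow> Lam" where "ee_int r = (if r < 0 then 0 else ee (nat r))"

lemma Tc_int_jing: "Tc_int r (jing (Suc n) f) = jing (Suc n) (Tc_int r f) + jing n (Tc_int (r - 1) f)"
proof -
  consider "r < 0" | "r = 0" | m where "r = int (Suc m)"
    by (metis int_cases negative_zless of_nat_0 not0_implies_Suc)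
  then show ?thesis
  proof cases
    case 3
    then have "nat r = Suc m" "nat (r - 1) = m" "\<not> r < 0" "\<not> r - 1 < 0" by auto
    then show ?thesis by (simp only: Tc_int_def Tc_jing if_False)
  qed (simp_all add: Tc_int_def Tc_0)
qed

lemma ee_int_jing: "ee_int r * jing n f = jing n (ee_int r * f) + jing (Suc n) (ee_int (r - 1) * f)"
proof -
  consider "r < 0" | "r = 0" | m where "r = int (Suc m)"
    by (metis int_cases negative_zless of_nat_0 not0_implies_Suc)
  then show ?thesis
  proof cases
    case 3
    then have "nat r = Suc m" "nat (r - 1) = m" "\<not> r < 0" "\<not> r - 1 < 0" by auto
    then show ?thesis by (simp only: ee_int_def ee_jing if_False)
  qed (simp_all add: ee_int_def)
qed

text \<open>The two summands of \<open>Tc_int_jing\<close> commute up to q. Larger indices are kept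
  on the left, so that the result is again ordered like a partition.\<close>

lemma Tc_int_jing_pow:
  "Tc_int r ((jing (Suc n) ^^ m) f) =
    (\<Sum>k\<le>m. cst (gbinom m k) * (jing (Suc n) ^^ (m - k)) ((jing n ^^ k) (Tc_int (r - int k) f)))"
proof (induction m arbitrary: r)
  case (Suc m)
  define X where "X k = (jing (Suc n) ^^ (Suc m - k)) ((jing n ^^ k) (Tc_int (r - int k) f))" for k
  have "Tc_int r ((jing (Suc n) ^^ Suc m) f) =
      (\<Sum>k\<le>m. cst (gbinom m k) * jing (Suc n) ((jing (Suc n) ^^ (m - k)) ((jing n ^^ k) (Tc_int (r - int k) f))))
     + (\<Sum>k\<le>m. cst (gbinom m k) * jing n ((jing (Suc n) ^^ (m - k)) ((jing n ^^ k) (Tc_int (r - 1 - int k) f))))"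
    by (simp add: Tc_int_jing Suc jing_sum jing_scale)
  also have "(\<Sum>k\<le>m. cst (gbinom m k) * jing (Suc n) ((jing (Suc n) ^^ (m - k)) ((jing n ^^ k) (Tc_int (r - int k) f))))
      = (\<Sum>k\<le>m. cst (gbinom m k) * X k)"
    by (rule sum.cong) (auto simp: X_def Suc_diff_le)
  also have "(\<Sum>k\<le>m. cst (gbinom m k) * jing n ((jing (Suc n) ^^ (m - k)) ((jing n ^^ k) (Tc_int (r - 1 - int k) f))))
      = (\<Sum>k\<le>m. cst (q ^ (m - k) * gbinom m k) * X (Suc k))"
    by (rule sum.cong) (auto simp: X_def jing_jing_Suc_pow cst_mult mult_ac diff_diff_eq add.commute)
  also note gbinom_sum_step
  finally show ?case by (simp only: X_def)
qed simp

lemma ee_int_jing_pow: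
  "ee_int r * ((jing n ^^ m) f) =
    (\<Sum>k\<le>m. cst (gbinom m k) * (jing (Suc n) ^^ k) ((jing n ^^ (m - k)) (ee_int (r - int k) * f)))"
proof (induction m arbitrary: r)
  case (Suc m)
  define X where "X k = (jing (Suc n) ^^ k) ((jing n ^^ (Suc m - k)) (ee_int (r - int k) * f))" for k
  have "ee_int r * ((jing n ^^ Suc m) f) =
      (\<Sum>k\<le>m. cst (gbinom m k) * jing n ((jing (Suc n) ^^ k) ((jing n ^^ (m - k)) (ee_int (r - int k) * f))))
     + (\<Sum>k\<le>m. cst (gbinom m k) * jing (Suc n) ((jing (Suc n) ^^ k) ((jing n ^^ (m - k)) (ee_int (r - 1 - int k) * f))))"
    by (simp add: ee_int_jing Suc jing_sum jing_scale)
  also have "(\<Sum>k\<le>m. cst (gbinom m k) * jing n ((jing (Suc n) ^^ k) ((jing n ^^ (m - k)) (ee_int (r - int k) * f))))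
      = (\<Sum>k\<le>m. cst (q ^ k * gbinom m k) * X k)"
    by (rule sum.cong) (auto simp: X_def jing_jing_Suc_pow cst_mult mult_ac Suc_diff_le)
  also have "(\<Sum>k\<le>m. cst (gbinom m k) * jing (Suc n) ((jing (Suc n) ^^ k) ((jing n ^^ (m - k)) (ee_int (r - 1 - int k) * f))))
      = (\<Sum>k\<le>m. cst (gbinom m k) * X (Suc k))"
    by (rule sum.cong) (auto simp: X_def diff_diff_eq add.commute)
  also note gbinom_sum_step'
  finally show ?case by (simp only: X_def)
qed simp

subsection \<open>Products of vertex operators indexed by column lengths\<close>

text \<open>\<open>c j\<close> is the length of column \<open>j\<close>, so \<open>c j - c (j + 1)\<close> is the multiplicity of the part \<open>j\<close>.\<close>

fun jing_columns :: "nat \<Rightarrow> (nat \<Rightarrow> nat) \<Rightarrow> Lam" where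
  "jing_columns 0 c = 1"
| "jing_columns (Suc N) c = (jing (Suc N) ^^ (c (Suc N) - c (Suc (Suc N)))) (jing_columns N c)"

lemma jing_columns_cong: "(\<And>j. j \<in> {1..N} \<Longrightarrow> c j - c (Suc j) = c' j - c' (Suc j)) \<Longrightarrow> jing_columns N c = jing_columns N c'"
  by (induction N) auto

text \<open>The extra parts N join the block of d N - x parts already present. For N = 0 they are
  parts of size 0 and vanish, as B_0 fixes 1.\<close>

lemma jing_columns_lower:
  assumes "x \<ge> y" "N > 0 \<Longrightarrow> d N \<ge> x"
  shows "(jing N ^^ (x - y)) (jing_columns N (d(Suc N := x))) = jing_columns N (d(Suc N := y))"
proof (cases N)
  case 0
  have "(jing 0 ^^ k) 1 = 1" for k by (induction k) simp_all
  then show ?thesis by (simp add: 0)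
next
  case (Suc M)
  have "jing_columns M (d(Suc N := x)) = jing_columns M (d(Suc N := y))"
    by (rule jing_columns_cong) (auto simp: Suc)
  moreover have "(x - y) + (d N - x) = d N - y" using assms Suc by simp
  ultimately show ?thesis by (simp add: Suc funpow_add[symmetric, unfolded comp_def, THEN fun_cong])
qed

text \<open>Of the c j - c (j+1) parts equal to j, those shortened number c j - d j, whence the
  binomial. The function d lives on 1..N only, so the entry bounding the last block is set by an
  update; the induction turns that entry into the new column length.\<close>

lemma Tc_int_jing_columns:
  assumes "\<And>j. j \<in> {1..N} \<Longrightarrow> c (Suc j) \<le> c j"
  shows "Tc_int r (jing_columns N c) = (\<Sum>d\<in>PiE {1..N} (\<lambda>j. {c (Suc j)..c j}).
    if int (\<Sum>j\<in>{1..N}. c j - d j) = r then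
      cst (\<Prod>j\<in>{1..N}. gbinom (c j - c (Suc j)) (c j - d j)) * jing_columns N (d(Suc N := c (Suc N))) else 0)"
  using assms
proof (induction N arbitrary: r)
  case 0
  show ?case by (simp add: Tc_int_def tauc_1)
next
  case (Suc N)
  define m where "m = c (Suc N) - c (Suc (Suc N))"
  have le: "c (Suc (Suc N)) \<le> c (Suc N)" using Suc.prems by simp
  let ?P = "PiE {1..N} (\<lambda>j. {c (Suc j)..c j})"
  define coef where "coef d = (\<Prod>j\<in>{1..N}. gbinom (c j - c (Suc j)) (c j - d j))" for d
  define len where "len d = int (\<Sum>j\<in>{1..N}. c j - d j)" for d
  have ins: "{1..Suc N} = insert (Suc N) {1..N}" by auto
  have "Tc_int r (jing_columns (Suc N) c) =
     (\<Sum>k\<le>m. cst (gbinom m k) * (jing (Suc N) ^^ (m - k)) ((jing N ^^ k) (Tc_int (r - int k) (jing_columns N c))))"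
    by (simp add: Tc_int_jing_pow m_def)
  also have "\<dots> = (\<Sum>k\<le>m. \<Sum>d\<in>?P. if len d = r - int k then
      cst (gbinom m k * coef d) * (jing (Suc N) ^^ (m - k)) ((jing N ^^ k) (jing_columns N (d(Suc N := c (Suc N))))) else 0)"
  proof (rule sum.cong[OF refl])
    fix k
    have "Tc_int (r - int k) (jing_columns N c) = (\<Sum>d\<in>?P. if len d = r - int k then
        cst (coef d) * jing_columns N (d(Suc N := c (Suc N))) else 0)"
      unfolding coef_def len_def by (rule Suc.IH) (use Suc.prems in auto)
    then show "cst (gbinom m k) * (jing (Suc N) ^^ (m - k)) ((jing N ^^ k) (Tc_int (r - int k) (jing_columns N c))) =
      (\<Sum>d\<in>?P. if len d = r - int k then
      cst (gbinom m k * coef d) * (jing (Suc N) ^^ (m - k)) ((jing N ^^ k) (jing_columns N (d(Suc N := c (Suc N))))) else 0)"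
      by (simp add: jing_pow_sum sum_distrib_left if_distrib[of "(jing _ ^^ _)"] if_distrib[of "(*) _"]
          jing_pow_scale cst_mult mult.assoc cong: if_cong)
  qed
  also have "\<dots> = (\<Sum>y\<in>{c (Suc (Suc N))..c (Suc N)}. \<Sum>d\<in>?P.
      if len d = r - int (c (Suc N) - y) then
      cst (gbinom m (c (Suc N) - y) * coef d) * (jing (Suc N) ^^ (y - c (Suc (Suc N)))) (jing_columns N (d(Suc N := y))) else 0)"
  proof (rule sum.reindex_bij_witness[of _ "\<lambda>y. c (Suc N) - y" "\<lambda>k. c (Suc N) - k"])
    fix k assume k: "k \<in> {..m}"
    let ?y = "c (Suc N) - k"
    have *: "(jing N ^^ k) (jing_columns N (d(Suc N := c (Suc N)))) = jing_columns N (d(Suc N := ?y))" if "d \<in> ?P" for d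
    proof -
      have "d N \<ge> c (Suc N)" if "N > 0" using \<open>d \<in> ?P\<close> that by (auto simp: PiE_iff)
      then show ?thesis using jing_columns_lower[of ?y "c (Suc N)" N d] k by (simp add: m_def)
    qed
    have "m - k = ?y - c (Suc (Suc N))" "k = c (Suc N) - ?y" using k by (auto simp: m_def)
    then show "(\<Sum>d\<in>?P. if len d = r - int (c (Suc N) - ?y) then
      cst (gbinom m (c (Suc N) - ?y) * coef d) * (jing (Suc N) ^^ (?y - c (Suc (Suc N)))) (jing_columns N (d(Suc N := ?y))) else 0)
      = (\<Sum>d\<in>?P. if len d = r - int k then
      cst (gbinom m k * coef d) * (jing (Suc N) ^^ (m - k)) ((jing N ^^ k) (jing_columns N (d(Suc N := c (Suc N))))) else 0)"
      by (intro sum.cong) (simp_all add: *)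
  qed (use le in \<open>auto simp: m_def\<close>)
  also have "\<dots> = (\<Sum>d\<in>PiE {1..Suc N} (\<lambda>j. {c (Suc j)..c j}).
    if int (\<Sum>j\<in>{1..Suc N}. c j - d j) = r then
      cst (\<Prod>j\<in>{1..Suc N}. gbinom (c j - c (Suc j)) (c j - d j)) * jing_columns (Suc N) (d(Suc (Suc N) := c (Suc (Suc N)))) else 0)"
    unfolding ins
  proof (subst sum_PiE_insert, simp, intro sum.cong refl)
    fix y and d :: "nat \<Rightarrow> nat"
    define d' where "d' = d(Suc N := y)"
    have 1: "(\<Sum>j\<in>{1..N}. c j - d' j) = (\<Sum>j\<in>{1..N}. c j - d j)"
      by (intro sum.cong) (auto simp: d'_def)
    have 2: "(\<Prod>j\<in>{1..N}. gbinom (c j - c (Suc j)) (c j - d' j)) = coef d"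
      unfolding coef_def by (intro prod.cong) (auto simp: d'_def)
    have 3: "jing_columns N (d'(Suc (Suc N) := c (Suc (Suc N)))) = jing_columns N (d(Suc N := y))"
      by (rule jing_columns_cong) (auto simp: d'_def)
    have 4: "jing_columns (Suc N) (d'(Suc (Suc N) := c (Suc (Suc N)))) =
        (jing (Suc N) ^^ (y - c (Suc (Suc N)))) (jing_columns N (d(Suc N := y)))"
      by (simp only: jing_columns.simps(2)[of N] 3) (simp add: d'_def)
    have 5: "int (\<Sum>j\<in>insert (Suc N) {1..N}. c j - d' j) = int (c (Suc N) - y) + len d"
      unfolding len_def 1[symmetric] by (subst sum.insert) (auto simp: d'_def)
    have 6: "(\<Prod>j\<in>insert (Suc N) {1..N}. gbinom (c j - c (Suc j)) (c j - d' j)) = gbinom m (c (Suc N) - y) * coef d"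
      unfolding 2[symmetric] by (subst prod.insert) (auto simp: d'_def m_def)
    show "(if len d = r - int (c (Suc N) - y) then
        cst (gbinom m (c (Suc N) - y) * coef d) * (jing (Suc N) ^^ (y - c (Suc (Suc N)))) (jing_columns N (d(Suc N := y))) else 0)
       = (if int (\<Sum>j\<in>insert (Suc N) {1..N}. c j - (d(Suc N := y)) j) = r then
      cst (\<Prod>j\<in>insert (Suc N) {1..N}. gbinom (c j - c (Suc j)) (c j - (d(Suc N := y)) j)) *
        jing_columns (Suc N) (d(Suc N := y, Suc (Suc N) := c (Suc (Suc N)))) else 0)"
      unfolding d'_def[symmetric] 4 5 6 by (simp add: eq_diff_eq add.commute)
  qed
  finally show ?case .
qed

text \<open>Of the parts equal to j, those lengthened number d (j+1) - c (j+1). A column N + 1 may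
  appear, and new parts of size 1 come from e_k acting on 1, with weight 1/\<open>qpoch k\<close>.
  The bound R makes the range of the first column finite.\<close>

lemma ee_int_jing_columns:
  assumes "\<And>j. j \<in> {1..N} \<Longrightarrow> c (Suc j) \<le> c j" "r \<le> int R"
  shows "ee_int r * jing_columns N c = (\<Sum>d\<in>PiE {1..Suc N} (\<lambda>j. if j = 1 then {c 1..c 1 + R} else {c j..c (j - 1)}).
    if int (\<Sum>j\<in>{1..Suc N}. d j - c j) = r then
      cst (1 / qpoch (d 1 - c 1) * (\<Prod>j\<in>{1..N}. gbinom (c j - c (Suc j)) (d (Suc j) - c (Suc j))))
        * jing_columns (Suc N) (d(Suc (Suc N) := c (Suc N))) else 0)"
  using assms
proof (induction N arbitrary: r)
  case 0
  have e: "ee k = cst (1 / qpoch k) * (jing (Suc 0) ^^ k) 1" for k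
  proof (induction k)
    case (Suc k)
    have "cst (1 / qpoch (Suc k)) * (jing (Suc 0) ^^ Suc k) 1 = cst (1 / qpoch (Suc k)) * jing (Suc 0) (cst (qpoch k) * ee k)"
      by (simp add: Suc mult.assoc[symmetric] flip: cst_mult)
    also have "\<dots> = cst (1 / qpoch (Suc k) * qpoch k * (1 - q ^ Suc k)) * ee (Suc k)"
      by (simp only: jing_scale jing_1_ee cst_mult mult.assoc)
    also have "1 / qpoch (Suc k) * qpoch k * (1 - q ^ Suc k) = 1"
      by (simp add: qpoch_Suc del: power_Suc)
    finally show ?case by simp
  qed simp
  have "(\<Sum>d\<in>PiE {1..Suc 0} (\<lambda>j. if j = 1 then {c 1..c 1 + R} else {c j..c (j - 1)}).
    if int (\<Sum>j\<in>{1..Suc 0}. d j - c j) = r then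
      cst (1 / qpoch (d 1 - c 1) * (\<Prod>j\<in>{1..0}. gbinom (c j - c (Suc j)) (d (Suc j) - c (Suc j))))
        * jing_columns (Suc 0) (d(Suc (Suc 0) := c (Suc 0))) else 0)
    = (\<Sum>y\<in>{c 1..c 1 + R}. if int (y - c 1) = r then cst (1 / qpoch (y - c 1)) * (jing (Suc 0) ^^ (y - c 1)) 1 else 0)"
    by (simp add: sum_PiE_insert[of "Suc 0" "{}"] cong: if_cong)
  also have "\<dots> = (\<Sum>y\<in>{c 1..c 1 + R}. if y = c 1 + nat r then (if r < 0 then 0 else ee (nat r)) else 0)"
    by (rule sum.cong) (auto simp: e)
  also have "\<dots> = ee_int r" using 0 by (auto simp: ee_int_def)
  finally show ?case by simp
next
  case (Suc N)
  define m where "m = c (Suc N) - c (Suc (Suc N))"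
  have le: "c (Suc (Suc N)) \<le> c (Suc N)" using Suc.prems by simp
  let ?B = "\<lambda>j. if j = 1 then {c 1..c 1 + R} else {c j..c (j - 1)}"
  let ?P = "PiE {1..Suc N} ?B"
  define coef where "coef d = 1 / qpoch (d 1 - c 1) * (\<Prod>j\<in>{1..N}. gbinom (c j - c (Suc j)) (d (Suc j) - c (Suc j)))" for d
  define len where "len d = int (\<Sum>j\<in>{1..Suc N}. d j - c j)" for d
  have ins: "{1..Suc (Suc N)} = insert (Suc (Suc N)) {1..Suc N}" by auto
  have ins': "{1..Suc N} = insert (Suc N) {1..N}" by auto
  have "ee_int r * jing_columns (Suc N) c =
     (\<Sum>k\<le>m. cst (gbinom m k) * (jing (Suc (Suc N)) ^^ k) ((jing (Suc N) ^^ (m - k)) (ee_int (r - int k) * jing_columns N c)))"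
    by (simp add: ee_int_jing_pow m_def)
  also have "\<dots> = (\<Sum>k\<le>m. \<Sum>d\<in>?P. if len d = r - int k then
      cst (gbinom m k * coef d) * (jing (Suc (Suc N)) ^^ k) ((jing (Suc N) ^^ (m - k)) (jing_columns (Suc N) (d(Suc (Suc N) := c (Suc N))))) else 0)"
  proof (rule sum.cong[OF refl])
    fix k
    have "ee_int (r - int k) * jing_columns N c = (\<Sum>d\<in>?P. if len d = r - int k then
        cst (coef d) * jing_columns (Suc N) (d(Suc (Suc N) := c (Suc N))) else 0)"
      unfolding coef_def len_def by (rule Suc.IH) (use Suc.prems in auto)
    then show "cst (gbinom m k) * (jing (Suc (Suc N)) ^^ k) ((jing (Suc N) ^^ (m - k)) (ee_int (r - int k) * jing_columns N c)) =
      (\<Sum>d\<in>?P. if len d = r - int k then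
      cst (gbinom m k * coef d) * (jing (Suc (Suc N)) ^^ k) ((jing (Suc N) ^^ (m - k)) (jing_columns (Suc N) (d(Suc (Suc N) := c (Suc N))))) else 0)"
      by (simp only: jing_pow_sum sum_distrib_left if_distrib[of "(jing _ ^^ _)"] if_distrib[of "(*) _"]
          jing_pow_scale cst_mult mult.assoc jing_pow_0 mult_zero_right cong: if_cong)
  qed
  also have "\<dots> = (\<Sum>y\<in>{c (Suc (Suc N))..c (Suc N)}. \<Sum>d\<in>?P.
      if len d = r - int (y - c (Suc (Suc N))) then
      cst (gbinom m (y - c (Suc (Suc N))) * coef d) * (jing (Suc (Suc N)) ^^ (y - c (Suc (Suc N)))) (jing_columns (Suc N) (d(Suc (Suc N) := y))) else 0)"
  proof (rule sum.reindex_bij_witness[of _ "\<lambda>y. y - c (Suc (Suc N))" "\<lambda>k. c (Suc (Suc N)) + k"])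
    fix k assume k: "k \<in> {..m}"
    let ?y = "c (Suc (Suc N)) + k"
    have *: "(jing (Suc N) ^^ (m - k)) (jing_columns (Suc N) (d(Suc (Suc N) := c (Suc N)))) = jing_columns (Suc N) (d(Suc (Suc N) := ?y))" if "d \<in> ?P" for d
    proof -
      have "d (Suc N) \<in> ?B (Suc N)" using that by (rule PiE_mem) simp
      then have "d (Suc N) \<ge> c (Suc N)" by (auto split: if_splits)
      moreover have "m - k = c (Suc N) - ?y" using k by (simp add: m_def)
      ultimately show ?thesis using jing_columns_lower[of ?y "c (Suc N)" "Suc N" d] k le by (simp add: m_def del: jing_columns.simps)
    qed
    have "?y - c (Suc (Suc N)) = k" by simp
    then show "(\<Sum>d\<in>?P. if len d = r - int (?y - c (Suc (Suc N))) then
      cst (gbinom m (?y - c (Suc (Suc N))) * coef d) * (jing (Suc (Suc N)) ^^ (?y - c (Suc (Suc N)))) (jing_columns (Suc N) (d(Suc (Suc N) := ?y))) else 0)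
      = (\<Sum>d\<in>?P. if len d = r - int k then
      cst (gbinom m k * coef d) * (jing (Suc (Suc N)) ^^ k) ((jing (Suc N) ^^ (m - k)) (jing_columns (Suc N) (d(Suc (Suc N) := c (Suc N))))) else 0)"
      by (intro sum.cong) (simp_all add: * del: jing_columns.simps)
  qed (use le in \<open>auto simp: m_def\<close>)
  also have "\<dots> = (\<Sum>d\<in>PiE {1..Suc (Suc N)} ?B.
    if int (\<Sum>j\<in>{1..Suc (Suc N)}. d j - c j) = r then
      cst (1 / qpoch (d 1 - c 1) * (\<Prod>j\<in>{1..Suc N}. gbinom (c j - c (Suc j)) (d (Suc j) - c (Suc j))))
        * jing_columns (Suc (Suc N)) (d(Suc (Suc (Suc N)) := c (Suc (Suc N)))) else 0)"
    unfolding ins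
  proof (subst sum_PiE_insert, simp, intro sum.cong)
    show "{c (Suc (Suc N))..c (Suc N)} = ?B (Suc (Suc N))" by simp
    fix y and d :: "nat \<Rightarrow> nat"
    define d' where "d' = d(Suc (Suc N) := y)"
    have 1: "(\<Sum>j\<in>{1..Suc N}. d' j - c j) = (\<Sum>j\<in>{1..Suc N}. d j - c j)"
      by (intro sum.cong) (auto simp: d'_def)
    have 2: "1 / qpoch (d' 1 - c 1) * (\<Prod>j\<in>{1..N}. gbinom (c j - c (Suc j)) (d' (Suc j) - c (Suc j))) = coef d"
      unfolding coef_def d'_def by (intro arg_cong2[of _ _ _ _ "(*)"] prod.cong) auto
    have 3: "jing_columns (Suc N) (d'(Suc (Suc (Suc N)) := c (Suc (Suc N)))) = jing_columns (Suc N) (d(Suc (Suc N) := y))"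
      by (rule jing_columns_cong) (auto simp: d'_def)
    have 4: "jing_columns (Suc (Suc N)) (d'(Suc (Suc (Suc N)) := c (Suc (Suc N)))) =
        (jing (Suc (Suc N)) ^^ (y - c (Suc (Suc N)))) (jing_columns (Suc N) (d(Suc (Suc N) := y)))"
      by (simp only: jing_columns.simps(2)[of "Suc N"] 3) (simp add: d'_def)
    have 5: "int (\<Sum>j\<in>insert (Suc (Suc N)) {1..Suc N}. d' j - c j) = int (y - c (Suc (Suc N))) + len d"
      unfolding len_def 1[symmetric] by (subst sum.insert) (auto simp: d'_def)
    have 6: "1 / qpoch (d' 1 - c 1) * (\<Prod>j\<in>{1..Suc N}. gbinom (c j - c (Suc j)) (d' (Suc j) - c (Suc j)))
       = gbinom m (y - c (Suc (Suc N))) * coef d"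
      unfolding 2[symmetric] ins' by (subst prod.insert) (auto simp: d'_def m_def)
    show "(if len d = r - int (y - c (Suc (Suc N))) then
        cst (gbinom m (y - c (Suc (Suc N))) * coef d) * (jing (Suc (Suc N)) ^^ (y - c (Suc (Suc N)))) (jing_columns (Suc N) (d(Suc (Suc N) := y))) else 0)
       = (if int (\<Sum>j\<in>insert (Suc (Suc N)) {1..Suc N}. (d(Suc (Suc N) := y)) j - c j) = r then
      cst (1 / qpoch ((d(Suc (Suc N) := y)) 1 - c 1) * (\<Prod>j\<in>{1..Suc N}. gbinom (c j - c (Suc j)) ((d(Suc (Suc N) := y)) (Suc j) - c (Suc j)))) *
        jing_columns (Suc (Suc N)) (d(Suc (Suc N) := y, Suc (Suc (Suc N)) := c (Suc (Suc N)))) else 0)"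
      unfolding d'_def[symmetric] 4 5 6 by (simp add: eq_diff_eq add.commute)
  qed simp
  finally show ?case .
qed

end

context hl_param
begin

subsection \<open>Pieri rules\<close>

definition Qlam :: "nat list \<Rightarrow> Lam" where "Qlam la = foldr jing la 1"

lemma Qlam_Nil [simp]: "Qlam [] = 1" and Qlam_Cons: "Qlam (n # la) = jing n (Qlam la)"
  by (simp_all add: Qlam_def)

lemma partition_split:
  assumes "is_partition la" "\<And>x. x \<in> set la \<Longrightarrow> x \<le> Suc N"
  shows "la = replicate (Defs.mult la (Suc N)) (Suc N) @ filter (\<lambda>x. x \<le> N) la"
  using assms
proof (induction la)
  case (Cons x xs)
  then have IH: "xs = replicate (Defs.mult xs (Suc N)) (Suc N) @ filter (\<lambda>x. x \<le> N) xs"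
    by (simp add: is_partition_Cons)
  show ?case
  proof (cases "x = Suc N")
    case True
    then show ?thesis using IH by (simp add: Defs.mult_def)
  next
    case False
    then have "x \<le> N" using Cons.prems(2)[of x] by simp
    then have le: "\<forall>y\<in>set xs. y \<le> N" using Cons.prems(1) by (auto simp: is_partition_Cons)
    then have "filter (\<lambda>x. x = Suc N) xs = []" by (auto simp: filter_empty_conv)
    moreover have "filter (\<lambda>x. x \<le> N) xs = xs" using le by simp
    ultimately show ?thesis using \<open>x \<le> N\<close> False by (simp add: Defs.mult_def)
  qed
qed (simp add: Defs.mult_def)

lemma Qlam_eq_jing_columns:
  assumes "is_partition la" "Defs.conj la (Suc N) = 0"
  shows "Qlam la = jing_columns N (Defs.conj la)"
proof -
  have "\<forall>x\<in>set la. x \<le> N" using parts_le_if_conj_0 assms(2) by blast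
  with assms(1) show ?thesis
  proof (induction N arbitrary: la)
    case 0
    then have "la = []" by (cases la) (auto simp: is_partition_Cons)
    then show ?case by simp
  next
    case (Suc N)
    let ?m = "Defs.mult la (Suc N)" and ?la = "filter (\<lambda>x. x \<le> N) la"
    have la: "la = replicate ?m (Suc N) @ ?la"
      by (rule partition_split) (use Suc.prems in auto)
    have "Qlam la = (jing (Suc N) ^^ ?m) (Qlam ?la)"
      by (subst la) (simp add: Qlam_def foldr_replicate)
    also have "Qlam ?la = jing_columns N (Defs.conj ?la)"
      by (rule Suc.IH) (use Suc.prems in \<open>auto simp: is_partition_def sorted_wrt_filter\<close>)
    also have "\<dots> = jing_columns N (Defs.conj la)"
    proof (rule jing_columns_cong)
      fix j assume "j \<in> {1..N}"
      then have "Defs.mult ?la j = Defs.mult la j"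
        by (simp add: Defs.mult_def cong: filter_cong)
          (metis (mono_tags, lifting) conj_commute)
      then show "Defs.conj ?la j - Defs.conj ?la (Suc j) = Defs.conj la j - Defs.conj la (Suc j)"
        by (simp add: mult_eq_conj)
    qed
    finally show ?case by (simp add: mult_eq_conj)
  qed
qed

text \<open>\<open>vs\<close> for parameter q; the summation sets, rather than a case distinction,
  supply the strip condition.\<close>

definition vs_gen :: "nat list \<Rightarrow> nat list \<Rightarrow> Qt" where
  "vs_gen la mu = (\<Prod>j\<in>{1..psize la}. gbinom (Defs.conj la j - Defs.conj la (Suc j)) (Defs.conj la j - Defs.conj mu j))"

lemma vs_gen_bound:
  assumes "psize la \<le> N"
  shows "vs_gen la mu = (\<Prod>j\<in>{1..N}. gbinom (Defs.conj la j - Defs.conj la (Suc j)) (Defs.conj la j - Defs.conj mu j))"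
  unfolding vs_gen_def
  by (rule prod.mono_neutral_left) (use assms in \<open>auto simp: conj_beyond\<close>)

definition strips_below :: "nat list \<Rightarrow> nat \<Rightarrow> nat list set" where
  "strips_below la r = {mu. is_partition mu \<and> vertical_strip la mu \<and> psize la = psize mu + r}"

definition strips_above :: "nat list \<Rightarrow> nat \<Rightarrow> nat list set" where
  "strips_above la r = {rho. is_partition rho \<and> vertical_strip rho la \<and> psize rho = psize la + r}"

lemma finite_strips_below [simp]: "finite (strips_below la r)"
  by (rule finite_subset[OF _ finite_partitions_le[of "psize la"]]) (auto simp: strips_below_def)

lemma finite_strips_above [simp]: "finite (strips_above la r)"
  by (rule finite_subset[OF _ finite_partitions_le[of "psize la + r"]]) (auto simp: strips_above_def)

lemma Tc_Qlam:
  assumes la: "is_partition la"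
  shows "Tc r (Qlam la) = (\<Sum>mu\<in>strips_below la r. cst (vs_gen la mu) * Qlam mu)"
proof -
  define N where "N = psize la"
  define c where "c = Defs.conj la"
  have cN: "c (Suc N) = 0" by (simp add: c_def N_def conj_beyond)
  define F where "F d = (if int (\<Sum>j\<in>{1..N}. c j - d j) = int r then
      cst (\<Prod>j\<in>{1..N}. gbinom (c j - c (Suc j)) (c j - d j)) * jing_columns N (d(Suc N := c (Suc N))) else 0)" for d
  let ?B = "\<lambda>j. {c (Suc j)..c j}"
  let ?S = "{mu. is_partition mu \<and> (\<forall>j\<in>{1..N}. Defs.conj mu j \<in> ?B j) \<and> Defs.conj mu (Suc N) = 0}"
  have S: "?S = {mu. is_partition mu \<and> vertical_strip la mu}" (is "_ = ?V")
  proof (intro equalityI subsetI)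
    fix mu assume mu: "mu \<in> ?S"
    have "Defs.conj mu j \<le> Defs.conj la j \<and> Defs.conj la (Suc j) \<le> Defs.conj mu j" if "j > 0" for j
    proof (cases "j \<le> N")
      case True then show ?thesis using mu that by (simp add: c_def)
    next
      case False
      then have "Defs.conj mu j \<le> Defs.conj mu (Suc N)" by (intro conj_mono) simp
      then show ?thesis using mu False by (simp add: N_def conj_beyond)
    qed
    then show "mu \<in> ?V" using mu la by (simp add: vertical_strip_iff_conj)
  next
    fix mu assume mu: "mu \<in> ?V"
    then have *: "Defs.conj mu j \<le> Defs.conj la j" "Defs.conj la (Suc j) \<le> Defs.conj mu j" if "j > 0" for j
      using that la by (auto simp: vertical_strip_iff_conj)
    have "Defs.conj mu (Suc N) = 0" using *(1)[of "Suc N"] cN by (simp add: c_def)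
    then show "mu \<in> ?S" using mu * by (auto simp: c_def)
  qed
  have "Tc r (Qlam la) = Tc_int (int r) (jing_columns N c)"
    using Qlam_eq_jing_columns[OF la, of N] cN by (simp add: Tc_int_def c_def)
  also have "\<dots> = (\<Sum>d\<in>PiE {1..N} ?B. F d)"
    unfolding F_def by (rule Tc_int_jing_columns) (simp add: c_def conj_Suc_le)
  also have "\<dots> = (\<Sum>mu\<in>?S. F (restrict (Defs.conj mu) {1..N}))"
    by (rule sum_PiE_columns) auto
  also have "\<dots> = (\<Sum>mu\<in>?V. if psize la = psize mu + r then cst (vs_gen la mu) * Qlam mu else 0)"
  proof (rule sum.cong[OF S])
    fix mu assume mu: "mu \<in> ?V"
    have le: "Defs.conj mu j \<le> c j" if "j > 0" for j
      using mu that la by (auto simp: vertical_strip_iff_conj c_def)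
    have mu0: "Defs.conj mu (Suc N) = 0" using le[of "Suc N"] cN by simp
    let ?d = "restrict (Defs.conj mu) {1..N}"
    have "(\<Sum>j\<in>{1..N}. c j - ?d j) + psize mu = (\<Sum>j\<in>{1..N}. (c j - Defs.conj mu j) + Defs.conj mu j)"
      using psize_eq_sum_conj[OF mu0] by (simp add: sum.distrib)
    also have "\<dots> = (\<Sum>j\<in>{1..N}. c j)" using le by (intro sum.cong) auto
    also have "\<dots> = psize la" using psize_eq_sum_conj[of la N] cN by (simp add: c_def)
    finally have 1: "int (\<Sum>j\<in>{1..N}. c j - ?d j) = int r \<longleftrightarrow> psize la = psize mu + r"
      by linarith
    have 2: "jing_columns N (?d(Suc N := c (Suc N))) = Qlam mu"
      unfolding Qlam_eq_jing_columns[OF _ mu0, OF mu[simplified, THEN conjunct1]]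
      by (rule jing_columns_cong) (auto simp: cN mu0 le_Suc_eq)
    have 3: "(\<Prod>j\<in>{1..N}. gbinom (c j - c (Suc j)) (c j - ?d j)) = vs_gen la mu"
      unfolding vs_gen_def N_def c_def by (rule prod.cong) auto
    show "F ?d = (if psize la = psize mu + r then cst (vs_gen la mu) * Qlam mu else 0)"
      unfolding F_def 1 2 3 ..
  qed
  also have "\<dots> = (\<Sum>mu\<in>{mu\<in>?V. psize la = psize mu + r}. cst (vs_gen la mu) * Qlam mu)"
  proof (rule sum.inter_filter[symmetric])
    show "finite ?V"
      by (rule finite_subset[OF _ finite_partitions_le[of "psize la"]])
        (use la in \<open>auto simp: vertical_strip_def contained_psize\<close>)
  qed
  also have "{mu\<in>?V. psize la = psize mu + r} = strips_below la r" by (auto simp: strips_below_def)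
  finally show ?thesis .
qed

definition bcoef :: "nat list \<Rightarrow> Qt" where
  "bcoef la = (\<Prod>j\<in>{1..psize la}. qpoch (Defs.conj la j - Defs.conj la (Suc j)))"

lemma bcoef_bound: "psize la \<le> N \<Longrightarrow> bcoef la = (\<Prod>j\<in>{1..N}. qpoch (Defs.conj la j - Defs.conj la (Suc j)))"
  unfolding bcoef_def by (rule prod.mono_neutral_left) (auto simp: conj_beyond)

lemma bcoef_nonzero [simp]: "bcoef la \<noteq> 0"
  by (simp add: bcoef_def)

definition Plam :: "nat list \<Rightarrow> Lam" where "Plam la = cst (1 / bcoef la) * Qlam la"

lemma Qlam_eq_Plam: "Qlam la = cst (bcoef la) * Plam la"
  by (simp add: Plam_def mult.assoc[symmetric] flip: cst_mult)

lemma Plam_Nil [simp]: "Plam [] = 1"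
  by (simp add: Plam_def bcoef_def)

text \<open>Both sides are the product over j of 1 / (\<open>qpoch (d j - c j)\<close>
  \<open>qpoch (c j - d (Suc j))\<close>). It converts the e-rule for Q into one for P.\<close>

lemma pieri_coefficient:
  assumes "\<And>j. j \<in> {1..Suc N} \<Longrightarrow> c j \<le> d j \<and> d (Suc j) \<le> c j" "c (Suc N) = 0" "\<And>j. j \<in> {1..N} \<Longrightarrow> c (Suc j) \<le> c j"
  shows "1 / qpoch (d 1 - c 1) * (\<Prod>j\<in>{1..N}. gbinom (c j - c (Suc j)) (d (Suc j) - c (Suc j)))
      / (\<Prod>j\<in>{1..N}. qpoch (c j - c (Suc j)))
    = (\<Prod>j\<in>{1..Suc N}. gbinom (d j - d (Suc j)) (d j - c j)) / (\<Prod>j\<in>{1..Suc N}. qpoch (d j - d (Suc j)))"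
proof -
  have "(\<Prod>j\<in>{1..Suc N}. gbinom (d j - d (Suc j)) (d j - c j)) / (\<Prod>j\<in>{1..Suc N}. qpoch (d j - d (Suc j)))
    = (\<Prod>j\<in>{1..Suc N}. 1 / qpoch (d j - c j) * (1 / qpoch (c j - d (Suc j))))"
    unfolding prod_dividef[symmetric]
  proof (rule prod.cong)
    fix j assume "j \<in> {1..Suc N}"
    then have "c j \<le> d j" "d (Suc j) \<le> c j" using assms by blast+
    then have "d j - d (Suc j) - (d j - c j) = c j - d (Suc j)" "d j - c j \<le> d j - d (Suc j)" by auto
    then show "gbinom (d j - d (Suc j)) (d j - c j) / qpoch (d j - d (Suc j)) = 1 / qpoch (d j - c j) * (1 / qpoch (c j - d (Suc j)))"
      by (simp add: gbinom_def)
  qed simp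
  also have "\<dots> = (\<Prod>j\<in>{1..Suc N}. 1 / qpoch (d j - c j)) * (\<Prod>j\<in>{1..Suc N}. 1 / qpoch (c j - d (Suc j)))"
    by (rule prod.distrib)
  also have "(\<Prod>j\<in>{1..Suc N}. 1 / qpoch (d j - c j)) = 1 / qpoch (d 1 - c 1) * (\<Prod>j\<in>{1..N}. 1 / qpoch (d (Suc j) - c (Suc j)))"
    by (subst prod.atLeast_Suc_atMost, simp) (simp only: prod.shift_bounds_cl_Suc_ivl)
  also have "(\<Prod>j\<in>{1..Suc N}. 1 / qpoch (c j - d (Suc j))) = (\<Prod>j\<in>{1..N}. 1 / qpoch (c j - d (Suc j)))"
    by (simp add: assms)
  also have "1 / qpoch (d 1 - c 1) * (\<Prod>j\<in>{1..N}. 1 / qpoch (d (Suc j) - c (Suc j))) * (\<Prod>j\<in>{1..N}. 1 / qpoch (c j - d (Suc j)))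
    = 1 / qpoch (d 1 - c 1) * (\<Prod>j\<in>{1..N}. gbinom (c j - c (Suc j)) (d (Suc j) - c (Suc j)) / qpoch (c j - c (Suc j)))"
    unfolding mult.assoc prod.distrib[symmetric]
  proof (intro arg_cong2[of _ _ _ _ "(*)"] prod.cong refl)
    fix j assume "j \<in> {1..N}"
    then have "c (Suc j) \<le> d (Suc j)" "d (Suc j) \<le> c j" using assms(1)[of j] assms(1)[of "Suc j"] by auto
    then have "c j - c (Suc j) - (d (Suc j) - c (Suc j)) = c j - d (Suc j)" "d (Suc j) - c (Suc j) \<le> c j - c (Suc j)" by auto
    then show "1 / qpoch (d (Suc j) - c (Suc j)) * (1 / qpoch (c j - d (Suc j))) =
        gbinom (c j - c (Suc j)) (d (Suc j) - c (Suc j)) / qpoch (c j - c (Suc j))"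
      by (simp add: gbinom_def)
  qed
  finally show ?thesis by (simp add: prod_dividef)
qed

text \<open>The normalization by \<open>bcoef\<close> turns the coefficients into those of
  \<open>Tc_Qlam\<close>; duality will rest on this agreement.\<close>

lemma ee_Plam:
  assumes la: "is_partition la"
  shows "ee r * Plam la = (\<Sum>rho\<in>strips_above la r. cst (vs_gen rho la) * Plam rho)"
proof -
  define N where "N = psize la"
  define c where "c = Defs.conj la"
  have c0: "c j = 0" if "j > N" for j using that by (simp add: c_def N_def conj_beyond)
  have cN: "c (Suc N) = 0" by (simp add: c0)
  define F where "F d = (if int (\<Sum>j\<in>{1..Suc N}. d j - c j) = int r then
      cst (1 / qpoch (d 1 - c 1) * (\<Prod>j\<in>{1..N}. gbinom (c j - c (Suc j)) (d (Suc j) - c (Suc j))))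
        * jing_columns (Suc N) (d(Suc (Suc N) := c (Suc N))) else 0)" for d
  let ?B = "\<lambda>j. if j = 1 then {c 1..c 1 + r} else {c j..c (j - 1)}"
  let ?S = "{mu. is_partition mu \<and> (\<forall>j\<in>{1..Suc N}. Defs.conj mu j \<in> ?B j) \<and> Defs.conj mu (Suc (Suc N)) = 0}"
  let ?T = "{rho\<in>?S. (\<Sum>j\<in>{1..Suc N}. Defs.conj rho j - c j) = r}"
  have strip: "c j \<le> Defs.conj rho j \<and> Defs.conj rho (Suc j) \<le> c j" if "rho \<in> ?S" "j > 0" for rho j
  proof (cases "j \<le> Suc N")
    case True
    then have 1: "Defs.conj rho j \<in> ?B j" using that by simp
    have "Defs.conj rho (Suc j) \<le> c j"
    proof (cases "j = Suc N")
      case True then show ?thesis using that by simp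
    next
      case False
      then have "Suc j \<in> {1..Suc N}" using True by simp
      then have "Defs.conj rho (Suc j) \<in> ?B (Suc j)" using that by blast
      then show ?thesis using that(2) by simp
    qed
    then show ?thesis using 1 by (auto split: if_splits)
  next
    case False
    then have "Defs.conj rho (Suc j) \<le> Defs.conj rho (Suc (Suc N))" by (intro conj_mono) simp
    then show ?thesis using that False c0[of j] by simp
  qed
  have size: "(\<Sum>j\<in>{1..Suc N}. Defs.conj rho j - c j) + psize la = psize rho"
    if "\<And>j. j > 0 \<Longrightarrow> c j \<le> Defs.conj rho j" "Defs.conj rho (Suc (Suc N)) = 0" for rho
  proof -
    have "psize la = (\<Sum>j\<in>{1..Suc N}. c j)"
      unfolding c_def by (rule psize_eq_sum_conj) (simp add: N_def conj_beyond)
    then have "(\<Sum>j\<in>{1..Suc N}. Defs.conj rho j - c j) + psize la = (\<Sum>j\<in>{1..Suc N}. Defs.conj rho j - c j + c j)"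
      by (simp only: sum.distrib)
    also have "\<dots> = (\<Sum>j\<in>{1..Suc N}. Defs.conj rho j)" using that by (intro sum.cong) auto
    also have "\<dots> = psize rho" using psize_eq_sum_conj[OF that(2)] by simp
    finally show ?thesis .
  qed
  have T: "?T = strips_above la r"
  proof (intro equalityI subsetI)
    fix rho assume rho: "rho \<in> ?T"
    then have st: "c j \<le> Defs.conj rho j \<and> Defs.conj rho (Suc j) \<le> c j" if "j > 0" for j
      using that by (intro strip) auto
    then show "rho \<in> strips_above la r"
      using rho size[of rho] la by (auto simp: strips_above_def vertical_strip_iff_conj c_def)
  next
    fix rho assume rho: "rho \<in> strips_above la r"
    then have st: "c j \<le> Defs.conj rho j" "Defs.conj rho (Suc j) \<le> c j" if "j > 0" for j
      using that la by (auto simp: strips_above_def vertical_strip_iff_conj c_def)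
    have 0: "Defs.conj rho (Suc (Suc N)) = 0" using st(2)[of "Suc N"] cN by simp
    have s: "(\<Sum>j\<in>{1..Suc N}. Defs.conj rho j - c j) = r"
      using size[of rho] st 0 rho by (simp add: strips_above_def)
    have "Defs.conj rho 1 - c 1 \<le> r"
      unfolding s[symmetric] by (rule member_le_sum[of 1 "{1..Suc N}" "\<lambda>j. Defs.conj rho j - c j"]) auto
    then have "Defs.conj rho j \<in> ?B j" if "j \<in> {1..Suc N}" for j
      using that st(1)[of j] st(2)[of "j - 1"] by (cases "j = 1") auto
    then show "rho \<in> ?T" using rho s 0 by (simp add: strips_above_def)
  qed
  have "ee r * Qlam la = ee_int (int r) * jing_columns N c"
    using Qlam_eq_jing_columns[OF la, of N] cN by (simp add: ee_int_def c_def)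
  also have "\<dots> = (\<Sum>d\<in>PiE {1..Suc N} ?B. F d)"
    unfolding F_def by (rule ee_int_jing_columns) (simp_all add: c_def conj_Suc_le)
  also have "\<dots> = (\<Sum>mu\<in>?S. F (restrict (Defs.conj mu) {1..Suc N}))"
    by (rule sum_PiE_columns) (auto split: if_splits)
  also have "\<dots> = (\<Sum>rho\<in>?S. if (\<Sum>j\<in>{1..Suc N}. Defs.conj rho j - c j) = r
       then cst (bcoef la * vs_gen rho la) * Plam rho else 0)"
  proof (rule sum.cong[OF refl])
    fix rho assume rho: "rho \<in> ?S"
    have st: "c j \<le> Defs.conj rho j" "Defs.conj rho (Suc j) \<le> c j" if "j > 0" for j
      using strip[OF rho that] by auto
    have 0: "Defs.conj rho (Suc (Suc N)) = 0" using rho by simp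
    let ?d = "restrict (Defs.conj rho) {1..Suc N}"
    have 1: "(\<Sum>j\<in>{1..Suc N}. ?d j - c j) = (\<Sum>j\<in>{1..Suc N}. Defs.conj rho j - c j)"
      by (rule sum.cong) auto
    have 2: "jing_columns (Suc N) (?d(Suc (Suc N) := c (Suc N))) = Qlam rho"
      unfolding Qlam_eq_jing_columns[OF _ 0, OF rho[simplified, THEN conjunct1]]
      by (rule jing_columns_cong) (auto simp: cN 0 le_Suc_eq)
    define A where "A = 1 / qpoch (?d 1 - c 1) * (\<Prod>j\<in>{1..N}. gbinom (c j - c (Suc j)) (?d (Suc j) - c (Suc j)))"
    have "A = 1 / qpoch (Defs.conj rho 1 - c 1) * (\<Prod>j\<in>{1..N}. gbinom (c j - c (Suc j)) (Defs.conj rho (Suc j) - c (Suc j)))"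
      unfolding A_def by (intro arg_cong2[of _ _ _ _ "(*)"] prod.cong) auto
    moreover have "bcoef la = (\<Prod>j\<in>{1..N}. qpoch (c j - c (Suc j)))"
      by (simp add: bcoef_def c_def N_def)
    moreover have "(\<Prod>j\<in>{1..Suc N}. gbinom (Defs.conj rho j - Defs.conj rho (Suc j)) (Defs.conj rho j - c j)) = vs_gen rho la"
      "(\<Prod>j\<in>{1..Suc N}. qpoch (Defs.conj rho j - Defs.conj rho (Suc j))) = bcoef rho"
    proof -
      have z: "Defs.conj rho j = 0" if "j > Suc N" for j
        using conj_mono[of "Suc (Suc N)" j rho] that 0 by simp
      define M where "M = psize rho + Suc N"
      have M: "psize rho \<le> M" by (simp add: M_def)
      show "(\<Prod>j\<in>{1..Suc N}. gbinom (Defs.conj rho j - Defs.conj rho (Suc j)) (Defs.conj rho j - c j)) = vs_gen rho la"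
        unfolding vs_gen_bound[OF M] c_def
        by (rule prod.mono_neutral_left) (auto simp: M_def z)
      show "(\<Prod>j\<in>{1..Suc N}. qpoch (Defs.conj rho j - Defs.conj rho (Suc j))) = bcoef rho"
        unfolding bcoef_bound[OF M]
        by (rule prod.mono_neutral_left) (auto simp: M_def z)
    qed
    ultimately have "A / bcoef la = vs_gen rho la / bcoef rho"
      using pieri_coefficient[of N c "Defs.conj rho"] st cN by (simp add: c_def conj_Suc_le)
    then have "A = bcoef la * vs_gen rho la * (1 / bcoef rho)" by (simp add: field_simps)
    then have "cst A * Qlam rho = cst (bcoef la * vs_gen rho la) * Plam rho"
      by (simp only: Plam_def cst_mult mult.assoc)
    then show "F ?d = (if (\<Sum>j\<in>{1..Suc N}. Defs.conj rho j - c j) = r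
       then cst (bcoef la * vs_gen rho la) * Plam rho else 0)"
      unfolding F_def 1 2 A_def[symmetric] by (simp only: of_nat_eq_iff)
  qed
  also have "\<dots> = (\<Sum>rho\<in>?T. cst (bcoef la * vs_gen rho la) * Plam rho)"
  proof (rule sum.inter_filter[symmetric])
    have "psize rho \<le> psize la + Suc N * (c 1 + r)" if "rho \<in> ?S" for rho
    proof -
      have "Defs.conj rho j - c j \<le> c 1 + r" if "j \<in> {1..Suc N}" for j
      proof -
        have "Defs.conj rho j \<in> ?B j" using that \<open>rho \<in> ?S\<close> by blast
        moreover have "c (j - 1) \<le> c 1" if "j \<noteq> 1" unfolding c_def
          using \<open>j \<in> {1..Suc N}\<close> that by (intro conj_mono) auto
        ultimately show ?thesis by (auto split: if_splits)
      qed
      then have "(\<Sum>j\<in>{1..Suc N}. Defs.conj rho j - c j) \<le> of_nat (card {1..Suc N}) * (c 1 + r)"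
        by (rule sum_bounded_above)
      then show ?thesis using size[of rho] strip[OF that] that by auto
    qed
    then show "finite ?S"
      by (intro finite_subset[OF _ finite_partitions_le[of "psize la + Suc N * (c 1 + r)"]]) auto
  qed
  finally have "ee r * Qlam la = cst (bcoef la) * (\<Sum>rho\<in>strips_above la r. cst (vs_gen rho la) * Plam rho)"
    by (simp only: T cst_mult mult.assoc sum_distrib_left)
  then have "cst (1 / bcoef la) * (ee r * Qlam la) = cst (1 / bcoef la) * cst (bcoef la) * (\<Sum>rho\<in>strips_above la r. cst (vs_gen rho la) * Plam rho)"
    by (simp only: mult.assoc)
  also have "cst (1 / bcoef la) * cst (bcoef la) = 1" by (simp flip: cst_mult)
  finally show ?thesis by (simp add: Plam_def mult.left_commute)
qed

lemma vs_gen_remove_column: "is_partition la \<Longrightarrow> vs_gen la (remove_column la) = 1"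
  by (simp add: vs_gen_def conj_remove_column)

end

subsection \<open>Unitriangularity with respect to dominance\<close>

definition below :: "nat list \<Rightarrow> nat list set" where
  "below la = {mu. is_partition mu \<and> dominated_strict mu la}"

definition low :: "(nat list \<Rightarrow> Lam) \<Rightarrow> nat list \<Rightarrow> Lam set" where
  "low F la = {f. \<exists>c. f = (\<Sum>mu\<in>below la. cst (c mu) * F mu)}"

lemma finite_below [simp]: "finite (below la)"
  by (rule finite_subset[OF _ finite_partitions_le[of "psize la"]]) (auto simp: below_def dominated_strict_def)

lemma below_trans: "nu \<in> below mu \<Longrightarrow> mu \<in> below la \<Longrightarrow> is_partition la \<Longrightarrow> nu \<in> below la"
  unfolding below_def dominated_strict_iff
  using dominated_trans dominated_antisym by blast

lemma low_0: "0 \<in> low F la"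
  unfolding low_def by (rule CollectI, rule exI[of _ "\<lambda>_. 0"]) simp

lemma low_add: "f \<in> low F la \<Longrightarrow> g \<in> low F la \<Longrightarrow> f + g \<in> low F la"
proof -
  assume "f \<in> low F la" "g \<in> low F la"
  then obtain c d where "f = (\<Sum>mu\<in>below la. cst (c mu) * F mu)" "g = (\<Sum>mu\<in>below la. cst (d mu) * F mu)"
    by (auto simp: low_def)
  then have "f + g = (\<Sum>mu\<in>below la. cst (c mu + d mu) * F mu)"
    by (simp add: sum.distrib cst_add distrib_right)
  then show ?thesis by (auto simp: low_def)
qed

lemma low_scale: "f \<in> low F la \<Longrightarrow> cst a * f \<in> low F la"
proof -
  assume "f \<in> low F la"
  then obtain c where "f = (\<Sum>mu\<in>below la. cst (c mu) * F mu)" by (auto simp: low_def)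
  then have "cst a * f = (\<Sum>mu\<in>below la. cst (a * c mu) * F mu)"
    by (simp add: sum_distrib_left cst_mult mult.assoc)
  then show ?thesis by (auto simp: low_def)
qed

lemma low_sum: "(\<And>x. x \<in> A \<Longrightarrow> f x \<in> low F la) \<Longrightarrow> sum f A \<in> low F la"
  by (induction A rule: infinite_finite_induct) (auto intro: low_0 low_add)

lemma low_base: "mu \<in> below la \<Longrightarrow> F mu \<in> low F la"
  unfolding low_def
  by (rule CollectI, rule exI[of _ "\<lambda>nu. if nu = mu then 1 else 0"])
    (simp add: if_distrib[of cst] if_distrib[of "\<lambda>x. x * _"] cong: if_cong)

lemma low_subset: "(\<And>mu. mu \<in> below la \<Longrightarrow> F mu \<in> low F' nu) \<Longrightarrow> low F la \<subseteq> low F' nu"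
proof
  fix f assume "f \<in> low F la" and base: "\<And>mu. mu \<in> below la \<Longrightarrow> F mu \<in> low F' nu"
  then obtain c where "f = (\<Sum>mu\<in>below la. cst (c mu) * F mu)" by (auto simp: low_def)
  then show "f \<in> low F' nu" by (simp add: low_sum low_scale base)
qed

lemma low_mono: "mu \<in> below la \<Longrightarrow> is_partition la \<Longrightarrow> low F mu \<subseteq> low F la"
  by (rule low_subset) (auto intro: low_base below_trans)

text \<open>A unitriangular change of family with respect to dominance. By \<open>tri_sym\<close>
  and \<open>tri_trans\<close>, two families are comparable as soon as a third is comparable with
  both.\<close>

definition tri :: "(nat list \<Rightarrow> Lam) \<Rightarrow> (nat list \<Rightarrow> Lam) \<Rightarrow> bool" where
  "tri F F' \<longleftrightarrow> (\<forall>la. is_partition la \<longrightarrow> F la - F' la \<in> low F' la)"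

lemma tri_low:
  assumes "tri F F'" "is_partition la"
  shows "low F la \<subseteq> low F' la"
proof (rule low_subset)
  fix mu assume mu: "mu \<in> below la"
  then have "F mu - F' mu \<in> low F' mu" using assms(1) by (simp add: tri_def below_def)
  then have "F mu - F' mu \<in> low F' la" using low_mono[OF mu assms(2)] by blast
  from low_add[OF this low_base[OF mu]] show "F mu \<in> low F' la" by simp
qed

text \<open>Inversion of a unitriangular matrix; the number of partitions strictly below drops in
  each step.\<close>

lemma tri_sym:
  assumes "tri F F'"
  shows "tri F' F"
  unfolding tri_def
proof (intro allI impI)
  fix la assume "is_partition la"
  then show "F' la - F la \<in> low F la"
  proof (induction "card (below la)" arbitrary: la rule: less_induct)
    case less
    have "low F' la \<subseteq> low F la"
    proof (rule low_subset)
      fix mu assume mu: "mu \<in> below la"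
      have "mu \<notin> below mu" by (simp add: below_def dominated_strict_def)
      then have "below mu \<subset> below la" using below_trans[OF _ mu less.prems] mu by blast
      then have "card (below mu) < card (below la)" by (simp add: psubset_card_mono)
      then have "F' mu - F mu \<in> low F mu" using less.hyps mu by (simp add: below_def)
      then have "F' mu - F mu \<in> low F la" using low_mono[OF mu less.prems] by blast
      from low_add[OF this low_base[OF mu]] show "F' mu \<in> low F la" by simp
    qed
    moreover have "F la - F' la \<in> low F' la" using assms less.prems by (simp add: tri_def)
    ultimately have "F la - F' la \<in> low F la" by blast
    from low_scale[OF this, of "-1"] show ?case by (simp add: cst_minus)
  qed
qed

lemma tri_trans:
  assumes "tri F F'" "tri F' H"
  shows "tri F H"
  unfolding tri_def
proof (intro allI impI)
  fix la assume la: "is_partition la"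
  have "F la - F' la \<in> low H la" "F' la - H la \<in> low H la"
    using assms la tri_low[OF assms(2) la] by (auto simp: tri_def)
  from low_add[OF this] show "F la - H la \<in> low H la" by simp
qed

text \<open>The product of e over the conjugate partition. It does not depend on q and so links the
  values q = t and q = 0.\<close>

definition elem_columns :: "nat list \<Rightarrow> Lam" where
  "elem_columns la = (\<Prod>j\<in>{1..psize la}. ee (Defs.conj la j))"

lemma elem_columns_bound: "psize la \<le> N \<Longrightarrow> elem_columns la = (\<Prod>j\<in>{1..N}. ee (Defs.conj la j))"
  unfolding elem_columns_def by (rule prod.mono_neutral_left) (auto simp: conj_beyond)

lemma elem_columns_Nil [simp]: "elem_columns [] = 1"
  by (simp add: elem_columns_def)

lemma elem_columns_remove_column:
  assumes "is_partition la"
  shows "elem_columns la = ee (length la) * elem_columns (remove_column la)"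
proof -
  have "elem_columns la = (\<Prod>j\<in>{1..Suc (psize la)}. ee (Defs.conj la j))"
    by (rule elem_columns_bound) simp
  also have "\<dots> = ee (Defs.conj la 1) * (\<Prod>j\<in>{1..psize la}. ee (Defs.conj la (Suc j)))"
    by (subst prod.atLeast_Suc_atMost, simp) (simp only: prod.shift_bounds_cl_Suc_ivl)
  also have "(\<Prod>j\<in>{1..psize la}. ee (Defs.conj la (Suc j))) = (\<Prod>j\<in>{1..psize la}. ee (Defs.conj (remove_column la) j))"
    by (rule prod.cong) (auto simp: conj_remove_column)
  also have "\<dots> = elem_columns (remove_column la)"
    by (rule elem_columns_bound[symmetric]) (simp add: psize_remove_column[OF assms])
  finally show ?thesis using assms by (simp add: conj_1)
qed

context hl_param
begin

text \<open>Peel off the first column. In e_l times the expansion for the remaining columns, P_la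
  occurs once, with coefficient 1 by \<open>vs_gen_remove_column\<close>; all other terms lie below
  \<open>la\<close>.\<close>

lemma tri_elem_columns_Plam: "tri elem_columns Plam"
  unfolding tri_def
proof (intro allI impI)
  fix la assume "is_partition la"
  then show "elem_columns la - Plam la \<in> low Plam la"
  proof (induction "psize la" arbitrary: la rule: less_induct)
    case less
    note la = less.prems
    show ?case
    proof (cases "la = []")
      case True then show ?thesis by (simp add: low_0)
    next
      case False
      let ?m = "remove_column la" and ?r = "length la"
      have m: "is_partition ?m" using la by (rule remove_column_partition)
      have size: "psize la = ?r + psize ?m" by (rule psize_remove_column[OF la])
      then have "elem_columns ?m - Plam ?m \<in> low Plam ?m" using less.hyps[OF _ m] False by simp
      then obtain c where c: "elem_columns ?m - Plam ?m = (\<Sum>nu\<in>below ?m. cst (c nu) * Plam nu)"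
        by (auto simp: low_def)
      have la_in: "la \<in> strips_above ?m ?r"
        using la size by (simp add: strips_above_def vertical_strip_remove_column)
      have dom: "rho \<in> below la" if "rho \<in> strips_above nu ?r" "dominated nu ?m" "rho \<noteq> la" for rho nu
        using that dominated_vertical_strip[OF la that(2), of rho]
        by (auto simp: strips_above_def below_def dominated_strict_iff)
      have "ee ?r * Plam ?m - Plam la = (\<Sum>rho\<in>strips_above ?m ?r - {la}. cst (vs_gen rho ?m) * Plam rho)"
        unfolding ee_Plam[OF m] by (subst sum.remove[OF _ la_in]) (simp_all add: vs_gen_remove_column[OF la])
      also have "\<dots> \<in> low Plam la"
        by (intro low_sum low_scale low_base) (auto intro: dom dominated_refl)
      finally have 1: "ee ?r * Plam ?m - Plam la \<in> low Plam la" .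
      have 2: "(\<Sum>nu\<in>below ?m. cst (c nu) * (ee ?r * Plam nu)) \<in> low Plam la"
      proof (rule low_sum)
        fix nu assume "nu \<in> below ?m"
        then have nu: "is_partition nu" "dominated nu ?m" "nu \<noteq> ?m"
          by (auto simp: below_def dominated_strict_iff)
        have "rho \<noteq> la" if "rho \<in> strips_above nu ?r" for rho
          using that dominated_vertical_strip_eq[OF la nu(1,2)] nu(3) by (auto simp: strips_above_def)
        then show "cst (c nu) * (ee ?r * Plam nu) \<in> low Plam la"
          unfolding ee_Plam[OF nu(1)] by (intro low_sum low_scale low_base) (auto intro: dom nu)
      qed
      have "elem_columns la - Plam la = (ee ?r * Plam ?m - Plam la) + ee ?r * (elem_columns ?m - Plam ?m)"
        by (simp add: elem_columns_remove_column[OF la] algebra_simps)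
      also have "ee ?r * (elem_columns ?m - Plam ?m) = (\<Sum>nu\<in>below ?m. cst (c nu) * (ee ?r * Plam nu))"
        by (simp add: c sum_distrib_left mult.left_commute)
      finally show ?thesis using low_add[OF 1 2] by (simp only:)
    qed
  qed
qed

end

subsection \<open>Schur functions as the specialization \<open>q = 0\<close>\<close>

interpretation zero: hl_param 0
  by unfold_locales (simp add: power_0_left)

lemma zero_qs: "zero.qs = hh"
proof -
  have "zero.qa = (\<lambda>_. 1)" by (rule ext) (simp add: zero.qa_def)
  then show ?thesis by simp
qed

lemma comm_ring_hom_tau: "comm_ring_hom (tau \<alpha>)"
  by unfold_locales (simp_all add: tau_add tau_mult)

lemma comm_ring_hom_const_poly: "comm_ring_hom (\<lambda>x::'r::comm_ring_1. [:x:])"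
  by unfold_locales simp_all

definition jacobi_trudi :: "nat list \<Rightarrow> Lam mat" where
  "jacobi_trudi la = mat (length la) (length la) (\<lambda>(i, j). hcomp_int (int (part la i) - int i + int j))"

lemma schur_eq_det: "schur la = det (jacobi_trudi la)"
proof -
  have "det (jacobi_trudi la) = (\<Sum>p\<in>{p. p permutes {0..<length la}}.
    of_int (sign p) * (\<Prod>i=0..<length la. jacobi_trudi la $$ (i, p i)))"
    by (rule det_def') (simp add: jacobi_trudi_def)
  also have "\<dots> = schur la"
    unfolding schur_def Let_def lessThan_atLeast0
  proof (intro sum.cong refl arg_cong2[of _ _ _ _ "(*)"] prod.cong)
    fix p i assume "p \<in> {p. p permutes {0..<length la}}" "i \<in> {0..<length la}"
    then have "p i < length la" "i < length la"
      using permutes_in_image[of p "{0..<length la}" i] by auto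
    then show "jacobi_trudi la $$ (i, p i) = hcomp_int (int (part la i) - int i + int (p i))"
      by (simp add: jacobi_trudi_def)
  qed
  finally show ?thesis by simp
qed

lemma tauS_hcomp_int: "zero.tauS (hcomp_int k) = [:hcomp_int k:] - monom 1 1 * [:hcomp_int (k - 1):]"
proof -
  consider "k < 0" | "k = 0" | m where "k = int (Suc m)"
    by (metis int_cases negative_zless of_nat_0 not0_implies_Suc)
  then show ?thesis
  proof cases
    case 3
    then have "nat k = Suc m" "nat (k - 1) = m" "\<not> k < 0" "\<not> k - 1 < 0" by auto
    then show ?thesis using zero.tauS_qs_rec[of m] by (simp add: hcomp_int_def hcomp_eq zero_qs)
  qed (simp_all add: hcomp_int_def hcomp_eq pCons_one)
qed

text \<open>Put the powers of \<open>w\<close> in the first row of the matrix. Subtracting \<open>w\<close> times the preceding column clears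
  that row except for its first entry and turns \<open>h\<^sub>k\<close> into \<open>h\<^sub>k - w h\<^bsub>k-1\<^esub> = S h\<^sub>k\<close> in the others.\<close>

lemma tauS_schur:
  fixes n :: nat and la :: "nat list"
  defines "A \<equiv> jacobi_trudi (n # la)"
  shows "zero.tauS (schur la) = (\<Sum>j<Suc (length la). monom (cofactor A 0 j) j)"
proof -
  define m where "m = length la"
  define w :: "Lam poly" where "w = monom 1 1"
  define M where "M = mat (Suc m) (Suc m) (\<lambda>(i, j). if i = 0 then monom (1::Lam) j else [:A $$ (i, j):])"
  define U where "U = mat (Suc m) (Suc m) (\<lambda>(k, j). if k = j then 1 else if Suc k = j then - w else 0)"
  have A: "A \<in> carrier_mat (Suc m) (Suc m)" by (simp add: A_def jacobi_trudi_def m_def)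
  have M: "M \<in> carrier_mat (Suc m) (Suc m)" and U: "U \<in> carrier_mat (Suc m) (Suc m)"
    by (simp_all add: M_def U_def)
  have "upper_triangular U" by (auto simp: U_def)
  then have "det U = prod_list (diag_mat U)" using U by (rule det_upper_triangular)
  also have "diag_mat U = map (\<lambda>_. 1) [0..<Suc m]"
    unfolding diag_mat_def by (auto simp: U_def)
  also have "prod_list (map (\<lambda>_. 1) [0..<Suc m]) = (1 :: Lam poly)" by (induction m) simp_all
  finally have detU: "det U = 1" .
  have MU: "(M * U) $$ (i, j) = M $$ (i, j) - (if j = 0 then 0 else w * M $$ (i, j - 1))"
    if "i < Suc m" "j < Suc m" for i j
  proof -
    have "(M * U) $$ (i, j) = (\<Sum>k<Suc m. M $$ (i, k) * U $$ (k, j))"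
      using that M U by (simp add: scalar_prod_def lessThan_atLeast0)
    also have "\<dots> = (\<Sum>k<Suc m. (if k = j then M $$ (i, k) else 0) + (if Suc k = j then - w * M $$ (i, k) else 0))"
      by (rule sum.cong) (use that in \<open>auto simp: U_def\<close>)
    also have "\<dots> = M $$ (i, j) + (\<Sum>k<Suc m. if Suc k = j then - w * M $$ (i, k) else 0)"
      using that by (simp add: sum.distrib del: sum.lessThan_Suc)
    also have "(\<Sum>k<Suc m. if Suc k = j then - w * M $$ (i, k) else 0) = (if j = 0 then 0 else - w * M $$ (i, j - 1))"
    proof (cases j)
      case (Suc l)
      then show ?thesis using that by (simp del: sum.lessThan_Suc)
    qed simp
    finally show ?thesis by simp
  qed
  have row0: "(M * U) $$ (0, j) = (if j = 0 then 1 else 0)" if "j < Suc m" for j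
  proof -
    have "M $$ (0, i) = monom 1 i" if "i < Suc m" for i using that by (simp add: M_def)
    then show ?thesis using that by (cases j) (simp_all add: MU w_def mult_monom)
  qed
  have "det (M * U) = (\<Sum>j<Suc m. (M * U) $$ (0, j) * cofactor (M * U) 0 j)"
    by (rule laplace_expansion_row) (use M U in auto)
  also have "\<dots> = (\<Sum>j<Suc m. if j = 0 then cofactor (M * U) 0 j else 0)"
    by (rule sum.cong) (auto simp: row0)
  also have "\<dots> = det (mat_delete (M * U) 0 0)"
    by (simp add: cofactor_def del: sum.lessThan_Suc)
  also have "mat_delete (M * U) 0 0 = map_mat zero.tauS (jacobi_trudi la)"
  proof (rule eq_matI)
    fix i j assume "i < dim_row (map_mat zero.tauS (jacobi_trudi la))" "j < dim_col (map_mat zero.tauS (jacobi_trudi la))"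
    then have ij: "i < m" "j < m" by (simp_all add: jacobi_trudi_def m_def)
    have "mat_delete (M * U) 0 0 $$ (i, j) = (M * U) $$ (Suc i, Suc j)"
      using ij M U by (simp add: mat_delete_def)
    also have "\<dots> = [:A $$ (Suc i, Suc j):] - w * [:A $$ (Suc i, j):]"
    proof -
      have "M $$ (Suc i, k) = [:A $$ (Suc i, k):]" if "k < Suc m" for k
        using that ij by (simp add: M_def)
      then show ?thesis using ij by (simp add: MU)
    qed
    also have "\<dots> = zero.tauS (hcomp_int (int (part la i) - int i + int j))"
      using ij by (simp add: A_def jacobi_trudi_def m_def tauS_hcomp_int w_def algebra_simps)
    finally show "mat_delete (M * U) 0 0 $$ (i, j) = map_mat zero.tauS (jacobi_trudi la) $$ (i, j)"
      using ij by (simp add: jacobi_trudi_def m_def)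
  qed (use M U in \<open>simp_all add: mat_delete_def jacobi_trudi_def m_def\<close>)
  also have "det (map_mat zero.tauS (jacobi_trudi la)) = zero.tauS (schur la)"
    by (simp add: comm_ring_hom.hom_det[OF comm_ring_hom_tau] schur_eq_det)
  finally have "zero.tauS (schur la) = det (M * U)" by simp
  also have "\<dots> = det M" using det_mult[OF M U] detU by simp
  \<comment> \<open>Expanded along its first row 1, w, w^2, ..., the unreduced matrix has cofactors
    free of w.\<close>
  also have "\<dots> = (\<Sum>j<Suc m. M $$ (0, j) * cofactor M 0 j)"
    by (rule laplace_expansion_row) (use M in auto)
  also have "\<dots> = (\<Sum>j<Suc m. monom (cofactor A 0 j) j)"
  proof (rule sum.cong)
    fix j assume j: "j \<in> {..<Suc m}"
    have "mat_delete M 0 j = map_mat (\<lambda>x. [:x:]) (mat_delete A 0 j)"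
      by (rule eq_matI) (use M A in \<open>auto simp: mat_delete_def M_def\<close>)
    moreover have "(- 1 :: Lam poly) ^ k = [:(- 1) ^ k:]" for k
      by (induction k) (simp_all add: pCons_one)
    ultimately have "cofactor M 0 j = [:cofactor A 0 j:]"
      by (simp add: cofactor_def comm_ring_hom.hom_det[OF comm_ring_hom_const_poly])
    then show "M $$ (0, j) * cofactor M 0 j = monom (cofactor A 0 j) j"
      using j by (simp add: M_def smult_monom)
  qed simp
  finally show ?thesis by (simp only: m_def)
qed

text \<open>The pairing replaces w^j by h_(n+j), the first row of the larger Jacobi-Trudi matrix,
  and turns \<open>tauS_schur\<close> into its Laplace expansion.\<close>

lemma jing_schur: "zero.jing n (schur la) = schur (n # la)"
proof -
  define A where "A = jacobi_trudi (n # la)"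
  have A: "A \<in> carrier_mat (Suc (length la)) (Suc (length la))" by (simp add: A_def jacobi_trudi_def)
  have "zero.pair_qs n (monom c j) = c * hh (n + j)" for c j
    using zero.pair_qs_monom_mult[of n c j 1] by (simp add: zero.pair_qs_def zero_qs)
  then have "zero.jing n (schur la) = (\<Sum>j<Suc (length la). cofactor A 0 j * hh (n + j))"
    unfolding zero.jing_def tauS_schur[of la n] A_def[symmetric] by (simp only: zero.pair_qs_sum)
  also have "\<dots> = (\<Sum>j<Suc (length la). A $$ (0, j) * cofactor A 0 j)"
    by (rule sum.cong) (simp_all add: A_def jacobi_trudi_def hcomp_int_def hcomp_eq nat_add_distrib mult.commute)
  also have "\<dots> = det A" by (rule laplace_expansion_row[symmetric]) (use A in auto)
  finally show ?thesis by (simp add: schur_eq_det A_def)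
qed

lemma zero_Qlam: "zero.Qlam la = schur la"
proof (induction la)
  case Nil
  show ?case by (simp add: schur_def)
qed (simp add: zero.Qlam_Cons jing_schur)

lemma zero_Plam: "zero.Plam la = schur la"
proof -
  have "zero.qpoch m = 1" for m by (simp add: zero.qpoch_def)
  then have "zero.bcoef la = 1" by (simp add: zero.bcoef_def)
  then show ?thesis by (simp add: zero.Plam_def zero_Qlam)
qed

lemma schur_single: "schur [r] = hh r"
  by (simp add: zero_Qlam[symmetric] zero.Qlam_Cons zero.jing_one zero_qs)

interpretation hl: hl_param tt
  by unfold_locales (rule tt_power_neq_1)

lemma Tc_eq_perp: "hl.Tc r f = perp (ee r) f"
proof -
  have "hl.ta = (\<lambda>k. (-1) ^ k / (1 - tt ^ Suc k))" by (rule ext) (simp only: hl.ta_def)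
  then show ?thesis by (simp only: perp_ee)
qed

lemma perp_ee_Qlam: "is_partition la \<Longrightarrow>
    perp (ee r) (hl.Qlam la) = (\<Sum>mu\<in>hl.strips_below la r. cst (hl.vs_gen la mu) * hl.Qlam mu)"
  using hl.Tc_Qlam[of la r] by (simp only: Tc_eq_perp)

subsection \<open>Orthogonality\<close>

text \<open>For n > 0 the image of B_n consists of sums of multiples of q_(n+i), which have no
  constant term.\<close>

lemma hl_inner_Qlam_1:
  assumes "is_partition la"
  shows "hl_inner (hl.Qlam la) 1 = (if la = [] then 1 else 0)"
proof (cases la)
  case Nil
  have "hl_inner 1 1 = Poly_Mapping.lookup 1 {#} * zt {#}"
    using hl_inner_single[of 1 "{#}"] by simp
  with Nil show ?thesis by (simp add: zt_def zrho_def)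
next
  case (Cons n xs)
  then have "n > 0" using assms by (simp add: is_partition_Cons)
  then have "Poly_Mapping.lookup (hl.jing n f) {#} = 0" for f
    by (simp add: hl.jing_def hl.pair_qs_def lookup_sum mult.commute[of "hl.qs _"] lookup_mult_G_empty)
  then have "hl_inner (hl.jing n (hl.Qlam xs)) 1 = 0"
    using hl_inner_single[of "hl.jing n (hl.Qlam xs)" "{#}"] by simp
  then show ?thesis by (simp add: Cons hl.Qlam_Cons)
qed

text \<open>With \<open>r\<close> the length of \<open>\<mu>\<close> and \<open>\<mu>'\<close> its truncation by one column, \<open>e\<^sub>r P\<^bsub>\<mu>'\<^esub>\<close> is \<open>P\<^sub>\<mu>\<close> plus terms indexed by longer
  partitions of the same size. Moving \<open>e\<^sub>r\<close> to the other side of the scalar product gives an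
  induction on size and, for equal size, downwards on length.\<close>

lemma hl_inner_Qlam_Plam:
  assumes "is_partition la" "is_partition mu"
  shows "hl_inner (hl.Qlam la) (hl.Plam mu) = (if la = mu then 1 else 0)"
proof -
  have "wf (measures [psize, \<lambda>mu. psize mu - length mu])" by (rule wf_measures)
  from this assms show ?thesis
  proof (induction mu arbitrary: la rule: wf_induct_rule)
    case (less mu)
    note la = less.prems(1) and mu = less.prems(2)
    show ?case
    proof (cases "mu = []")
      case True
      then show ?thesis using hl_inner_Qlam_1[OF la] by simp
    next
      case False
      let ?m = "remove_column mu" and ?r = "length mu"
      have m: "is_partition ?m" using mu by (rule remove_column_partition)
      have size: "psize mu = ?r + psize ?m" by (rule psize_remove_column[OF mu])
      let ?S = "hl.strips_above ?m ?r"
      have mu_in: "mu \<in> ?S"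
        using mu size by (simp add: hl.strips_above_def vertical_strip_remove_column)
      have IH: "hl_inner (hl.Qlam la) (hl.Plam rho) = (if la = rho then 1 else 0)" if "rho \<in> ?S - {mu}" for rho
      proof (rule less.IH[OF _ la])
        show rho: "is_partition rho" using that by (simp add: hl.strips_above_def)
        have ps: "psize rho = psize mu" using that size by (simp add: hl.strips_above_def)
        have "length rho > length mu"
          using that vertical_strip_eq_if_shorter[OF mu rho] ps by (auto simp: hl.strips_above_def not_le[symmetric])
        moreover have "length rho \<le> psize rho" using psize_remove_column[OF rho] by simp
        ultimately show "(rho, mu) \<in> measures [psize, \<lambda>mu. psize mu - length mu]"
          using ps by auto
      qed
      have "hl_inner (hl.Qlam la) (ee ?r * hl.Plam ?m) = hl_inner (perp (ee ?r) (hl.Qlam la)) (hl.Plam ?m)"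
        by (simp add: hl_inner_perp mult.commute)
      also have "\<dots> = (\<Sum>nu\<in>hl.strips_below la ?r. hl.vs_gen la nu * hl_inner (hl.Qlam nu) (hl.Plam ?m))"
        by (simp add: perp_ee_Qlam[OF la] hl_inner_sum_left hl_inner_scale_left)
      also have "\<dots> = (\<Sum>nu\<in>hl.strips_below la ?r. if nu = ?m then hl.vs_gen la nu else 0)"
      proof (rule sum.cong[OF refl])
        fix nu assume "nu \<in> hl.strips_below la ?r"
        then have "is_partition nu" by (simp add: hl.strips_below_def)
        then have "hl_inner (hl.Qlam nu) (hl.Plam ?m) = (if nu = ?m then 1 else 0)"
          using less.IH[of ?m nu] m size False by simp
        then show "hl.vs_gen la nu * hl_inner (hl.Qlam nu) (hl.Plam ?m) = (if nu = ?m then hl.vs_gen la nu else 0)"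
          by simp
      qed
      also have "\<dots> = (if ?m \<in> hl.strips_below la ?r then hl.vs_gen la ?m else 0)"
        by (simp only: sum.delta hl.finite_strips_below)
      also have "?m \<in> hl.strips_below la ?r \<longleftrightarrow> la \<in> ?S"
        using la m by (auto simp only: hl.strips_below_def hl.strips_above_def mem_Collect_eq)
      finally have 1: "hl_inner (hl.Qlam la) (ee ?r * hl.Plam ?m) = (if la \<in> ?S then hl.vs_gen la ?m else 0)" .
      have "hl_inner (hl.Qlam la) (ee ?r * hl.Plam ?m) =
          (\<Sum>rho\<in>?S. hl.vs_gen rho ?m * hl_inner (hl.Qlam la) (hl.Plam rho))"
        by (simp add: hl.ee_Plam[OF m] hl_inner_sum_right hl_inner_scale_right)
      also have "\<dots> = hl_inner (hl.Qlam la) (hl.Plam mu) + (\<Sum>rho\<in>?S - {mu}. hl.vs_gen rho ?m * hl_inner (hl.Qlam la) (hl.Plam rho))"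
        by (subst sum.remove[OF _ mu_in]) (simp_all add: hl.vs_gen_remove_column[OF mu])
      also have "(\<Sum>rho\<in>?S - {mu}. hl.vs_gen rho ?m * hl_inner (hl.Qlam la) (hl.Plam rho))
          = (\<Sum>rho\<in>?S - {mu}. if rho = la then hl.vs_gen la ?m else 0)"
        by (rule sum.cong) (auto simp: IH)
      also have "\<dots> = (if la \<in> ?S - {mu} then hl.vs_gen la ?m else 0)"
        by (simp only: sum.delta finite_Diff hl.finite_strips_above)
      \<comment> \<open>For \<open>la\<close> in \<open>?S - {mu}\<close> the same coefficient
        appears in both evaluations and leaves 0; for \<open>la = mu\<close> only the first contains
        it, and it is 1.\<close>
      finally show ?thesis
        using 1 mu_in hl.vs_gen_remove_column[OF mu] by (auto split: if_splits)
    qed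
  qed
qed

lemma hl_inner_Plam_Plam:
  assumes "is_partition la" "is_partition mu"
  shows "hl_inner (hl.Plam la) (hl.Plam mu) = (if la = mu then 1 / hl.bcoef la else 0)"
  using hl_inner_Qlam_Plam[OF assms] by (subst hl.Plam_def) (simp add: hl_inner_scale_left)

subsection \<open>Identification with the Hall--Littlewood functions\<close>

lemma tri_Plam_schur: "tri hl.Plam schur"
proof -
  have "zero.Plam = schur" by (rule ext) (rule zero_Plam)
  then show ?thesis using tri_trans[OF tri_sym[OF hl.tri_elem_columns_Plam] zero.tri_elem_columns_Plam] by simp
qed

text \<open>For uniqueness, a competitor P differs from \<open>hl.Plam\<close> at \<open>la\<close>
  only by lower terms. Below \<open>la\<close> the two families agree by induction, so orthogonality
  kills each coefficient of the difference.\<close>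

lemma HL_P_eq: "HL_P = (\<lambda>la. if is_partition la then hl.Plam la else 0)"
  unfolding HL_P_def
proof (rule the_equality)
  let ?P = "\<lambda>la. if is_partition la then hl.Plam la else 0"
  have "\<exists>c. hl.Plam la = schur la + (\<Sum>mu\<in>{mu. is_partition mu \<and> dominated_strict mu la}. cst (c mu) * schur mu)"
    if "is_partition la" for la
  proof -
    from tri_Plam_schur that obtain c where "hl.Plam la - schur la = (\<Sum>mu\<in>below la. cst (c mu) * schur mu)"
      by (auto simp: tri_def low_def)
    then show ?thesis by (auto simp: below_def algebra_simps)
  qed
  then show "(\<forall>la. \<not> is_partition la \<longrightarrow> ?P la = 0) \<and> (\<forall>la. is_partition la \<longrightarrow>
      (\<exists>c. ?P la = schur la + (\<Sum>mu\<in>{mu. is_partition mu \<and> dominated_strict mu la}. cst (c mu) * schur mu))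
      \<and> (\<forall>mu. is_partition mu \<and> mu \<noteq> la \<longrightarrow> hl_inner (?P la) (?P mu) = 0))"
    by (simp add: hl_inner_Plam_Plam)
next
  let ?P = "\<lambda>la. if is_partition la then hl.Plam la else 0"
  fix P
  assume P: "(\<forall>la. \<not> is_partition la \<longrightarrow> P la = 0) \<and> (\<forall>la. is_partition la \<longrightarrow>
      (\<exists>c. P la = schur la + (\<Sum>mu\<in>{mu. is_partition mu \<and> dominated_strict mu la}. cst (c mu) * schur mu))
      \<and> (\<forall>mu. is_partition mu \<and> mu \<noteq> la \<longrightarrow> hl_inner (P la) (P mu) = 0))"
  have "tri P schur"
    unfolding tri_def
  proof (intro allI impI)
    fix la assume "is_partition la"
    then obtain c where "P la = schur la + (\<Sum>mu\<in>below la. cst (c mu) * schur mu)"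
      using P unfolding below_def by blast
    then have "P la - schur la = (\<Sum>mu\<in>below la. cst (c mu) * schur mu)" by simp
    then show "P la - schur la \<in> low schur la" by (auto simp: low_def)
  qed
  then have tri: "tri P hl.Plam" using tri_trans tri_sym[OF tri_Plam_schur] by blast
  have "P la = hl.Plam la" if "is_partition la" for la
    using that
  proof (induction "card (below la)" arbitrary: la rule: less_induct)
    case less
    have IH: "P mu = hl.Plam mu" if mu: "mu \<in> below la" for mu
    proof (rule less.hyps)
      have "mu \<notin> below mu" by (simp add: below_def dominated_strict_def)
      then have "below mu \<subset> below la" using below_trans[OF _ mu less.prems] mu by blast
      then show "card (below mu) < card (below la)" by (simp add: psubset_card_mono)
    qed (use mu in \<open>simp add: below_def\<close>)
    from tri less.prems obtain c where c: "P la - hl.Plam la = (\<Sum>mu\<in>below la. cst (c mu) * hl.Plam mu)"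
      by (auto simp: tri_def low_def)
    have "c nu = 0" if nu: "nu \<in> below la" for nu
    proof -
      have nup: "is_partition nu" "nu \<noteq> la" using nu by (auto simp: below_def dominated_strict_def)
      have "hl_inner (P la) (hl.Plam nu) = 0"
        using P less.prems nup IH[OF nu] by metis
      then have "hl_inner (P la - hl.Plam la) (hl.Plam nu) = 0"
        using nup less.prems by (simp add: hl_inner_diff_left hl_inner_Plam_Plam)
      moreover have "hl_inner (P la - hl.Plam la) (hl.Plam nu) = (\<Sum>mu\<in>below la. if mu = nu then c nu * (1 / hl.bcoef nu) else 0)"
        unfolding c hl_inner_sum_left
        by (rule sum.cong) (auto simp: hl_inner_scale_left hl_inner_Plam_Plam nup below_def)
      ultimately show ?thesis using nu by simp
    qed
    then have "P la - hl.Plam la = 0" unfolding c by simp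
    then show ?case by simp
  qed
  then show "P = ?P" using P by (auto simp: fun_eq_iff)
qed

lemma bfac_eq: "bfac la = hl.bcoef la" if "is_partition la"
proof -
  have qpoch: "hl.qpoch m = (\<Prod>k\<in>{1..m}. 1 - tt ^ k)" for m
    by (induction m) (simp_all add: hl.qpoch_Suc)
  have "hl.bcoef la = (\<Prod>j\<in>{1..psize la}. hl.qpoch (Defs.mult la j))"
    by (simp add: hl.bcoef_def mult_eq_conj)
  also have "\<dots> = (\<Prod>j\<in>set la. hl.qpoch (Defs.mult la j))"
  proof (rule prod.mono_neutral_right)
    show "set la \<subseteq> {1..psize la}"
      using that le_psize by (auto simp: is_partition_def Suc_le_eq intro: gr0I)
    show "\<forall>i\<in>{1..psize la} - set la. hl.qpoch (Defs.mult la i) = 1"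
    proof
      fix i assume "i \<in> {1..psize la} - set la"
      then have "filter (\<lambda>x. x = i) la = []" by (auto simp: filter_empty_conv)
      then show "hl.qpoch (Defs.mult la i) = 1" by (simp add: Defs.mult_def)
    qed
  qed simp
  finally show ?thesis by (simp add: bfac_def qpoch)
qed

lemma HL_Q_eq: "is_partition la \<Longrightarrow> HL_Q la = hl.Qlam la"
  by (simp add: HL_Q_def HL_P_eq bfac_eq hl.Qlam_eq_Plam)

section \<open>The Hall-Littlewood functions span the ring\<close>

inductive_set span_Plam :: "Lam set" where
  base: "is_partition la \<Longrightarrow> hl.Plam la \<in> span_Plam"
| add: "f \<in> span_Plam \<Longrightarrow> g \<in> span_Plam \<Longrightarrow> f + g \<in> span_Plam"
| scale: "f \<in> span_Plam \<Longrightarrow> cst c * f \<in> span_Plam"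

lemma span_Plam_0: "0 \<in> span_Plam"
  using span_Plam.scale[OF span_Plam.base[of "[]"], of 0] by simp

lemma span_Plam_sum: "(\<And>x. x \<in> A \<Longrightarrow> f x \<in> span_Plam) \<Longrightarrow> sum f A \<in> span_Plam"
  by (induction A rule: infinite_finite_induct) (auto intro: span_Plam_0 span_Plam.add)

lemma span_Plam_ee: "f \<in> span_Plam \<Longrightarrow> ee r * f \<in> span_Plam"
proof (induction rule: span_Plam.induct)
  case (base la)
  then show ?case unfolding hl.ee_Plam[OF base]
    by (intro span_Plam_sum span_Plam.scale span_Plam.base) (simp add: hl.strips_above_def)
next
  case (add f g)
  then show ?case by (simp add: distrib_left span_Plam.add)
next
  case (scale f c)
  then show ?case by (simp add: mult.left_commute[of _ "cst c"] span_Plam.scale)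
qed

text \<open>Newton's identity expresses p_(k+1) through e's and smaller power sums, and the span is
  closed under e_r by the e-rule.\<close>

lemma span_Plam_pk: "f \<in> span_Plam \<Longrightarrow> pk k * f \<in> span_Plam"
proof (induction k arbitrary: f rule: less_induct)
  case (less k)
  have "of_nat (Suc k) * ee (Suc k) = (\<Sum>j<k. cst ((-1) ^ j) * (pk j * ee (k - j))) + cst ((-1) ^ k) * pk k"
    using G_newton_sum[of "Suc k" "\<lambda>k. (-1) ^ k"] by simp
  then have "cst ((-1) ^ k) * pk k = cst (of_nat (Suc k)) * ee (Suc k) - (\<Sum>j<k. cst ((-1) ^ j) * (pk j * ee (k - j)))"
    by (simp only: cst_of_nat) simp
  then have "cst ((-1) ^ k) * pk k * f = cst (of_nat (Suc k)) * (ee (Suc k) * f)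
      + (\<Sum>j<k. cst (- ((-1) ^ j)) * (pk j * (ee (k - j) * f)))"
    by (simp add: left_diff_distrib sum_distrib_right mult.assoc cst_minus sum_negf del: of_nat_Suc)
  also have "\<dots> \<in> span_Plam"
    by (intro span_Plam.add span_Plam.scale span_Plam_sum span_Plam_ee less) auto
  finally have "cst ((-1) ^ k) * (cst ((-1) ^ k) * pk k * f) \<in> span_Plam"
    by (rule span_Plam.scale)
  moreover have "cst ((-1) ^ k) * cst ((-1) ^ k) = 1" by (simp flip: cst_mult)
  ultimately show ?case by (simp add: mult.assoc[symmetric])
qed

lemma span_Plam_UNIV: "f \<in> span_Plam"
proof (induction f rule: Lam_induct)
  case one
  show ?case using span_Plam.base[of "[]"] by simp
qed (auto intro: span_Plam.intros span_Plam_pk)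

text \<open>Q and P differ by nonzero scalars, so testing against every Q tests against a spanning
  set. This yields uniqueness in the definition of skew functions.\<close>

lemma hl_inner_Qlam_eqI:
  assumes "\<And>nu. is_partition nu \<Longrightarrow> hl_inner f (hl.Qlam nu) = hl_inner g (hl.Qlam nu)"
  shows "f = g"
proof (rule hl_inner_eqI)
  fix x
  have "x \<in> span_Plam" by (rule span_Plam_UNIV)
  then show "hl_inner f x = hl_inner g x"
  proof induction
    case (base la)
    then show ?case by (simp add: hl.Plam_def hl_inner_scale_right assms)
  qed (simp_all add: hl_inner_add_right hl_inner_scale_right)
qed

lemma HL_P_skew_eq:
  assumes "is_partition la" "is_partition mu"
  shows "HL_P_skew la mu = perp (hl.Qlam mu) (hl.Plam la)"
  unfolding HL_P_skew_def
proof (rule the_equality)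
  show "\<forall>nu. is_partition nu \<longrightarrow>
    hl_inner (perp (hl.Qlam mu) (hl.Plam la)) (HL_Q nu) = hl_inner (HL_P la) (HL_Q nu * HL_Q mu)"
    using assms by (simp add: hl_inner_perp HL_Q_eq HL_P_eq)
next
  fix f assume "\<forall>nu. is_partition nu \<longrightarrow> hl_inner f (HL_Q nu) = hl_inner (HL_P la) (HL_Q nu * HL_Q mu)"
  then show "f = perp (hl.Qlam mu) (hl.Plam la)"
    using assms by (intro hl_inner_Qlam_eqI) (simp add: hl_inner_perp HL_Q_eq HL_P_eq)
qed

subsection \<open>Multiplication by complete symmetric functions\<close>

lemma qbinom_eq: "b \<le> a \<Longrightarrow> qbinom a b = hl.gbinom a b"
proof -
  assume b: "b \<le> a"
  have "hl.qpoch (a - b) * (\<Prod>i<b. 1 - tt ^ (a - i)) = hl.qpoch a"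
    using b
  proof (induction b)
    case (Suc b)
    have "hl.qpoch (a - b) = hl.qpoch (a - Suc b) * (1 - tt ^ (a - b))"
      using hl.qpoch_Suc[of "a - Suc b"] Suc.prems by (simp add: Suc_diff_Suc)
    then show ?case using Suc by (simp add: mult_ac)
  qed simp
  then have "(\<Prod>i<b. 1 - tt ^ (a - i)) = hl.qpoch a / hl.qpoch (a - b)"
    by (simp add: field_simps)
  then show ?thesis using b by (simp add: qbinom_def hl.gbinom_def hl.qpoch_def divide_divide_eq_left mult.commute)
qed

lemma vs_eq_vs_gen:
  assumes "is_partition la" "is_partition mu" "vertical_strip la mu"
  shows "vs la mu = hl.vs_gen la mu"
proof -
  have "qbinom (Defs.conj la j - Defs.conj la (j + 1)) (Defs.conj la j - Defs.conj mu j)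
      = hl.gbinom (Defs.conj la j - Defs.conj la (Suc j)) (Defs.conj la j - Defs.conj mu j)" if "j > 0" for j
    using assms that by (simp add: vertical_strip_iff_conj qbinom_eq diff_le_mono2)
  then show ?thesis using assms(3) by (simp add: vs_def hl.vs_gen_def)
qed

lemma zero_choose_two [simp]: "(0::nat) choose 2 = 0"
  by (simp add: numeral_2_eq_2)

text \<open>The power of t is distributed over the columns, and empty columns contribute 1, so any
  common bound N may be used.\<close>

lemma sk_bound:
  assumes "psize la \<le> N" "is_partition la" "is_partition mu" "contained mu la"
  shows "sk la mu = (\<Prod>j\<in>{1..N}. tt ^ ((Defs.conj la j - Defs.conj mu j) choose 2) *
    hl.gbinom (Defs.conj la j - Defs.conj mu (Suc j)) (Defs.conj mu j - Defs.conj mu (Suc j)))"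
proof -
  have le: "Defs.conj mu j \<le> Defs.conj la j" if "j > 0" for j
    using assms that by (simp add: contained_iff_conj)
  have "sk la mu = (\<Prod>j\<in>{1..psize la}. tt ^ ((Defs.conj la j - Defs.conj mu j) choose 2) *
    hl.gbinom (Defs.conj la j - Defs.conj mu (Suc j)) (Defs.conj mu j - Defs.conj mu (Suc j)))"
    unfolding sk_def power_sum prod.distrib mult_eq_conj
    by (intro arg_cong2[of _ _ _ _ "(*)"] prod.cong) (auto intro!: qbinom_eq diff_le_mono le)
  also have "\<dots> = (\<Prod>j\<in>{1..N}. tt ^ ((Defs.conj la j - Defs.conj mu j) choose 2) *
    hl.gbinom (Defs.conj la j - Defs.conj mu (Suc j)) (Defs.conj mu j - Defs.conj mu (Suc j)))"
  proof (rule prod.mono_neutral_left)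
    show "\<forall>j\<in>{1..N} - {1..psize la}. tt ^ ((Defs.conj la j - Defs.conj mu j) choose 2) *
      hl.gbinom (Defs.conj la j - Defs.conj mu (Suc j)) (Defs.conj mu j - Defs.conj mu (Suc j)) = 1"
    proof
      fix j assume "j \<in> {1..N} - {1..psize la}"
      then have "j > 0" "Defs.conj la j = 0" by (auto simp: conj_beyond)
      then show "tt ^ ((Defs.conj la j - Defs.conj mu j) choose 2) *
        hl.gbinom (Defs.conj la j - Defs.conj mu (Suc j)) (Defs.conj mu j - Defs.conj mu (Suc j)) = 1"
        using le[of j] by simp
    qed
  qed (use assms in auto)
  finally show ?thesis .
qed

text \<open>The product of 1 - x t^i over i < n, expanded by the t-binomial theorem, at x = 1.
  Pascal's rule makes the sum telescope.\<close>

lemma gbinom_alternating_sum: "n > 0 \<Longrightarrow> (\<Sum>y\<le>n. (-1) ^ y * tt ^ (y choose 2) * hl.gbinom n y) = 0"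
proof -
  assume "n > 0"
  then obtain m where n: "n = Suc m" by (cases n) auto
  have ch: "Suc y choose 2 = y + (y choose 2)" for y
    by (simp add: numeral_2_eq_2)
  have "(\<Sum>y\<le>Suc m. (-1) ^ y * tt ^ (y choose 2) * hl.gbinom (Suc m) y) =
     1 + (\<Sum>y\<le>m. (-1) ^ Suc y * tt ^ (Suc y choose 2) * (tt ^ Suc y * hl.gbinom m (Suc y) + hl.gbinom m y))"
    unfolding sum.atMost_Suc_shift by (simp add: hl.gbinom_pascal' del: power_Suc)
  also have "\<dots> = 1 + (\<Sum>y\<le>m. (-1) ^ Suc y * tt ^ (Suc y choose 2) * (tt ^ Suc y * hl.gbinom m (Suc y)))
      - (\<Sum>y\<le>m. (-1) ^ y * tt ^ (y choose 2) * (tt ^ y * hl.gbinom m y))"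
    unfolding add_diff_eq[symmetric] sum_subtractf[symmetric]
    by (intro arg_cong2[of _ _ _ _ "(+)"] sum.cong) (auto simp: ch power_add algebra_simps)
  also have "1 + (\<Sum>y\<le>m. (-1) ^ Suc y * tt ^ (Suc y choose 2) * (tt ^ Suc y * hl.gbinom m (Suc y)))
     = (\<Sum>y\<le>Suc m. (-1) ^ y * tt ^ (y choose 2) * (tt ^ y * hl.gbinom m y))"
    unfolding sum.atMost_Suc_shift by simp
  also have "\<dots> = (\<Sum>y\<le>m. (-1) ^ y * tt ^ (y choose 2) * (tt ^ y * hl.gbinom m y))"
    by (simp add: hl.gbinom_gt)
  finally show ?thesis by (simp add: n)
qed

text \<open>L and A are the lengths of one column in the inner and the outer partition, M the length
  of the next column in both. Regrouping the two binomials isolates a factor independent of x and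
  leaves \<open>gbinom_alternating_sum\<close>.\<close>

lemma column_sum_zero:
  assumes "M \<le> L" "L < A"
  shows "(\<Sum>x\<in>{L..A}. (-1) ^ (A - x) * (tt ^ ((x - L) choose 2) * hl.gbinom (x - M) (L - M)) * hl.gbinom (A - M) (A - x)) = 0"
proof -
  obtain l where L: "L = M + l" using assms by (metis le_Suc_ex)
  obtain n where A: "A = L + n" "n > 0" using assms by (metis less_imp_add_positive)
  have "(\<Sum>x\<in>{L..A}. (-1) ^ (A - x) * (tt ^ ((x - L) choose 2) * hl.gbinom (x - M) (L - M)) * hl.gbinom (A - M) (A - x))
    = (\<Sum>y\<le>n. (-1) ^ (n - y) * (tt ^ (y choose 2) * hl.gbinom (l + y) l) * hl.gbinom (l + n) (n - y))"
  proof -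
    have "{L..A} = {0 + L..n + L}" by (simp add: A add.commute)
    then show ?thesis
      unfolding atMost_atLeast0 by (simp only: sum.shift_bounds_cl_nat_ivl) (simp add: A L add_ac)
  qed
  also have "\<dots> = (\<Sum>y\<le>n. (-1) ^ n * hl.gbinom (l + n) l * ((-1) ^ y * tt ^ (y choose 2) * hl.gbinom n y))"
  proof (rule sum.cong)
    fix y assume "y \<in> {..n}"
    then have y: "y \<le> n" by simp
    have "(-1 :: Qt) ^ (n - y) = (-1) ^ n * (-1) ^ y"
      using y by (simp add: power_add[symmetric] uminus_power_if)
    moreover have "hl.gbinom (l + y) l * hl.gbinom (l + n) (n - y) = hl.gbinom (l + n) l * hl.gbinom n y"
      using y by (simp add: hl.gbinom_def field_simps)
    ultimately show "(-1) ^ (n - y) * (tt ^ (y choose 2) * hl.gbinom (l + y) l) * hl.gbinom (l + n) (n - y)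
        = (-1) ^ n * hl.gbinom (l + n) l * ((-1) ^ y * tt ^ (y choose 2) * hl.gbinom n y)"
      by (simp add: mult_ac)
  qed simp
  also have "\<dots> = 0" unfolding sum_distrib_left[symmetric] gbinom_alternating_sum[OF A(2)] by simp
  finally show ?thesis .
qed

definition between :: "nat list \<Rightarrow> nat list \<Rightarrow> nat list set" where
  "between la rho = {nu. is_partition nu \<and> contained la nu \<and> vertical_strip rho nu}"

text \<open>The sum factors over columns; the factor of the last column in which \<open>\<lambda>\<close> and \<open>\<rho>\<close> differ vanishes.\<close>

lemma sum_between_zero:
  assumes la: "is_partition la" and rho: "is_partition rho" and con: "contained la rho" and ne: "la \<noteq> rho"
  shows "(\<Sum>nu\<in>between la rho. (-1) ^ (psize rho - psize nu) * sk nu la * hl.vs_gen rho nu) = 0"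
proof -
  define N where "N = psize rho"
  define L where "L = Defs.conj la"
  define R where "R = Defs.conj rho"
  have LR: "L j \<le> R j" if "j > 0" for j
    using con that by (simp add: contained_iff_conj la rho L_def R_def)
  have R0: "R j = 0" if "j > N" for j using that by (simp add: R_def N_def conj_beyond)
  have L0: "L j = 0" if "j > N" for j using that LR[of j] R0[of j] by simp
  let ?B = "\<lambda>j. {max (L j) (R (Suc j))..R j}"
  define f where "f j x = (-1) ^ (R j - x) * (tt ^ ((x - L j) choose 2) * hl.gbinom (x - L (Suc j)) (L j - L (Suc j)))
      * hl.gbinom (R j - R (Suc j)) (R j - x)" for j x
  let ?S = "{nu. is_partition nu \<and> (\<forall>j\<in>{1..N}. Defs.conj nu j \<in> ?B j) \<and> Defs.conj nu (Suc N) = 0}"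
  have S: "between la rho = ?S"
  proof (intro equalityI subsetI)
    fix nu assume nu: "nu \<in> between la rho"
    then have *: "Defs.conj nu j \<in> ?B j" if "j > 0" for j
      using that la rho by (auto simp: between_def vertical_strip_iff_conj contained_iff_conj L_def R_def)
    then show "nu \<in> ?S" using nu *[of "Suc N"] R0[of "Suc N"] by (auto simp: between_def)
  next
    fix nu assume nu: "nu \<in> ?S"
    have *: "Defs.conj nu j \<in> ?B j" if "j > 0" for j
    proof (cases "j \<le> N")
      case False
      then have "Defs.conj nu j \<le> Defs.conj nu (Suc N)" by (intro conj_mono) simp
      then show ?thesis using nu False R0[of j] R0[of "Suc j"] L0[of j] by simp
    qed (use nu that in auto)
    then show "nu \<in> between la rho"
      using nu la rho by (auto simp: between_def vertical_strip_iff_conj contained_iff_conj L_def R_def)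
  qed
  have "(\<Sum>nu\<in>between la rho. (-1) ^ (psize rho - psize nu) * sk nu la * hl.vs_gen rho nu)
     = (\<Sum>nu\<in>?S. \<Prod>j\<in>{1..N}. f j (restrict (Defs.conj nu) {1..N} j))"
  proof (rule sum.cong[OF S])
    fix nu assume "nu \<in> ?S"
    then have nu: "nu \<in> between la rho" "Defs.conj nu (Suc N) = 0" using S by auto
    then have nup: "is_partition nu" "contained la nu" "vertical_strip rho nu" by (auto simp: between_def)
    have le: "Defs.conj nu j \<le> R j" if "j > 0" for j
      using nup that rho by (auto simp: vertical_strip_iff_conj R_def)
    have "(\<Sum>j\<in>{1..N}. R j - Defs.conj nu j) + psize nu = (\<Sum>j\<in>{1..N}. R j - Defs.conj nu j + Defs.conj nu j)"
      using psize_eq_sum_conj[OF nu(2)] by (simp add: sum.distrib)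
    also have "\<dots> = (\<Sum>j\<in>{1..N}. R j)" using le by (intro sum.cong) auto
    also have "\<dots> = psize rho" unfolding R_def by (rule psize_eq_sum_conj[symmetric]) (use R0[of "Suc N"] in \<open>simp add: R_def\<close>)
    finally have s: "psize rho - psize nu = (\<Sum>j\<in>{1..N}. R j - Defs.conj nu j)" by simp
    have "psize nu \<le> N" using contained_psize[OF nup(1) rho] nup(3) by (simp add: N_def vertical_strip_def)
    then have sk: "sk nu la = (\<Prod>j\<in>{1..N}. tt ^ ((Defs.conj nu j - L j) choose 2) *
      hl.gbinom (Defs.conj nu j - L (Suc j)) (L j - L (Suc j)))"
      unfolding L_def by (rule sk_bound[OF _ nup(1) la nup(2)])
    have "(-1) ^ (psize rho - psize nu) * sk nu la * hl.vs_gen rho nu = (\<Prod>j\<in>{1..N}. f j (Defs.conj nu j))"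
      unfolding s power_sum sk hl.vs_gen_def f_def prod.distrib R_def N_def by (simp add: mult.assoc)
    also have "\<dots> = (\<Prod>j\<in>{1..N}. f j (restrict (Defs.conj nu) {1..N} j))"
      by (rule prod.cong) auto
    finally show "(-1) ^ (psize rho - psize nu) * sk nu la * hl.vs_gen rho nu = (\<Prod>j\<in>{1..N}. f j (restrict (Defs.conj nu) {1..N} j))" .
  qed
  also have "\<dots> = (\<Sum>d\<in>PiE {1..N} ?B. \<Prod>j\<in>{1..N}. f j (d j))"
    by (rule sum_PiE_columns[symmetric]) auto
  also have "\<dots> = (\<Prod>j\<in>{1..N}. \<Sum>x\<in>?B j. f j x)"
    by (rule prod_sum_PiE[symmetric]) auto
  also have "\<dots> = 0"
  proof -
    define J where "J = {j. j > 0 \<and> L j \<noteq> R j}"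
    have "J \<noteq> {}"
    proof
      assume "J = {}"
      then have "\<And>j. j > 0 \<Longrightarrow> Defs.conj la j = Defs.conj rho j" unfolding J_def L_def R_def by blast
      then show False using partition_eq_if_conj_eq[OF la rho] ne by blast
    qed
    have sub: "J \<subseteq> {1..N}" using R0 L0 by (auto simp: J_def Suc_le_eq) (metis not_le)
    then have fin: "finite J" by (rule finite_subset) simp
    define j where "j = Max J"
    have j: "j \<in> J" using fin \<open>J \<noteq> {}\<close> by (simp add: j_def)
    have "Suc j \<notin> J" using Max_ge[OF fin, of "Suc j"] by (auto simp: j_def)
    \<comment> \<open>This gives the \<open>sk\<close> and \<open>vs_gen\<close> factors the same M
      and reduces the lower end of the interval to \<open>L j\<close>.\<close>
    then have eq: "L (Suc j) = R (Suc j)" by (simp add: J_def)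
    have le: "L (Suc j) \<le> L j" unfolding L_def by (rule conj_Suc_le)
    have "L j < R j" using j LR[of j] by (auto simp: J_def)
    then have "(\<Sum>x\<in>?B j. f j x) = 0"
      using column_sum_zero[OF le, of "R j"] le unfolding f_def eq[symmetric] by (simp add: max_absorb1)
    then show ?thesis using j sub by (intro prod_zero) auto
  qed
  finally show ?thesis .
qed

definition above :: "nat list \<Rightarrow> nat \<Rightarrow> nat list set" where
  "above la r = {rho. is_partition rho \<and> contained la rho \<and> psize rho = psize la + r}"

lemma finite_above [simp]: "finite (above la r)"
  by (rule finite_subset[OF _ finite_partitions_le[of "psize la + r"]]) (auto simp: above_def)

lemma finite_between [simp]: "is_partition rho \<Longrightarrow> finite (between la rho)"
  by (rule finite_subset[OF _ finite_partitions_le[of "psize rho"]])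
    (auto simp: between_def vertical_strip_def contained_psize)

lemma contained_eq:
  assumes "is_partition la" "is_partition rho" "contained la rho" "psize rho = psize la"
  shows "rho = la"
proof (rule dominated_antisym[OF assms(2,1)])
  have "(\<Sum>i<k. part la i) \<le> (\<Sum>i<k. part rho i)" for k
    using assms(3) by (intro sum_mono) (simp add: contained_def)
  then show "dominated la rho" using assms(4) by (simp add: dominated_def)
  have "part la i = part rho i" for i
  proof -
    define K where "K = Suc i + length la + length rho"
    have "psize la = (\<Sum>i<K. part la i)" "psize rho = (\<Sum>i<K. part rho i)"
      by (rule psize_eq_sum_part; simp add: K_def)+
    then show ?thesis
      using sum_mono_inv[of "part la" "{..<K}" "part rho" i] assms(3,4) by (simp add: contained_def K_def)
  qed
  then show "dominated rho la" using assms(4) by (simp add: dominated_def)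
qed

text \<open>The relation between e and h determines h_r P recursively from smaller r. The right-hand
  side obeys the same recursion by \<open>sum_between_zero\<close>.\<close>

lemma hh_Plam:
  assumes la: "is_partition la"
  shows "hh r * hl.Plam la = (\<Sum>rho\<in>above la r. cst (sk rho la) * hl.Plam rho)"
proof (induction r rule: less_induct)
  case (less r)
  show ?case
  proof (cases "r = 0")
    case True
    have "above la 0 = {la}"
      using la contained_eq[OF la] by (auto simp: above_def contained_refl)
    moreover have "sk la la = 1"
      using sk_bound[OF order_refl la la contained_refl] by (simp add: numeral_2_eq_2)
    ultimately show ?thesis using True by simp
  next
    case False
    define g where "g i nu rho = cst ((-1) ^ i * sk nu la * hl.vs_gen rho nu) * hl.Plam rho" for i nu rho
    have "(\<Sum>i\<le>r. \<Sum>nu\<in>above la (r - i). \<Sum>rho\<in>hl.strips_above nu i. g i nu rho)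
        = (\<Sum>(i, nu, rho)\<in>(SIGMA i:{..r}. SIGMA nu:above la (r - i). hl.strips_above nu i). g i nu rho)"
      by (simp add: sum.Sigma)
    \<comment> \<open>Group by the outer partition \<open>rho\<close>; the degree i is recovered as
      the size of the strip.\<close>
    also have "\<dots> = (\<Sum>(rho, nu)\<in>(SIGMA rho:above la r. between la rho). g (psize rho - psize nu) nu rho)"
    proof (rule sum.reindex_bij_witness[of _ "\<lambda>(rho, nu). (psize rho - psize nu, nu, rho)" "\<lambda>(i, nu, rho). (rho, nu)"])
      fix p assume "p \<in> (SIGMA i:{..r}. SIGMA nu:above la (r - i). hl.strips_above nu i)"
      then obtain i nu rho where p: "p = (i, nu, rho)"
        and *: "i \<le> r" "nu \<in> above la (r - i)" "rho \<in> hl.strips_above nu i" by auto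
      show "(case case p of (i, nu, rho) \<Rightarrow> (rho, nu) of (rho, nu) \<Rightarrow> (psize rho - psize nu, nu, rho)) = p"
        "(case case p of (i, nu, rho) \<Rightarrow> (rho, nu) of (rho, nu) \<Rightarrow> g (psize rho - psize nu) nu rho)
          = (case p of (i, nu, rho) \<Rightarrow> g i nu rho)"
        using * by (simp_all add: p hl.strips_above_def)
      show "(case p of (i, nu, rho) \<Rightarrow> (rho, nu)) \<in> (SIGMA rho:above la r. between la rho)"
        using * by (auto simp: p above_def between_def hl.strips_above_def vertical_strip_def intro: contained_trans)
    next
      fix p assume "p \<in> (SIGMA rho:above la r. between la rho)"
      then obtain nu rho where p: "p = (rho, nu)" and *: "rho \<in> above la r" "nu \<in> between la rho" by auto
      then have "psize la \<le> psize nu" "psize nu \<le> psize rho"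
        using la contained_psize[of nu rho] contained_psize[of la nu]
        by (auto simp: above_def between_def vertical_strip_def)
      then show "(case p of (rho, nu) \<Rightarrow> (psize rho - psize nu, nu, rho))
          \<in> (SIGMA i:{..r}. SIGMA nu:above la (r - i). hl.strips_above nu i)"
        using * by (auto simp: p above_def between_def hl.strips_above_def)
    qed auto
    also have "\<dots> = (\<Sum>rho\<in>above la r. \<Sum>nu\<in>between la rho. g (psize rho - psize nu) nu rho)"
      by (rule sum.Sigma[symmetric], simp) (auto simp: above_def)
    also have "\<dots> = (\<Sum>rho\<in>above la r. 0)"
    proof (rule sum.cong[OF refl])
      fix rho assume "rho \<in> above la r"
      then have rho: "is_partition rho" "contained la rho" "la \<noteq> rho" using False by (auto simp: above_def)
      show "(\<Sum>nu\<in>between la rho. g (psize rho - psize nu) nu rho) = 0"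
        using sum_between_zero[OF la rho] by (simp add: g_def flip: sum_distrib_right cst_sum)
    qed
    finally have zero: "(\<Sum>i\<le>r. \<Sum>nu\<in>above la (r - i). \<Sum>rho\<in>hl.strips_above nu i. g i nu rho) = 0" by simp
    have "(\<Sum>i\<le>r. (-1) ^ i * ee i * hh (r - i)) * hl.Plam la = 0"
      using False by (simp add: ee_hh_sum)
    then have zero': "(\<Sum>i\<le>r. (-1) ^ i * (ee i * (hh (r - i) * hl.Plam la))) = 0"
      by (simp add: sum_distrib_right mult.assoc)
    have step: "(-1) ^ i * (ee i * (\<Sum>nu\<in>above la (r - i). cst (sk nu la) * hl.Plam nu))
        = (\<Sum>nu\<in>above la (r - i). \<Sum>rho\<in>hl.strips_above nu i. g i nu rho)" for i
    proof -
      have "(-1) ^ i * (ee i * (\<Sum>nu\<in>above la (r - i). cst (sk nu la) * hl.Plam nu))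
         = (\<Sum>nu\<in>above la (r - i). cst ((-1) ^ i * sk nu la) * (ee i * hl.Plam nu))"
        by (simp add: sum_distrib_left cst_mult cst_power cst_minus mult_ac)
      also have "\<dots> = (\<Sum>nu\<in>above la (r - i). \<Sum>rho\<in>hl.strips_above nu i. g i nu rho)"
        by (rule sum.cong) (auto simp: above_def hl.ee_Plam sum_distrib_left g_def cst_mult mult.assoc)
      finally show ?thesis .
    qed
    have "(\<Sum>i\<le>r. (-1) ^ i * (ee i * (\<Sum>nu\<in>above la (r - i). cst (sk nu la) * hl.Plam nu))) = 0"
      unfolding step by (rule zero)
    then have "(\<Sum>i\<le>r. (-1) ^ i * (ee i * (\<Sum>nu\<in>above la (r - i). cst (sk nu la) * hl.Plam nu)))
       = (\<Sum>i\<le>r. (-1) ^ i * (ee i * (hh (r - i) * hl.Plam la)))" using zero' by simp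
    \<comment> \<open>The terms with i > 0 agree by induction, so equality of the whole sums leaves
      the i = 0 terms, which are the claim.\<close>
    moreover have "(\<Sum>i\<in>{Suc 0..r}. (-1) ^ i * (ee i * (\<Sum>nu\<in>above la (r - i). cst (sk nu la) * hl.Plam nu)))
       = (\<Sum>i\<in>{Suc 0..r}. (-1) ^ i * (ee i * (hh (r - i) * hl.Plam la)))"
      by (rule sum.cong) (use less.IH in auto)
    ultimately show ?thesis
      unfolding atMost_atLeast0 by (simp add: sum.atLeast_Suc_atMost)
  qed
qed

section \<open>The skew Pieri rule\<close>

theorem theorem3:
  fixes la mu :: "nat list" and r :: nat
  assumes "is_partition la" and "is_partition mu" and "contained mu la"
  shows "HL_P_skew la mu * schur [r] =
    (\<Sum>(lp, mm)\<in>{(lp, mm). is_partition lp \<and> is_partition mm \<and> contained la lp \<and>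
                           contained mm mu \<and> (psize lp - psize la) + (psize mu - psize mm) = r}.
       cst ((-1) ^ (psize mu - psize mm) * sk lp la * vs mu mm) * HL_P_skew lp mm)"
proof -
  note la = assms(1) and mu = assms(2)
  let ?S = "{(lp, mm). is_partition lp \<and> is_partition mm \<and> contained la lp \<and>
      contained mm mu \<and> (psize lp - psize la) + (psize mu - psize mm) = r}"
  let ?g = "\<lambda>j mm lp. cst ((-1) ^ j * sk lp la * vs mu mm) * HL_P_skew lp mm"
  have "HL_P_skew la mu * schur [r] = (\<Sum>j\<le>r. (-1) ^ j * perp (perp (ee j) (hl.Qlam mu)) (hh (r - j) * hl.Plam la))"
    by (simp only: HL_P_skew_eq[OF la mu] schur_single perp_mult_hh)
  also have "\<dots> = (\<Sum>j\<le>r. \<Sum>mm\<in>hl.strips_below mu j. \<Sum>lp\<in>above la (r - j). ?g j mm lp)"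
  proof (rule sum.cong[OF refl])
    fix j
    have "(-1) ^ j * perp (perp (ee j) (hl.Qlam mu)) (hh (r - j) * hl.Plam la)
       = (\<Sum>mm\<in>hl.strips_below mu j. \<Sum>lp\<in>above la (r - j).
          cst ((-1) ^ j * sk lp la * hl.vs_gen mu mm) * perp (hl.Qlam mm) (hl.Plam lp))"
      unfolding perp_ee_Qlam[OF mu] hh_Plam[OF la] perp_sum_left
      unfolding perp_sum_right perp_scale_left perp_scale_right sum_distrib_left
      by (simp only: cst_mult cst_power cst_minus cst_1 mult_ac)
    also have "\<dots> = (\<Sum>mm\<in>hl.strips_below mu j. \<Sum>lp\<in>above la (r - j). ?g j mm lp)"
      by (intro sum.cong refl)
        (simp add: above_def hl.strips_below_def HL_P_skew_eq vs_eq_vs_gen[OF mu])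
    finally show "(-1) ^ j * perp (perp (ee j) (hl.Qlam mu)) (hh (r - j) * hl.Plam la)
       = (\<Sum>mm\<in>hl.strips_below mu j. \<Sum>lp\<in>above la (r - j). ?g j mm lp)" .
  qed
  also have "\<dots> = (\<Sum>(j, mm, lp)\<in>(SIGMA j:{..r}. hl.strips_below mu j \<times> above la (r - j)). ?g j mm lp)"
    by (simp add: sum.Sigma sum.cartesian_product)
  also have "\<dots> = (\<Sum>(lp, mm)\<in>{(lp, mm)\<in>?S. vertical_strip mu mm}. ?g (psize mu - psize mm) mm lp)"
  proof (rule sum.reindex_bij_witness[of _ "\<lambda>(lp, mm). (psize mu - psize mm, mm, lp)" "\<lambda>(j, mm, lp). (lp, mm)"])
    fix p assume "p \<in> {(lp, mm)\<in>?S. vertical_strip mu mm}"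
    then obtain lp mm where p: "p = (lp, mm)" and *: "(lp, mm) \<in> ?S" "vertical_strip mu mm" by auto
    then have "psize la \<le> psize lp" "psize mm \<le> psize mu"
      using la mu contained_psize[of la lp] contained_psize[of mm mu] by auto
    then show "(case p of (lp, mm) \<Rightarrow> (psize mu - psize mm, mm, lp))
        \<in> (SIGMA j:{..r}. hl.strips_below mu j \<times> above la (r - j))"
      using * by (auto simp: p above_def hl.strips_below_def)
  qed (auto simp: above_def hl.strips_below_def vertical_strip_def)
  \<comment> \<open>The range grows from vertical strips to all contained partitions, where
    \<open>vs\<close> is 0 by definition.\<close>
  also have "\<dots> = (\<Sum>(lp, mm)\<in>?S. ?g (psize mu - psize mm) mm lp)"
  proof (rule sum.mono_neutral_left)
    have "?S \<subseteq> {lp. is_partition lp \<and> psize lp \<le> psize la + r} \<times> {mm. is_partition mm \<and> psize mm \<le> psize mu}"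
    proof
      fix p assume "p \<in> ?S"
      then obtain lp mm where p: "p = (lp, mm)" and *: "(lp, mm) \<in> ?S" by (cases p) auto
      then have "psize la \<le> psize lp" "psize mm \<le> psize mu"
        using la mu contained_psize[of la lp] contained_psize[of mm mu] by auto
      then show "p \<in> {lp. is_partition lp \<and> psize lp \<le> psize la + r} \<times> {mm. is_partition mm \<and> psize mm \<le> psize mu}"
        using * by (auto simp: p)
    qed
    then show "finite ?S" by (rule finite_subset) (intro finite_cartesian_product finite_partitions_le)
    show "\<forall>p\<in>?S - {(lp, mm)\<in>?S. vertical_strip mu mm}.
        (case p of (lp, mm) \<Rightarrow> ?g (psize mu - psize mm) mm lp) = 0"
      by (auto simp: vs_def split: if_splits)
  qed auto
  finally show ?thesis .
qed

end
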